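(* Let $k\ge 1$ be an integer, let $\Lambda$ be a finitely aligned $k$-graph, and let $\{D_v,R_\mu,f_\mu\}_{\mu\in\bigcup_{i=1}^k\Lambda^{e_i},\,v\in\Lambda^0}$ be a $\Lambda$-branching system on a measure space $(X,\eta)$. Then there exists a unique representation $\pi:C^*(\Lambda)\to B(L^2(X,\eta))$ such that $\pi(s_\mu)(\phi)=\Phi_{f_\mu^{-1}}^{1/2}\,(\phi\circ f_\mu^{-1})$ and $\pi(s_v)(\phi)=\chi_{D_v}\phi$ for all $\mu\in\bigcup_{i=1}^k\Lambda^{e_i}$, $v\in\Lambda^0$ and $\phi\in L^2(X,\eta)$.
   Context: $\mathbb{N}=\{0,1,2,\dots\}$, and $e_1,\dots,e_k$ is the standard basis of $\mathbb{N}^k$; for $n,m\in\mathbb{N}^k$, $n\vee m$ is the coordinatewise maximum. All measure spaces are assumed $\sigma$-finite. A $k$-graph is a countable small category $\Lambda$ (identified with its set of morphisms, with range and source maps $r,s$, and with composites $\mu\nu$ defined when $s(\mu)=r(\nu)$) together with a functor $d:\Lambda\to\mathbb{N}^k$ with the factorization property: whenever $d(\mu)=n+m$ there are unique $\nu,\alpha\in\Lambda$ with $d(\nu)=n$, $d(\alpha)=m$, $s(\nu)=r(\alpha)$, $\mu=\nu\alpha$. Put $\Lambda^n:=d^{-1}(n)$; $\Lambda^0$ is identified with the set of objects (vertices). For $v\in\Lambda^0$, $v\Lambda:=\{\mu: r(\mu)=v\}$ and $v\Lambda^n:=\{\mu\in\Lambda^n:r(\mu)=v\}$. For $\mu,\nu\in\Lambda$,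 $\Lambda^{\min}(\mu,\nu):=\{(\alpha,\beta)\in\Lambda\times\Lambda:\mu\alpha=\nu\beta,\ d(\mu\alpha)=d(\mu)\vee d(\nu)\}$. $\Lambda$ is finitely aligned if $\Lambda^{\min}(\mu,\nu)$ is finite for all $\mu,\nu$. A subset $E\subset v\Lambda$ is exhaustive for $v$ if for every $\mu\in v\Lambda$ there is $\nu\in E$ with $\Lambda^{\min}(\mu,\nu)\ne\emptyset$. For a finitely aligned $k$-graph $\Lambda$, a Cuntz–Krieger $\Lambda$-family in a C*-algebra is a family of partial isometries $\{S_\mu\}_{\mu\in\Lambda}$ such that: $\{S_v\}_{v\in\Lambda^0}$ are mutually orthogonal projections; $S_{\mu\nu}=S_\mu S_\nu$ if $s(\mu)=r(\nu)$; $S_\mu^*S_\nu=\sum_{(\alpha,\beta)\in\Lambda^{\min}(\mu,\nu)}S_\alpha S_\beta^*$ for all $\mu,\nu$; and $\prod_{\mu\in E}(S_v-S_\mu S_\mu^* )=0$ for all $v\in\Lambda^0$ and all finite exhaustive $E\subset v\Lambda$. $C^*(\Lambda)$ is the C*-algebra generated by a universal Cuntz–Krieger $\Lambda$-family $\{s_\mu\}_{\mu\in\Lambda}$. Let $(X,\eta)$ be a measure space. A $\Lambda$-branching system on $(X,\eta)$ is a family $\{D_v,R_\mu,f_\mu\}_{\mu\in\bigcup_{i=1}^k\Lambda^{e_i},\,v\in\Lambda^0}$, with $D_v,R_\mu$ measurable subsets of $X$, such that (all relations between sets and maps holding $\eta$-a.e.): (1) $R_\mu\cap R_\nu=\emptyset$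 a.e. if $\mu\neq\nu\in\Lambda^{e_i}$ for some $1\le i\le k$; (2) $D_v\cap D_w=\emptyset$ a.e. if $v\ne w\in\Lambda^0$; (3) $R_\mu\subseteq D_{r(\mu)}$ a.e. for all $\mu\in\bigcup_i\Lambda^{e_i}$; (4) for each $\mu\in\bigcup_i\Lambda^{e_i}$ there are measurable maps $f_\mu:D_{s(\mu)}\to R_\mu$ and $f_\mu^{-1}:R_\mu\to D_{s(\mu)}$ with $f_\mu\circ f_\mu^{-1}=\mathrm{id}_{R_\mu}$ a.e. and $f_\mu^{-1}\circ f_\mu=\mathrm{id}_{D_{s(\mu)}}$ a.e., such that the pushforward measure $\eta\circ f_\mu$ (the pushforward under $f_\mu^{-1}$) on $D_{s(\mu)}$ is absolutely continuous with respect to $\eta$ on $D_{s(\mu)}$, and the pushforward measure $\eta\circ f_\mu^{-1}$ (the pushforward under $f_\mu$) on $R_\mu$ is absolutely continuous with respect to $\eta$ on $R_\mu$; the Radon–Nikodym derivatives are denoted $\Phi_{f_\mu}:=d(\eta\circ f_\mu)/d\eta$ and $\Phi_{f_\mu^{-1}}:=d(\eta\circ f_\mu^{-1})/d\eta$; (5) if $\mu,\nu,\alpha,\beta\in\bigcup_i\Lambda^{e_i}$ and $\mu\nu=\alpha\beta$, then $f_\mu\circ f_\nu=f_\alpha\circ f_\beta$ a.e.; (6) if $\mu,\nu\in\bigcup_i\Lambda^{e_i}$, $r(\mu)=r(\nu)$ and $d(\mu)\ne d(\nu)$, then $f_\mu\big(D_{s(\mu)}\setminus\bigcup_{(\alpha,\beta)\in\Lambda^{\min}(\mu,\nu)}R_\alpha\big)\cap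 f_\nu\big(D_{s(\nu)}\setminus\bigcup_{(\alpha,\beta)\in\Lambda^{\min}(\mu,\nu)}R_\beta\big)=\emptyset$ a.e.; (7) for every $v\in\Lambda^0$ and every finite set $E\subset\bigcup_{i=1}^k v\Lambda^{e_i}$ that is exhaustive for $v$, $\bigcup_{\mu\in E}R_\mu=D_v$ a.e. Convention: the function $\Phi_{f_\mu^{-1}}^{1/2}(\phi\circ f_\mu^{-1})$, defined on $R_\mu$, is extended by $0$ to all of $X$. A representation is a $*$-homomorphism. *)

theory Defs
  imports "HOL-Analysis.Analysis" "HOL-Algebra.Module"
begin

section \<open>Higher-rank graphs\<close>

text \<open>
  A small category is identified with its set of morphisms. An object is identified with its
  identity morphism, so range and source map morphisms to (identity) morphisms. The composite
  \<open>cmp \<Lambda> \<mu> \<nu>\<close> is meaningful only when \<open>src \<Lambda> \<mu> = rng \<Lambda> \<nu>\<close>. The rank is \<open>k = CARD('k)\<close>, which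
  ranges over all integers \<open>\<ge> 1\<close>.
\<close>

record ('m, 'k::finite) kgraph =
  mor :: "'m set"
  rng :: "'m \<Rightarrow> 'm"
  src :: "'m \<Rightarrow> 'm"
  cmp :: "'m \<Rightarrow> 'm \<Rightarrow> 'm"
  deg :: "'m \<Rightarrow> nat ^ 'k"

locale k_graph =
  fixes \<Lambda> :: "('m, 'k::finite) kgraph"
  assumes countable_mor: "countable (mor \<Lambda>)"
    and rng_closed: "\<mu> \<in> mor \<Lambda> \<Longrightarrow> rng \<Lambda> \<mu> \<in> mor \<Lambda>"
    and src_closed: "\<mu> \<in> mor \<Lambda> \<Longrightarrow> src \<Lambda> \<mu> \<in> mor \<Lambda>"
    and rng_rng: "\<mu> \<in> mor \<Lambda> \<Longrightarrow> rng \<Lambda> (rng \<Lambda> \<mu>) = rng \<Lambda> \<mu>"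
    and src_rng: "\<mu> \<in> mor \<Lambda> \<Longrightarrow> src \<Lambda> (rng \<Lambda> \<mu>) = rng \<Lambda> \<mu>"
    and rng_src: "\<mu> \<in> mor \<Lambda> \<Longrightarrow> rng \<Lambda> (src \<Lambda> \<mu>) = src \<Lambda> \<mu>"
    and src_src: "\<mu> \<in> mor \<Lambda> \<Longrightarrow> src \<Lambda> (src \<Lambda> \<mu>) = src \<Lambda> \<mu>"
    and cmp_closed:
      "\<lbrakk>\<mu> \<in> mor \<Lambda>; \<nu> \<in> mor \<Lambda>; src \<Lambda> \<mu> = rng \<Lambda> \<nu>\<rbrakk> \<Longrightarrow> cmp \<Lambda> \<mu> \<nu> \<in> mor \<Lambda>"
    and rng_cmp:
      "\<lbrakk>\<mu> \<in> mor \<Lambda>; \<nu> \<in> mor \<Lambda>; src \<Lambda> \<mu> = rng \<Lambda> \<nu>\<rbrakk> \<Longrightarrow> rng \<Lambda> (cmp \<Lambda> \<mu> \<nu>) = rng \<Lambda> \<mu>"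
    and src_cmp:
      "\<lbrakk>\<mu> \<in> mor \<Lambda>; \<nu> \<in> mor \<Lambda>; src \<Lambda> \<mu> = rng \<Lambda> \<nu>\<rbrakk> \<Longrightarrow> src \<Lambda> (cmp \<Lambda> \<mu> \<nu>) = src \<Lambda> \<nu>"
    and cmp_assoc:
      "\<lbrakk>\<mu> \<in> mor \<Lambda>; \<nu> \<in> mor \<Lambda>; \<alpha> \<in> mor \<Lambda>; src \<Lambda> \<mu> = rng \<Lambda> \<nu>; src \<Lambda> \<nu> = rng \<Lambda> \<alpha>\<rbrakk> \<Longrightarrow>
        cmp \<Lambda> (cmp \<Lambda> \<mu> \<nu>) \<alpha> = cmp \<Lambda> \<mu> (cmp \<Lambda> \<nu> \<alpha>)"
    and cmp_rng: "\<mu> \<in> mor \<Lambda> \<Longrightarrow> cmp \<Lambda> (rng \<Lambda> \<mu>) \<mu> = \<mu>"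
    and cmp_src: "\<mu> \<in> mor \<Lambda> \<Longrightarrow> cmp \<Lambda> \<mu> (src \<Lambda> \<mu>) = \<mu>"
    and deg_rng: "\<mu> \<in> mor \<Lambda> \<Longrightarrow> deg \<Lambda> (rng \<Lambda> \<mu>) = 0"
    and deg_src: "\<mu> \<in> mor \<Lambda> \<Longrightarrow> deg \<Lambda> (src \<Lambda> \<mu>) = 0"
    and deg_cmp:
      "\<lbrakk>\<mu> \<in> mor \<Lambda>; \<nu> \<in> mor \<Lambda>; src \<Lambda> \<mu> = rng \<Lambda> \<nu>\<rbrakk> \<Longrightarrow>
        deg \<Lambda> (cmp \<Lambda> \<mu> \<nu>) = deg \<Lambda> \<mu> + deg \<Lambda> \<nu>"
    and factorization:
      "\<lbrakk>\<mu> \<in> mor \<Lambda>; deg \<Lambda> \<mu> = n + m\<rbrakk> \<Longrightarrow>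
        \<exists>!(\<nu>, \<alpha>). \<nu> \<in> mor \<Lambda> \<and> \<alpha> \<in> mor \<Lambda> \<and> deg \<Lambda> \<nu> = n \<and> deg \<Lambda> \<alpha> = m \<and>
          src \<Lambda> \<nu> = rng \<Lambda> \<alpha> \<and> \<mu> = cmp \<Lambda> \<nu> \<alpha>"

definition paths :: "('m, 'k::finite) kgraph \<Rightarrow> nat ^ 'k \<Rightarrow> 'm set" where
  "paths \<Lambda> n = {\<mu> \<in> mor \<Lambda>. deg \<Lambda> \<mu> = n}"

abbreviation vertices :: "('m, 'k::finite) kgraph \<Rightarrow> 'm set" where
  "vertices \<Lambda> \<equiv> paths \<Lambda> 0"

definition edges :: "('m, 'k::finite) kgraph \<Rightarrow> 'm set" where
  "edges \<Lambda> = (\<Union>i. paths \<Lambda> (axis i 1))"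

lemma (in k_graph) vertices_eq_objects: "vertices \<Lambda> = {v \<in> mor \<Lambda>. rng \<Lambda> v = v \<and> src \<Lambda> v = v}"
proof (intro equalityI subsetI)
  fix v assume "v \<in> vertices \<Lambda>"
  then have v: "v \<in> mor \<Lambda>" "deg \<Lambda> v = 0 + 0" by (auto simp: paths_def)
  let ?P = "\<lambda>p. case p of (\<nu>, \<alpha>) \<Rightarrow> \<nu> \<in> mor \<Lambda> \<and> \<alpha> \<in> mor \<Lambda> \<and> deg \<Lambda> \<nu> = 0 \<and>
    deg \<Lambda> \<alpha> = 0 \<and> src \<Lambda> \<nu> = rng \<Lambda> \<alpha> \<and> v = cmp \<Lambda> \<nu> \<alpha>"
  have ex: "\<exists>!p. ?P p" using factorization[OF v] by simp
  have "?P (rng \<Lambda> v, v)" "?P (v, src \<Lambda> v)"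
    using v by (simp_all add: rng_closed src_closed src_rng rng_src deg_rng deg_src cmp_rng cmp_src)
  with ex have "(rng \<Lambda> v, v) = (v, src \<Lambda> v)" by blast
  with v show "v \<in> {v \<in> mor \<Lambda>. rng \<Lambda> v = v \<and> src \<Lambda> v = v}" by simp
next
  fix v assume "v \<in> {v \<in> mor \<Lambda>. rng \<Lambda> v = v \<and> src \<Lambda> v = v}"
  then show "v \<in> vertices \<Lambda>" using deg_rng[of v] by (simp add: paths_def)
qed

definition Lambda_min :: "('m, 'k::finite) kgraph \<Rightarrow> 'm \<Rightarrow> 'm \<Rightarrow> ('m \<times> 'm) set" where
  "Lambda_min \<Lambda> \<mu> \<nu> = {(\<alpha>, \<beta>). \<alpha> \<in> mor \<Lambda> \<and> \<beta> \<in> mor \<Lambda> \<and>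
     src \<Lambda> \<mu> = rng \<Lambda> \<alpha> \<and> src \<Lambda> \<nu> = rng \<Lambda> \<beta> \<and> cmp \<Lambda> \<mu> \<alpha> = cmp \<Lambda> \<nu> \<beta> \<and>
     deg \<Lambda> (cmp \<Lambda> \<mu> \<alpha>) = (\<chi> i. max (deg \<Lambda> \<mu> $ i) (deg \<Lambda> \<nu> $ i))}"

locale finitely_aligned_k_graph = k_graph \<Lambda> for \<Lambda> :: "('m, 'k::finite) kgraph" +
  assumes finite_Lambda_min: "\<lbrakk>\<mu> \<in> mor \<Lambda>; \<nu> \<in> mor \<Lambda>\<rbrakk> \<Longrightarrow> finite (Lambda_min \<Lambda> \<mu> \<nu>)"

definition exhaustive :: "('m, 'k::finite) kgraph \<Rightarrow> 'm \<Rightarrow> 'm set \<Rightarrow> bool" where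
  "exhaustive \<Lambda> v E \<longleftrightarrow> E \<subseteq> {\<nu> \<in> mor \<Lambda>. rng \<Lambda> \<nu> = v} \<and>
     (\<forall>\<mu>\<in>mor \<Lambda>. rng \<Lambda> \<mu> = v \<longrightarrow> (\<exists>\<nu>\<in>E. Lambda_min \<Lambda> \<mu> \<nu> \<noteq> {}))"


section \<open>C*-algebras\<close>

text \<open>
  C*-algebras are carrier-based, because the algebras of operators on \<open>L\<^sup>2\<close> depend on a measure.
  They need not be unital: the field \<open>one\<close>, inherited from the record of modules, is left
  unconstrained.
\<close>

definition complex_ring :: "complex ring" where
  "complex_ring = \<lparr>carrier = UNIV, mult = (*), one = 1, zero = 0, add = (+)\<rparr>"

record 'a cstar = "(complex, 'a) module" +
  star :: "'a \<Rightarrow> 'a"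
  cnorm :: "'a \<Rightarrow> real"

locale cstar_algebra = Module.module complex_ring A for A :: "'a cstar" (structure) +
  assumes mult_closed: "\<lbrakk>a \<in> carrier A; b \<in> carrier A\<rbrakk> \<Longrightarrow> a \<otimes> b \<in> carrier A"
    and mult_assoc:
      "\<lbrakk>a \<in> carrier A; b \<in> carrier A; c \<in> carrier A\<rbrakk> \<Longrightarrow> (a \<otimes> b) \<otimes> c = a \<otimes> (b \<otimes> c)"
    and mult_add_left:
      "\<lbrakk>a \<in> carrier A; b \<in> carrier A; c \<in> carrier A\<rbrakk> \<Longrightarrow> (a \<oplus> b) \<otimes> c = a \<otimes> c \<oplus> b \<otimes> c"
    and mult_add_right:
      "\<lbrakk>a \<in> carrier A; b \<in> carrier A; c \<in> carrier A\<rbrakk> \<Longrightarrow> a \<otimes> (b \<oplus> c) = a \<otimes> b \<oplus> a \<otimes> c"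
    and smult_mult_left:
      "\<lbrakk>a \<in> carrier A; b \<in> carrier A\<rbrakk> \<Longrightarrow> (z \<odot> a) \<otimes> b = z \<odot> (a \<otimes> b)"
    and smult_mult_right:
      "\<lbrakk>a \<in> carrier A; b \<in> carrier A\<rbrakk> \<Longrightarrow> a \<otimes> (z \<odot> b) = z \<odot> (a \<otimes> b)"
    and star_closed: "a \<in> carrier A \<Longrightarrow> star A a \<in> carrier A"
    and star_star: "a \<in> carrier A \<Longrightarrow> star A (star A a) = a"
    and star_add:
      "\<lbrakk>a \<in> carrier A; b \<in> carrier A\<rbrakk> \<Longrightarrow> star A (a \<oplus> b) = star A a \<oplus> star A b"
    and star_smult: "a \<in> carrier A \<Longrightarrow> star A (z \<odot> a) = cnj z \<odot> star A a"
    and star_mult: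
      "\<lbrakk>a \<in> carrier A; b \<in> carrier A\<rbrakk> \<Longrightarrow> star A (a \<otimes> b) = star A b \<otimes> star A a"
    and cnorm_nonneg: "a \<in> carrier A \<Longrightarrow> 0 \<le> cnorm A a"
    and cnorm_eq_0: "a \<in> carrier A \<Longrightarrow> cnorm A a = 0 \<longleftrightarrow> a = \<zero>"
    and cnorm_add:
      "\<lbrakk>a \<in> carrier A; b \<in> carrier A\<rbrakk> \<Longrightarrow> cnorm A (a \<oplus> b) \<le> cnorm A a + cnorm A b"
    and cnorm_smult: "a \<in> carrier A \<Longrightarrow> cnorm A (z \<odot> a) = cmod z * cnorm A a"
    and cnorm_mult:
      "\<lbrakk>a \<in> carrier A; b \<in> carrier A\<rbrakk> \<Longrightarrow> cnorm A (a \<otimes> b) \<le> cnorm A a * cnorm A b"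
    and cstar_identity: "a \<in> carrier A \<Longrightarrow> cnorm A (star A a \<otimes> a) = (cnorm A a)\<^sup>2"
    and complete:
      "\<lbrakk>range x \<subseteq> carrier A; \<forall>e>0. \<exists>N. \<forall>m\<ge>N. \<forall>n\<ge>N. cnorm A (x m \<ominus> x n) < e\<rbrakk> \<Longrightarrow>
        \<exists>a\<in>carrier A. (\<lambda>n. cnorm A (x n \<ominus> a)) \<longlonglongrightarrow> 0"

text \<open>
  Homomorphisms are required to be \<open>undefined\<close> off the carrier, so that unique existence is not
  spoiled by junk values.
\<close>

definition star_hom :: "'a cstar \<Rightarrow> 'b cstar \<Rightarrow> ('a \<Rightarrow> 'b) set" where
  "star_hom A B = {\<pi> \<in> carrier A \<rightarrow>\<^sub>E carrier B.
     (\<forall>a\<in>carrier A. \<forall>b\<in>carrier A. \<pi> (a \<oplus>\<^bsub>A\<^esub> b) = \<pi> a \<oplus>\<^bsub>B\<^esub> \<pi> b) \<and>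
     (\<forall>z. \<forall>a\<in>carrier A. \<pi> (z \<odot>\<^bsub>A\<^esub> a) = z \<odot>\<^bsub>B\<^esub> \<pi> a) \<and>
     (\<forall>a\<in>carrier A. \<forall>b\<in>carrier A. \<pi> (a \<otimes>\<^bsub>A\<^esub> b) = \<pi> a \<otimes>\<^bsub>B\<^esub> \<pi> b) \<and>
     (\<forall>a\<in>carrier A. \<pi> (star A a) = star B (\<pi> a))}"

definition closed_star_subalgebra :: "'a cstar \<Rightarrow> 'a set \<Rightarrow> bool" where
  "closed_star_subalgebra A B \<longleftrightarrow> B \<subseteq> carrier A \<and> \<zero>\<^bsub>A\<^esub> \<in> B \<and>
     (\<forall>a\<in>B. \<forall>b\<in>B. a \<oplus>\<^bsub>A\<^esub> b \<in> B) \<and> (\<forall>z. \<forall>a\<in>B. z \<odot>\<^bsub>A\<^esub> a \<in> B) \<and>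
     (\<forall>a\<in>B. \<forall>b\<in>B. a \<otimes>\<^bsub>A\<^esub> b \<in> B) \<and> (\<forall>a\<in>B. star A a \<in> B) \<and>
     (\<forall>x a. range x \<subseteq> B \<longrightarrow> a \<in> carrier A \<longrightarrow>
        (\<lambda>n. cnorm A (x n \<ominus>\<^bsub>A\<^esub> a)) \<longlonglongrightarrow> 0 \<longrightarrow> a \<in> B)"

definition generates :: "'a cstar \<Rightarrow> 'a set \<Rightarrow> bool" where
  "generates A G \<longleftrightarrow> G \<subseteq> carrier A \<and>
     (\<forall>B. closed_star_subalgebra A B \<longrightarrow> G \<subseteq> B \<longrightarrow> B = carrier A)"


section \<open>Cuntz--Krieger families and the C*-algebra of a k-graph\<close>

text \<open>Product, in the order of the list, of a nonempty list of elements.\<close>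

fun list_mult :: "'a cstar \<Rightarrow> 'a list \<Rightarrow> 'a" where
  "list_mult A [] = undefined"
| "list_mult A [a] = a"
| "list_mult A (a # b # as) = a \<otimes>\<^bsub>A\<^esub> list_mult A (b # as)"

text \<open>
  In the last condition the list \<open>\<mu>s\<close> enumerates the finite exhaustive set \<open>E = set \<mu>s\<close>. Such a set
  is nonempty, and the factors commute by \<open>star_S_mult\<close>, so the product over \<open>E\<close> does not
  depend on the enumeration.
\<close>

locale cuntz_krieger_family = cstar_algebra B
  for \<Lambda> :: "('m, 'k::finite) kgraph" and B :: "'b cstar" (structure) +
  fixes S :: "'m \<Rightarrow> 'b"
  assumes S_closed: "\<mu> \<in> mor \<Lambda> \<Longrightarrow> S \<mu> \<in> carrier B"
    and partial_isometry: "\<mu> \<in> mor \<Lambda> \<Longrightarrow> S \<mu> \<otimes> star B (S \<mu>) \<otimes> S \<mu> = S \<mu>"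
    and vertex_projection:
      "v \<in> vertices \<Lambda> \<Longrightarrow> star B (S v) = S v" "v \<in> vertices \<Lambda> \<Longrightarrow> S v \<otimes> S v = S v"
    and vertex_orthogonal:
      "\<lbrakk>v \<in> vertices \<Lambda>; w \<in> vertices \<Lambda>; v \<noteq> w\<rbrakk> \<Longrightarrow> S v \<otimes> S w = \<zero>"
    and S_cmp:
      "\<lbrakk>\<mu> \<in> mor \<Lambda>; \<nu> \<in> mor \<Lambda>; src \<Lambda> \<mu> = rng \<Lambda> \<nu>\<rbrakk> \<Longrightarrow> S (cmp \<Lambda> \<mu> \<nu>) = S \<mu> \<otimes> S \<nu>"
    and star_S_mult:
      "\<lbrakk>\<mu> \<in> mor \<Lambda>; \<nu> \<in> mor \<Lambda>\<rbrakk> \<Longrightarrow>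
        star B (S \<mu>) \<otimes> S \<nu> = finsum B (\<lambda>(\<alpha>, \<beta>). S \<alpha> \<otimes> star B (S \<beta>)) (Lambda_min \<Lambda> \<mu> \<nu>)"
    and exhaustive_prod:
      "\<lbrakk>v \<in> vertices \<Lambda>; exhaustive \<Lambda> v (set \<mu>s); distinct \<mu>s\<rbrakk> \<Longrightarrow>
        list_mult B (map (\<lambda>\<mu>. S v \<ominus> S \<mu> \<otimes> star B (S \<mu>)) \<mu>s) = \<zero>"

text \<open>
  \<open>(A, s)\<close> is the C*-algebra of \<open>\<Lambda>\<close> with its universal Cuntz--Krieger family. HOL cannot quantify
  over types inside a formula, so the universal property is stated for all C*-algebras whose
  carrier is a set of elements of the type \<open>'b\<close>. As soon as \<open>'b\<close> has at least the cardinality of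
  the continuum this is the full universal property: a Cuntz--Krieger family in an arbitrary
  C*-algebra generates a separable C*-algebra (\<open>\<Lambda>\<close> is countable), which has an isomorphic copy
  carried by \<open>'b\<close>. Every type \<open>('x \<Rightarrow> complex) set \<Rightarrow> ('x \<Rightarrow> complex) set\<close> is that large.
  Uniqueness of the homomorphism is not demanded here, since it follows from generation.
\<close>

definition graph_cstar_algebra ::
    "'b itself \<Rightarrow> ('m, 'k::finite) kgraph \<Rightarrow> 'a cstar \<Rightarrow> ('m \<Rightarrow> 'a) \<Rightarrow> bool" where
  "graph_cstar_algebra (_ :: 'b itself) \<Lambda> A s \<longleftrightarrow>
     cuntz_krieger_family \<Lambda> A s \<and> generates A (s ` mor \<Lambda>) \<and>
     (\<forall>(B :: 'b cstar) t. cuntz_krieger_family \<Lambda> B t \<longrightarrow>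
        (\<exists>\<pi>\<in>star_hom A B. \<forall>\<mu>\<in>mor \<Lambda>. \<pi> (s \<mu>) = t \<mu>))"


section \<open>Square-integrable functions and bounded operators\<close>

record 'h inner_space = "(complex, 'h) module" +
  inner_prod :: "'h \<Rightarrow> 'h \<Rightarrow> complex"

definition hnorm :: "'h inner_space \<Rightarrow> 'h \<Rightarrow> real" where
  "hnorm H h = sqrt (Re (inner_prod H h h))"

definition square_integrable :: "'x measure \<Rightarrow> ('x \<Rightarrow> complex) set" where
  "square_integrable M = {\<phi> \<in> borel_measurable M. integrable M (\<lambda>x. (cmod (\<phi> x))\<^sup>2)}"

definition L2_class :: "'x measure \<Rightarrow> ('x \<Rightarrow> complex) \<Rightarrow> ('x \<Rightarrow> complex) set" where
  "L2_class M \<phi> = {\<psi> \<in> borel_measurable M. AE x in M. \<psi> x = \<phi> x}"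

definition L2_rep :: "('x \<Rightarrow> complex) set \<Rightarrow> 'x \<Rightarrow> complex" where
  "L2_rep a = (SOME \<phi>. \<phi> \<in> a)"

text \<open>The ring multiplication and unit of the module record play no role for a vector space.\<close>

definition L2 :: "'x measure \<Rightarrow> ('x \<Rightarrow> complex) set inner_space" where
  "L2 M = \<lparr>carrier = L2_class M ` square_integrable M,
     mult = undefined, one = undefined,
     zero = L2_class M (\<lambda>x. 0),
     add = (\<lambda>a b. L2_class M (\<lambda>x. L2_rep a x + L2_rep b x)),
     smult = (\<lambda>z a. L2_class M (\<lambda>x. z * L2_rep a x)),
     inner_prod = (\<lambda>a b. LINT x|M. L2_rep a x * cnj (L2_rep b x))\<rparr>"

definition bounded_operators :: "'h inner_space \<Rightarrow> ('h \<Rightarrow> 'h) set" where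
  "bounded_operators H = {T \<in> carrier H \<rightarrow>\<^sub>E carrier H.
     (\<forall>h\<in>carrier H. \<forall>k\<in>carrier H. T (h \<oplus>\<^bsub>H\<^esub> k) = T h \<oplus>\<^bsub>H\<^esub> T k) \<and>
     (\<forall>z. \<forall>h\<in>carrier H. T (z \<odot>\<^bsub>H\<^esub> h) = z \<odot>\<^bsub>H\<^esub> T h) \<and>
     (\<exists>C. \<forall>h\<in>carrier H. hnorm H (T h) \<le> C * hnorm H h)}"

definition operator_algebra :: "'h inner_space \<Rightarrow> ('h \<Rightarrow> 'h) cstar" where
  "operator_algebra H = \<lparr>carrier = bounded_operators H,
     mult = compose (carrier H),
     one = (\<lambda>h\<in>carrier H. h),
     zero = (\<lambda>h\<in>carrier H. \<zero>\<^bsub>H\<^esub>),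
     add = (\<lambda>S T. \<lambda>h\<in>carrier H. S h \<oplus>\<^bsub>H\<^esub> T h),
     smult = (\<lambda>z T. \<lambda>h\<in>carrier H. z \<odot>\<^bsub>H\<^esub> T h),
     star = (\<lambda>T. THE T'. T' \<in> bounded_operators H \<and>
       (\<forall>h\<in>carrier H. \<forall>k\<in>carrier H. inner_prod H (T h) k = inner_prod H h (T' k))),
     cnorm = (\<lambda>T. SUP h\<in>{h \<in> carrier H. hnorm H h \<le> 1}. hnorm H (T h))\<rparr>"


section \<open>Branching systems\<close>

text \<open>
  The maps \<open>f \<mu>\<close> and \<open>g \<mu>\<close> are \<open>f\<^sub>\<mu>\<close> and \<open>f\<^sub>\<mu>\<^sup>-\<^sup>1\<close>; their values off \<open>D (src \<Lambda> \<mu>)\<close> and \<open>R \<mu>\<close>,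
  respectively, are irrelevant.
\<close>

locale branching_system =
  fixes \<Lambda> :: "('m, 'k::finite) kgraph" and M :: "'x measure"
    and D R :: "'m \<Rightarrow> 'x set" and f g :: "'m \<Rightarrow> 'x \<Rightarrow> 'x"
  assumes D_sets: "v \<in> vertices \<Lambda> \<Longrightarrow> D v \<in> sets M"
    and R_sets: "\<mu> \<in> edges \<Lambda> \<Longrightarrow> R \<mu> \<in> sets M"
    and R_disjoint:
      "\<lbrakk>\<mu> \<in> paths \<Lambda> (axis i 1); \<nu> \<in> paths \<Lambda> (axis i 1); \<mu> \<noteq> \<nu>\<rbrakk> \<Longrightarrow>
        AE x in M. x \<notin> R \<mu> \<inter> R \<nu>"
    and D_disjoint:
      "\<lbrakk>v \<in> vertices \<Lambda>; w \<in> vertices \<Lambda>; v \<noteq> w\<rbrakk> \<Longrightarrow> AE x in M. x \<notin> D v \<inter> D w"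
    and R_subset_D:
      "\<mu> \<in> edges \<Lambda> \<Longrightarrow> AE x in M. x \<in> R \<mu> \<longrightarrow> x \<in> D (rng \<Lambda> \<mu>)"
    and f_measurable:
      "\<mu> \<in> edges \<Lambda> \<Longrightarrow>
        f \<mu> \<in> measurable (restrict_space M (D (src \<Lambda> \<mu>))) (restrict_space M (R \<mu>))"
    and g_measurable:
      "\<mu> \<in> edges \<Lambda> \<Longrightarrow>
        g \<mu> \<in> measurable (restrict_space M (R \<mu>)) (restrict_space M (D (src \<Lambda> \<mu>)))"
    and f_g: "\<mu> \<in> edges \<Lambda> \<Longrightarrow> AE x in M. x \<in> R \<mu> \<longrightarrow> f \<mu> (g \<mu> x) = x"
    and g_f: "\<mu> \<in> edges \<Lambda> \<Longrightarrow> AE x in M. x \<in> D (src \<Lambda> \<mu>) \<longrightarrow> g \<mu> (f \<mu> x) = x"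
    and g_absolutely_continuous:
      "\<mu> \<in> edges \<Lambda> \<Longrightarrow> absolutely_continuous (restrict_space M (D (src \<Lambda> \<mu>)))
        (distr (restrict_space M (R \<mu>)) (restrict_space M (D (src \<Lambda> \<mu>))) (g \<mu>))"
    and f_absolutely_continuous:
      "\<mu> \<in> edges \<Lambda> \<Longrightarrow> absolutely_continuous (restrict_space M (R \<mu>))
        (distr (restrict_space M (D (src \<Lambda> \<mu>))) (restrict_space M (R \<mu>)) (f \<mu>))"
    and f_commute:
      "\<lbrakk>\<mu> \<in> edges \<Lambda>; \<nu> \<in> edges \<Lambda>; \<alpha> \<in> edges \<Lambda>; \<beta> \<in> edges \<Lambda>;
        src \<Lambda> \<mu> = rng \<Lambda> \<nu>; src \<Lambda> \<alpha> = rng \<Lambda> \<beta>; cmp \<Lambda> \<mu> \<nu> = cmp \<Lambda> \<alpha> \<beta>\<rbrakk> \<Longrightarrow>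
        AE x in M. x \<in> D (src \<Lambda> \<nu>) \<longrightarrow> f \<mu> (f \<nu> x) = f \<alpha> (f \<beta> x)"
    and f_images_disjoint:
      "\<lbrakk>\<mu> \<in> edges \<Lambda>; \<nu> \<in> edges \<Lambda>; rng \<Lambda> \<mu> = rng \<Lambda> \<nu>; deg \<Lambda> \<mu> \<noteq> deg \<Lambda> \<nu>\<rbrakk> \<Longrightarrow>
        AE x in M. x \<notin> f \<mu> ` (D (src \<Lambda> \<mu>) - (\<Union>(\<alpha>, \<beta>)\<in>Lambda_min \<Lambda> \<mu> \<nu>. R \<alpha>)) \<inter>
                       f \<nu> ` (D (src \<Lambda> \<nu>) - (\<Union>(\<alpha>, \<beta>)\<in>Lambda_min \<Lambda> \<mu> \<nu>. R \<beta>))"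
    and exhaustive_union:
      "\<lbrakk>v \<in> vertices \<Lambda>; finite E; E \<subseteq> edges \<Lambda>; exhaustive \<Lambda> v E\<rbrakk> \<Longrightarrow>
        AE x in M. x \<in> (\<Union>\<mu>\<in>E. R \<mu>) \<longleftrightarrow> x \<in> D v"

text \<open>The Radon--Nikodym derivative of \<open>\<eta> \<circ> f\<^sub>\<mu>\<^sup>-\<^sup>1\<close> (the pushforward under \<open>f\<^sub>\<mu>\<close>) on \<open>R\<^sub>\<mu>\<close>.\<close>

definition branching_deriv ::
    "('m, 'k::finite) kgraph \<Rightarrow> 'x measure \<Rightarrow> ('m \<Rightarrow> 'x set) \<Rightarrow> ('m \<Rightarrow> 'x set) \<Rightarrow>
      ('m \<Rightarrow> 'x \<Rightarrow> 'x) \<Rightarrow> 'm \<Rightarrow> 'x \<Rightarrow> real" where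
  "branching_deriv \<Lambda> M D R f \<mu> x =
     enn2real (RN_deriv (restrict_space M (R \<mu>))
       (distr (restrict_space M (D (src \<Lambda> \<mu>))) (restrict_space M (R \<mu>)) (f \<mu>)) x)"

end

theory Submission
  imports Defs
begin

text \<open>
  Each edge \<open>e\<close> gives a weighted composition operator \<open>S\<^sub>e\<close> on \<open>L\<^sup>2\<close>, a partial isometry with range
  projection \<open>\<chi>\<^sub>R\<^sub>e\<close>. Discarding a null set that is invariant under all \<open>f\<^sub>e\<close> and \<open>f\<^sub>e\<^sup>-\<^sup>1\<close>, the relations of
  the branching system hold pointwise, so that every remaining point has an itinerary in \<open>\<Lambda>\<close>. The
  commuting squares make \<open>S\<^sub>\<mu>\<close> well defined for all paths, and its range projection is the indicator of
  the set of points whose itinerary starts with \<open>\<mu>\<close>. The Cuntz--Krieger relations for edges thereby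
  pass to all paths by combinatorics of itineraries: two paths on one itinerary have a minimal common
  extension on it, and an itinerary meets every finite exhaustive set. Universality yields the
  representation. It is unique because *-homomorphisms into operator algebras are continuous.
\<close>

section \<open>Hilbert spaces\<close>

text \<open>Two obstacles shape the proof. The relations hold only almost everywhere, while an
  itinerary is followed through arbitrarily long words of maps. As \<open>\<Lambda>\<close> is
  countable there are countably many words, and absolute continuity pulls null sets back along each
  letter. The good set is not shown to be measurable, so the itinerary sets serve only
  combinatorics; each range projection is carried by a measurable set that has the same good points.
  Second, the C*-algebras may lack a unit, and continuity of homomorphisms is proved without
  spectral theory. For self-adjoint \<open>b\<close> of norm at most 1/2, a contraction argument
  solves c = (b + c^2)/2, the unit-free form of (1 - c)^2 = 1 - b. Taking b = x^* x bounds the image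
  of x. The threshold 1/2 costs a factor 2 in the norm bound, which is harmless for
  continuity.\<close>

lemma complex_ring_simps [simp]:
  "carrier complex_ring = UNIV" "\<one>\<^bsub>complex_ring\<^esub> = 1" "\<zero>\<^bsub>complex_ring\<^esub> = 0"
  "x \<otimes>\<^bsub>complex_ring\<^esub> y = x * y" "x \<oplus>\<^bsub>complex_ring\<^esub> y = x + y"
  by (simp_all add: complex_ring_def)

lemma cring_complex_ring: "cring complex_ring"
proof (rule cringI)
  show "abelian_group complex_ring"
  proof (rule abelian_groupI)
    fix x assume "x \<in> carrier complex_ring"
    show "\<exists>y\<in>carrier complex_ring. y \<oplus>\<^bsub>complex_ring\<^esub> x = \<zero>\<^bsub>complex_ring\<^esub>"
      by (auto intro: exI[of _ "-x"])
  qed (auto simp: algebra_simps)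
  show "comm_monoid complex_ring"
    by (rule comm_monoidI) (auto simp: algebra_simps)
qed (auto simp: algebra_simps)

lemma complex_ring_minus [simp]: "\<ominus>\<^bsub>complex_ring\<^esub> z = - z"
proof -
  interpret cring complex_ring by (rule cring_complex_ring)
  have "\<ominus>\<^bsub>complex_ring\<^esub> z \<oplus>\<^bsub>complex_ring\<^esub> z = \<zero>\<^bsub>complex_ring\<^esub>"
    by (rule l_neg) simp
  then show ?thesis by (simp add: eq_neg_iff_add_eq_0)
qed

text \<open>Writing subtraction through addition and scalar multiplication lets every map that
  respects these two respect subtraction as well.\<close>

lemma complex_module_minus:
  assumes "Module.module complex_ring M" "x \<in> carrier M" "y \<in> carrier M"
  shows "x \<ominus>\<^bsub>M\<^esub> y = x \<oplus>\<^bsub>M\<^esub> (-1) \<odot>\<^bsub>M\<^esub> y"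
proof -
  interpret Module.module complex_ring M by (rule assms(1))
  show ?thesis using assms smult_l_minus[of 1 y] smult_one[of y] by (simp add: a_minus_def)
qed

lemma (in abelian_group) minus_add_minus:
  "\<lbrakk>x \<in> carrier G; y \<in> carrier G; z \<in> carrier G\<rbrakk> \<Longrightarrow> (x \<ominus> y) \<oplus> (y \<ominus> z) = x \<ominus> z"
  by (simp add: a_minus_def a_ac(1)) (simp add: a_ac(1)[symmetric] l_neg)

lemma (in abelian_group) eq_if_minus_zero:
  "\<lbrakk>x \<in> carrier G; y \<in> carrier G; x \<ominus> y = \<zero>\<rbrakk> \<Longrightarrow> x = y"
  by (metis a_inv_closed a_minus_def minus_equality minus_minus)

section \<open>Inner product geometry and the Riesz representation\<close>

locale hilbert_space = Module.module complex_ring H for H :: "'h inner_space" (structure) +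
  assumes inner_add_left:
      "\<lbrakk>h \<in> carrier H; k \<in> carrier H; l \<in> carrier H\<rbrakk> \<Longrightarrow>
        inner_prod H (h \<oplus> k) l = inner_prod H h l + inner_prod H k l"
    and inner_smult_left:
      "\<lbrakk>h \<in> carrier H; k \<in> carrier H\<rbrakk> \<Longrightarrow> inner_prod H (z \<odot> h) k = z * inner_prod H h k"
    and inner_commute:
      "\<lbrakk>h \<in> carrier H; k \<in> carrier H\<rbrakk> \<Longrightarrow> inner_prod H h k = cnj (inner_prod H k h)"
    and inner_self_nonneg: "h \<in> carrier H \<Longrightarrow> 0 \<le> Re (inner_prod H h h)"
    and inner_self_eq_0: "\<lbrakk>h \<in> carrier H; inner_prod H h h = 0\<rbrakk> \<Longrightarrow> h = \<zero>"
    and hnorm_complete: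
      "\<lbrakk>range x \<subseteq> carrier H; \<forall>e>0. \<exists>N. \<forall>m\<ge>N. \<forall>n\<ge>N. hnorm H (x m \<ominus> x n) < e\<rbrakk> \<Longrightarrow>
        \<exists>h\<in>carrier H. (\<lambda>n. hnorm H (x n \<ominus> h)) \<longlonglongrightarrow> 0"
begin

abbreviation ip :: "'h \<Rightarrow> 'h \<Rightarrow> complex" where "ip \<equiv> inner_prod H"
abbreviation nrm :: "'h \<Rightarrow> real" where "nrm \<equiv> hnorm H"

lemma smult_mem [simp, intro]: "h \<in> carrier H \<Longrightarrow> z \<odot> h \<in> carrier H"
  by (rule smult_closed) simp

lemma minus_smult: "\<lbrakk>h \<in> carrier H; k \<in> carrier H\<rbrakk> \<Longrightarrow> h \<ominus> k = h \<oplus> (-1) \<odot> k"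
  by (rule complex_module_minus) unfold_locales

lemma inner_add_right:
  "\<lbrakk>h \<in> carrier H; k \<in> carrier H; l \<in> carrier H\<rbrakk> \<Longrightarrow> ip l (h \<oplus> k) = ip l h + ip l k"
  by (metis M.a_closed complex_cnj_add inner_add_left inner_commute)

lemma inner_smult_right:
  "\<lbrakk>h \<in> carrier H; k \<in> carrier H\<rbrakk> \<Longrightarrow> ip k (z \<odot> h) = cnj z * ip k h"
  by (metis complex_cnj_mult inner_commute inner_smult_left smult_mem)

lemma inner_zero_left: "k \<in> carrier H \<Longrightarrow> ip \<zero> k = 0"
  using inner_add_left[of "\<zero>" "\<zero>" k] by simp

lemma inner_zero_right: "k \<in> carrier H \<Longrightarrow> ip k \<zero> = 0"
  by (metis M.zero_closed complex_cnj_zero inner_commute inner_zero_left)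

lemma inner_minus_left:
  "\<lbrakk>h \<in> carrier H; k \<in> carrier H; l \<in> carrier H\<rbrakk> \<Longrightarrow> ip (h \<ominus> k) l = ip h l - ip k l"
  by (simp add: minus_smult inner_add_left inner_smult_left)

lemma inner_minus_right:
  "\<lbrakk>h \<in> carrier H; k \<in> carrier H; l \<in> carrier H\<rbrakk> \<Longrightarrow> ip l (h \<ominus> k) = ip l h - ip l k"
  by (simp add: minus_smult inner_add_right inner_smult_right)

lemma inner_self_real: "h \<in> carrier H \<Longrightarrow> Im (ip h h) = 0"
  by (metis Reals_cnj_iff complex_is_Real_iff inner_commute)

lemma nrm_sq: "h \<in> carrier H \<Longrightarrow> (nrm h)\<^sup>2 = Re (ip h h)"
  by (simp add: hnorm_def inner_self_nonneg)

lemma inner_self: "h \<in> carrier H \<Longrightarrow> ip h h = complex_of_real ((nrm h)\<^sup>2)"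
  by (simp add: complex_eq_iff nrm_sq inner_self_real)

lemma nrm_nonneg: "h \<in> carrier H \<Longrightarrow> 0 \<le> nrm h"
  by (simp add: hnorm_def inner_self_nonneg)

lemma nrm_eq_0: "h \<in> carrier H \<Longrightarrow> nrm h = 0 \<longleftrightarrow> h = \<zero>"
  by (metis inner_self inner_self_eq_0 inner_zero_left M.zero_closed of_real_eq_0_iff zero_eq_power2)

lemma nrm_zero [simp]: "nrm \<zero> = 0"
  by (simp add: nrm_eq_0)

lemma nrm_smult: "h \<in> carrier H \<Longrightarrow> nrm (z \<odot> h) = cmod z * nrm h"
proof -
  assume h: "h \<in> carrier H"
  have "(nrm (z \<odot> h))\<^sup>2 = Re ((z * cnj z) * ip h h)"
    using h by (simp add: nrm_sq inner_smult_left inner_smult_right algebra_simps)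
  also have "\<dots> = (cmod z * nrm h)\<^sup>2"
    using h by (simp only: complex_norm_square[symmetric] inner_self power_mult_distrib
        of_real_mult[symmetric] Re_complex_of_real)
  finally show ?thesis
    using h by (simp add: nrm_nonneg power2_eq_iff_nonneg)
qed

lemma nrm_sq_add:
  "\<lbrakk>h \<in> carrier H; k \<in> carrier H\<rbrakk> \<Longrightarrow> (nrm (h \<oplus> k))\<^sup>2 = (nrm h)\<^sup>2 + 2 * Re (ip h k) + (nrm k)\<^sup>2"
  using inner_commute[of k h]
  by (simp add: nrm_sq inner_add_left inner_add_right)

lemma nrm_sq_minus:
  "\<lbrakk>h \<in> carrier H; k \<in> carrier H\<rbrakk> \<Longrightarrow> (nrm (h \<ominus> k))\<^sup>2 = (nrm h)\<^sup>2 - 2 * Re (ip h k) + (nrm k)\<^sup>2"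
  by (simp add: minus_smult nrm_sq_add nrm_smult inner_smult_right)

lemma Cauchy_Schwarz:
  assumes h: "h \<in> carrier H" and k: "k \<in> carrier H"
  shows "cmod (ip h k) \<le> nrm h * nrm k"
proof (cases "k = \<zero>")
  case True
  then show ?thesis using h by (simp add: inner_zero_right)
next
  case False
  \<comment> \<open>The coefficient of the orthogonal projection of \<open>h\<close> onto
    \<open>k\<close>; the claim is nonnegativity of the squared norm of
    \<open>h \<ominus> c \<odot> k\<close>.\<close>
  define c where "c = ip h k / (complex_of_real ((nrm k)\<^sup>2))"
  have pos: "(nrm k)\<^sup>2 > 0" using False k by (simp add: nrm_eq_0)
  have eq: "ip h k * cnj (ip h k) = complex_of_real ((cmod (ip h k))\<^sup>2)"
    by (rule complex_norm_square[symmetric])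
  have r: "Re (cnj c * ip h k) = (cmod (ip h k))\<^sup>2 / (nrm k)\<^sup>2"
    unfolding c_def complex_cnj_divide complex_cnj_complex_of_real times_divide_eq_left
    by (subst mult.commute, subst eq, subst of_real_divide[symmetric]) simp
  have n: "(cmod c)\<^sup>2 * (nrm k)\<^sup>2 = (cmod (ip h k))\<^sup>2 / (nrm k)\<^sup>2"
    using pos by (simp add: c_def norm_divide norm_power power_divide)
      (simp add: field_simps eval_nat_numeral)
  have "0 \<le> (nrm (h \<ominus> c \<odot> k))\<^sup>2" by simp
  also have "\<dots> = (nrm h)\<^sup>2 - 2 * Re (cnj c * ip h k) + (cmod c)\<^sup>2 * (nrm k)\<^sup>2"
    using h k by (simp add: nrm_sq_minus nrm_smult inner_smult_right power_mult_distrib)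
  also have "\<dots> = (nrm h)\<^sup>2 - (cmod (ip h k))\<^sup>2 / (nrm k)\<^sup>2"
    unfolding r n by simp
  finally have "(cmod (ip h k))\<^sup>2 \<le> (nrm h * nrm k)\<^sup>2"
    using pos by (simp add: field_simps power_mult_distrib)
  then show ?thesis
    by (rule power2_le_imp_le) (simp add: h k nrm_nonneg)
qed

lemma nrm_triangle:
  assumes h: "h \<in> carrier H" and k: "k \<in> carrier H"
  shows "nrm (h \<oplus> k) \<le> nrm h + nrm k"
proof (rule power2_le_imp_le)
  have "Re (ip h k) \<le> nrm h * nrm k"
    using Cauchy_Schwarz[OF h k] complex_Re_le_cmod[of "ip h k"] by linarith
  then show "(nrm (h \<oplus> k))\<^sup>2 \<le> (nrm h + nrm k)\<^sup>2"
    using h k by (simp add: nrm_sq_add power2_sum)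
qed (simp add: h k nrm_nonneg)

lemma nrm_minus_commute:
  "\<lbrakk>h \<in> carrier H; k \<in> carrier H\<rbrakk> \<Longrightarrow> nrm (h \<ominus> k) = nrm (k \<ominus> h)"
proof -
  assume a: "h \<in> carrier H" "k \<in> carrier H"
  have "(nrm (h \<ominus> k))\<^sup>2 = (nrm (k \<ominus> h))\<^sup>2"
    using a inner_commute[of h k] by (simp add: nrm_sq_minus)
  then show ?thesis using a by (simp add: nrm_nonneg power2_eq_iff_nonneg)
qed

lemma nrm_triangle_minus:
  "\<lbrakk>h \<in> carrier H; k \<in> carrier H; l \<in> carrier H\<rbrakk> \<Longrightarrow> nrm (h \<ominus> l) \<le> nrm (h \<ominus> k) + nrm (k \<ominus> l)"
  using nrm_triangle[of "h \<ominus> k" "k \<ominus> l"] minus_add_minus[of h k l] by simp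

lemma nrm_diff_le:
  assumes "h \<in> carrier H" "k \<in> carrier H"
  shows "nrm h \<le> nrm (h \<ominus> k) + nrm k"
  using nrm_triangle_minus[of h k "\<zero>"] assms by (simp add: minus_smult)

lemma eq_if_inner_eq:
  assumes "u \<in> carrier H" "w \<in> carrier H" "\<And>h. h \<in> carrier H \<Longrightarrow> ip h u = ip h w"
  shows "u = w"
proof -
  have "ip (u \<ominus> w) (u \<ominus> w) = 0"
    using assms by (simp add: inner_minus_right)
  then have "u \<ominus> w = \<zero>" using assms by (intro inner_self_eq_0) auto
  then show ?thesis by (rule M.eq_if_minus_zero[OF assms(1,2)])
qed

lemma eq_if_inner_eq':
  assumes "u \<in> carrier H" "w \<in> carrier H" "\<And>h. h \<in> carrier H \<Longrightarrow> ip u h = ip w h"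
  shows "u = w"
  using assms by (intro eq_if_inner_eq) (auto simp: inner_commute[of _ u] inner_commute[of _ w])

text \<open>The representing vector minimises \<open>\<parallel>h\<parallel>\<^sup>2 - 2 Re (F h)\<close>.\<close>

lemma Riesz_representation:
  fixes F :: "'h \<Rightarrow> complex"
  assumes F_add: "\<And>h k. \<lbrakk>h \<in> carrier H; k \<in> carrier H\<rbrakk> \<Longrightarrow> F (h \<oplus> k) = F h + F k"
    and F_smult: "\<And>z h. h \<in> carrier H \<Longrightarrow> F (z \<odot> h) = z * F h"
    and F_le: "\<And>h. h \<in> carrier H \<Longrightarrow> cmod (F h) \<le> C * nrm h"
  shows "\<exists>u\<in>carrier H. \<forall>h\<in>carrier H. F h = ip h u"
proof -
  define J where "J h = (nrm h)\<^sup>2 - 2 * Re (F h)" for h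
  define m where "m = Inf (J ` carrier H)"
  have ne: "J ` carrier H \<noteq> {}" by blast
  \<comment> \<open>Completing the square with \<open>(nrm h - C)\<^sup>2\<close> bounds
    \<open>J\<close> from below.\<close>
  have J_ge: "- C\<^sup>2 \<le> J h" if "h \<in> carrier H" for h
  proof -
    have "Re (F h) \<le> C * nrm h" using F_le[OF that] complex_Re_le_cmod[of "F h"] by linarith
    moreover have "0 \<le> (nrm h - C)\<^sup>2" by simp
    ultimately show ?thesis by (simp add: J_def power2_diff algebra_simps)
  qed
  have bdd: "bdd_below (J ` carrier H)" using J_ge by (auto intro!: bdd_belowI[of _ "- C\<^sup>2"])
  have m_le: "m \<le> J h" if "h \<in> carrier H" for h
    unfolding m_def using bdd that by (auto intro: cInf_lower)
  have "\<exists>h\<in>carrier H. J h < m + 1 / Suc n" for n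
  proof -
    have "Inf (J ` carrier H) < m + 1 / Suc n" by (simp add: m_def)
    then show ?thesis using cInf_lessD[OF ne] by auto
  qed
  then obtain x where x: "\<And>n. x n \<in> carrier H" "\<And>n. J (x n) < m + 1 / Suc n" by metis
  have F_minus: "F (h \<ominus> k) = F h - F k" if "h \<in> carrier H" "k \<in> carrier H" for h k
    using that by (simp add: minus_smult F_add F_smult)
  \<comment> \<open>The midpoint has \<open>J\<close> at least \<open>m\<close>; with the
    parallelogram law this bounds the distance of two near-minimisers, so a minimising sequence is
    Cauchy.\<close>
  have par: "(nrm (h \<ominus> k))\<^sup>2 \<le> 2 * J h + 2 * J k - 4 * m"
    if h: "h \<in> carrier H" and k: "k \<in> carrier H" for h k
  proof -
    have "m \<le> J ((1/2) \<odot> (h \<oplus> k))" by (rule m_le) (use h k in auto)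
    also have "\<dots> = (nrm h)\<^sup>2 / 4 + Re (ip h k) / 2 + (nrm k)\<^sup>2 / 4 - Re (F h) - Re (F k)"
      using h k by (simp add: J_def nrm_smult F_smult F_add power_mult_distrib nrm_sq_add
          power_divide norm_divide Re_divide_numeral) (simp add: field_simps)
    finally show ?thesis using h k by (simp add: nrm_sq_minus J_def)
  qed
  have par_x: "(nrm (x i \<ominus> x j))\<^sup>2 \<le> 2 / Suc i + 2 / Suc j" for i j
    using par[OF x(1) x(1), of i j] x(2)[of i] x(2)[of j] by simp
  have "\<exists>h\<in>carrier H. (\<lambda>n. nrm (x n \<ominus> h)) \<longlonglongrightarrow> 0"
  proof (rule hnorm_complete)
    show "\<forall>e>0. \<exists>N. \<forall>i\<ge>N. \<forall>j\<ge>N. nrm (x i \<ominus> x j) < e"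
    proof (intro allI impI)
      fix e :: real assume "e > 0"
      then obtain N where N: "inverse (real (Suc N)) < e\<^sup>2 / 4"
        using reals_Archimedean[of "e\<^sup>2 / 4"] by auto
      have "nrm (x i \<ominus> x j) < e" if "i \<ge> N" "j \<ge> N" for i j
      proof (rule power2_less_imp_less)
        have "2 / real (Suc i) \<le> 2 / real (Suc N)" "2 / real (Suc j) \<le> 2 / real (Suc N)"
          using that by (auto intro!: divide_left_mono)
        then show "(nrm (x i \<ominus> x j))\<^sup>2 < e\<^sup>2"
          using par_x[of i j] N by (simp add: inverse_eq_divide)
      qed (use \<open>e > 0\<close> in simp)
      then show "\<exists>N. \<forall>i\<ge>N. \<forall>j\<ge>N. nrm (x i \<ominus> x j) < e" by blast
    qed
  qed (use x in auto)
  then obtain u where u: "u \<in> carrier H" and lim: "(\<lambda>n. nrm (x n \<ominus> u)) \<longlonglongrightarrow> 0" by blast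
  have "(\<lambda>n. J (x n)) \<longlonglongrightarrow> J u"
  proof -
    \<comment> \<open>Expansion of \<open>J\<close> around \<open>u\<close>: all three error terms
      vanish with the norm of \<open>x n \<ominus> u\<close>.\<close>
    have eq: "J (x n) = J u + (nrm (x n \<ominus> u))\<^sup>2 + 2 * Re (ip (x n \<ominus> u) u) - 2 * Re (F (x n \<ominus> u))" for n
    proof -
      have "Re (ip u u) = (nrm u)\<^sup>2" using u by (simp add: nrm_sq)
      then show ?thesis
        using u x(1)[of n] by (simp add: J_def nrm_sq_minus inner_minus_left F_minus)
    qed
    have "(\<lambda>n. Re (ip (x n \<ominus> u) u)) \<longlonglongrightarrow> 0"
    proof (rule Lim_null_comparison)
      show "\<forall>\<^sub>F n in sequentially. norm (Re (ip (x n \<ominus> u) u)) \<le> nrm (x n \<ominus> u) * nrm u"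
        using Cauchy_Schwarz[OF _ u] x(1) u
        by (intro always_eventually allI order_trans[OF _ Cauchy_Schwarz]) (auto simp: abs_Re_le_cmod)
      show "(\<lambda>n. nrm (x n \<ominus> u) * nrm u) \<longlonglongrightarrow> 0" by (rule tendsto_mult_left_zero[OF lim])
    qed
    moreover have "(\<lambda>n. Re (F (x n \<ominus> u))) \<longlonglongrightarrow> 0"
    proof (rule Lim_null_comparison)
      show "\<forall>\<^sub>F n in sequentially. norm (Re (F (x n \<ominus> u))) \<le> C * nrm (x n \<ominus> u)"
        using x(1) u
        by (intro always_eventually allI order_trans[OF _ F_le]) (auto simp: abs_Re_le_cmod)
      show "(\<lambda>n. C * nrm (x n \<ominus> u)) \<longlonglongrightarrow> 0" by (rule tendsto_mult_right_zero[OF lim])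
    qed
    moreover have "(\<lambda>n. (nrm (x n \<ominus> u))\<^sup>2) \<longlonglongrightarrow> 0" using tendsto_power[OF lim, of 2] by simp
    ultimately have "(\<lambda>n. J (x n)) \<longlonglongrightarrow> J u + 0 + 2 * 0 - 2 * 0"
      unfolding eq by (intro tendsto_intros)
    then show ?thesis by simp
  qed
  moreover have "(\<lambda>n. m + 1 / Suc n) \<longlonglongrightarrow> m + 0"
    by (intro tendsto_intros LIMSEQ_Suc lim_inverse_n')
  ultimately have "J u \<le> m + 0"
    by (rule LIMSEQ_le) (use x(2) in \<open>auto intro: less_imp_le\<close>)
  then have Ju: "J u \<le> J h" if "h \<in> carrier H" for h using m_le[OF that] by simp
  have re: "Re (F h) = Re (ip h u)" if h: "h \<in> carrier H" for h
  proof -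
    define a where "a = Re (ip h u) - Re (F h)"
    \<comment> \<open>Minimality of \<open>u\<close> along the line u + t h: the increment of
      \<open>J\<close> is this quadratic in \<open>t\<close>.\<close>
    have "0 \<le> t\<^sup>2 * (nrm h)\<^sup>2 + 2 * t * a" for t :: real
    proof -
      have "J u \<le> J (u \<oplus> complex_of_real t \<odot> h)" by (rule Ju) (use u h in auto)
      moreover have "Re (ip u h) = Re (ip h u)" using inner_commute[OF u h] by simp
      ultimately show ?thesis
        using u h by (simp add: J_def F_add F_smult nrm_sq_add nrm_smult inner_smult_right
            power_mult_distrib a_def algebra_simps)
    qed
    note nonneg = this
    \<comment> \<open>At \<open>t = - a * q\<close> the quadratic is at most
      \<open>- q * a\<^sup>2\<close>. The added 1 in the denominator keeps \<open>q\<close> defined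
      when \<open>h\<close> is zero.\<close>
    define q where "q = 1 / ((nrm h)\<^sup>2 + 1)"
    have "(nrm h)\<^sup>2 + 1 > 0" by (simp add: add_nonneg_pos)
    then have q: "q > 0" "q * (nrm h)\<^sup>2 \<le> 1" by (simp_all add: q_def field_simps)
    have "0 \<le> q * (a\<^sup>2 * (q * (nrm h)\<^sup>2) - 2 * a\<^sup>2)"
      using nonneg[of "- a * q"] by (simp add: power2_eq_square algebra_simps)
    then have "0 \<le> a\<^sup>2 * (q * (nrm h)\<^sup>2) - 2 * a\<^sup>2"
      using q(1) by (simp add: zero_le_mult_iff)
    moreover have "a\<^sup>2 * (q * (nrm h)\<^sup>2) \<le> a\<^sup>2 * 1"
      using q(2) by (intro mult_left_mono) auto
    ultimately have "a\<^sup>2 \<le> 0" by linarith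
    then show ?thesis by (simp add: a_def)
  qed
  \<comment> \<open>Imaginary parts are obtained from real parts at
    \<open>\<i> \<odot> h\<close>.\<close>
  have "F h = ip h u" if h: "h \<in> carrier H" for h
    using re[OF h] re[of "\<i> \<odot> h"] h u
    by (simp add: complex_eq_iff F_smult inner_smult_left)
  with u show ?thesis by blast
qed

end

section \<open>The C*-algebra of bounded operators\<close>

lemma operator_algebra_simps [simp]:
  "carrier (operator_algebra H) = bounded_operators H"
  "\<zero>\<^bsub>operator_algebra H\<^esub> = (\<lambda>h\<in>carrier H. \<zero>\<^bsub>H\<^esub>)"
  "h \<in> carrier H \<Longrightarrow> (S \<otimes>\<^bsub>operator_algebra H\<^esub> T) h = S (T h)"
  "h \<in> carrier H \<Longrightarrow> (S \<oplus>\<^bsub>operator_algebra H\<^esub> T) h = S h \<oplus>\<^bsub>H\<^esub> T h"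
  "h \<in> carrier H \<Longrightarrow> (z \<odot>\<^bsub>operator_algebra H\<^esub> T) h = z \<odot>\<^bsub>H\<^esub> T h"
  by (simp_all add: operator_algebra_def compose_def)

context hilbert_space
begin

lemma smult_1 [simp]: "h \<in> carrier H \<Longrightarrow> 1 \<odot> h = h"
  using smult_one[of h] by simp

section \<open>Bounded operators, the operator norm and adjoints\<close>

abbreviation BH :: "('h \<Rightarrow> 'h) cstar" where "BH \<equiv> operator_algebra H"
abbreviation bop :: "('h \<Rightarrow> 'h) set" where "bop \<equiv> bounded_operators H"

lemma bop_mem [simp]: "\<lbrakk>T \<in> bop; h \<in> carrier H\<rbrakk> \<Longrightarrow> T h \<in> carrier H"
  by (auto simp: bounded_operators_def)

lemma bop_add: "\<lbrakk>T \<in> bop; h \<in> carrier H; k \<in> carrier H\<rbrakk> \<Longrightarrow> T (h \<oplus> k) = T h \<oplus> T k"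
  by (auto simp: bounded_operators_def)

lemma bop_smult: "\<lbrakk>T \<in> bop; h \<in> carrier H\<rbrakk> \<Longrightarrow> T (z \<odot> h) = z \<odot> T h"
  by (auto simp: bounded_operators_def)

lemma bop_bound:
  assumes "T \<in> bop"
  obtains C where "0 \<le> C" "\<And>h. h \<in> carrier H \<Longrightarrow> nrm (T h) \<le> C * nrm h"
proof -
  from assms obtain C where C: "\<forall>h\<in>carrier H. nrm (T h) \<le> C * nrm h"
    by (auto simp: bounded_operators_def)
  have "nrm (T h) \<le> max C 0 * nrm h" if "h \<in> carrier H" for h
    using bspec[OF C that] mult_right_mono[of C "max C 0" "nrm h"] nrm_nonneg[OF that] by linarith
  then show ?thesis by (intro that[of "max C 0"]) auto
qed

lemma bopI:
  assumes "T \<in> extensional (carrier H)"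
    and "\<And>h. h \<in> carrier H \<Longrightarrow> T h \<in> carrier H"
    and "\<And>h k. \<lbrakk>h \<in> carrier H; k \<in> carrier H\<rbrakk> \<Longrightarrow> T (h \<oplus> k) = T h \<oplus> T k"
    and "\<And>z h. h \<in> carrier H \<Longrightarrow> T (z \<odot> h) = z \<odot> T h"
    and "\<And>h. h \<in> carrier H \<Longrightarrow> nrm (T h) \<le> C * nrm h"
  shows "T \<in> bop"
  unfolding bounded_operators_def mem_Collect_eq PiE_def
  by (intro conjI IntI Pi_I ballI allI exI[of _ C]) (fact assms)+

lemma bop_eqI:
  assumes "T \<in> bop" "U \<in> bop" "\<And>h. h \<in> carrier H \<Longrightarrow> T h = U h"
  shows "T = U"
  using assms by (auto simp: bounded_operators_def intro: PiE_ext)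

lemma bop_eq_innerI:
  assumes "T \<in> bop" "U \<in> bop" "\<And>h k. \<lbrakk>h \<in> carrier H; k \<in> carrier H\<rbrakk> \<Longrightarrow> ip h (T k) = ip h (U k)"
  shows "T = U"
  by (rule bop_eqI) (use assms in \<open>auto intro!: eq_if_inner_eq\<close>)

lemma bop_bdd_above:
  assumes "T \<in> bop"
  shows "bdd_above ((\<lambda>h. nrm (T h)) ` {h \<in> carrier H. nrm h \<le> 1})"
proof -
  obtain C where C: "0 \<le> C" "\<And>h. h \<in> carrier H \<Longrightarrow> nrm (T h) \<le> C * nrm h"
    using bop_bound[OF assms] by blast
  have "nrm (T h) \<le> C" if "h \<in> carrier H" "nrm h \<le> 1" for h
    using C(2)[OF that(1)] mult_left_mono[OF that(2) C(1)] by simp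
  then show ?thesis by (auto intro!: bdd_aboveI[of _ C])
qed

lemma cnorm_BH: "cnorm BH T = (SUP h\<in>{h \<in> carrier H. nrm h \<le> 1}. nrm (T h))"
  by (simp add: operator_algebra_def)

lemma opnorm_nonneg: "T \<in> bop \<Longrightarrow> 0 \<le> cnorm BH T"
  unfolding cnorm_BH
  by (rule cSUP_upper2[where x = "\<zero>"]) (auto simp: bop_bdd_above nrm_nonneg)

lemma opnorm_bound:
  assumes T: "T \<in> bop" and h: "h \<in> carrier H"
  shows "nrm (T h) \<le> cnorm BH T * nrm h"
proof (cases "h = \<zero>")
  case True
  have "T \<zero> = \<zero>"
    using bop_smult[OF T, of "\<zero>" 0] T by (metis M.zero_closed bop_mem complex_ring_simps(3) smult_l_null)
  then show ?thesis using True by simp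
next
  case False
  then have pos: "nrm h > 0" using h nrm_eq_0 nrm_nonneg by (metis less_eq_real_def)
  define k where "k = complex_of_real (1 / nrm h) \<odot> h"
  have k: "k \<in> carrier H" "nrm k \<le> 1" using h pos by (auto simp: k_def nrm_smult norm_divide)
  have "nrm (T k) \<le> cnorm BH T"
    unfolding cnorm_BH by (rule cSUP_upper) (use k bop_bdd_above[OF T] in auto)
  moreover have "nrm (T k) = nrm (T h) / nrm h"
    using h pos T by (simp add: k_def bop_smult nrm_smult norm_divide)
  ultimately show ?thesis using pos by (simp add: field_simps)
qed

lemma opnorm_le:
  assumes "0 \<le> C" "\<And>h. h \<in> carrier H \<Longrightarrow> nrm (T h) \<le> C * nrm h"
  shows "cnorm BH T \<le> C"
  unfolding cnorm_BH
proof (rule cSUP_least)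
  show "{h \<in> carrier H. nrm h \<le> 1} \<noteq> {}" by (auto intro!: exI[of _ "\<zero>"])
  fix h assume "h \<in> {h \<in> carrier H. nrm h \<le> 1}"
  then show "nrm (T h) \<le> C"
    using assms(2)[of h] mult_left_mono[of "nrm h" 1 C] assms(1) by auto
qed

text \<open>For fixed \<open>k\<close> the functional sending \<open>h\<close> to
  \<open>ip (T h) k\<close> is bounded, so its Riesz vector serves as the value of the adjoint at
  \<open>k\<close>. Linearity in \<open>k\<close> follows because inner products determine
  vectors.\<close>

lemma ex_adjoint:
  assumes T: "T \<in> bop"
  shows "\<exists>T'\<in>bop. \<forall>h\<in>carrier H. \<forall>k\<in>carrier H. ip (T h) k = ip h (T' k)"
proof -
  obtain C where C: "0 \<le> C" "\<And>h. h \<in> carrier H \<Longrightarrow> nrm (T h) \<le> C * nrm h"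
    using bop_bound[OF T] by blast
  have "\<exists>u\<in>carrier H. \<forall>h\<in>carrier H. ip (T h) k = ip h u" if k: "k \<in> carrier H" for k
  proof (rule Riesz_representation)
    fix h assume h: "h \<in> carrier H"
    have "cmod (ip (T h) k) \<le> nrm (T h) * nrm k" using T h k by (intro Cauchy_Schwarz) auto
    also have "\<dots> \<le> (C * nrm k) * nrm h"
      using mult_right_mono[OF C(2)[OF h] nrm_nonneg[OF k]] by (simp add: mult_ac)
    finally show "cmod (ip (T h) k) \<le> (C * nrm k) * nrm h" .
  qed (use T k in \<open>auto simp: bop_add bop_smult inner_add_left inner_smult_left\<close>)
  then obtain U where U: "\<And>k. k \<in> carrier H \<Longrightarrow> U k \<in> carrier H"
    "\<And>h k. \<lbrakk>h \<in> carrier H; k \<in> carrier H\<rbrakk> \<Longrightarrow> ip (T h) k = ip h (U k)" by metis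
  have "restrict U (carrier H) \<in> bop"
  proof (rule bopI)
    fix h k assume hk: "h \<in> carrier H" "k \<in> carrier H"
    have "U (h \<oplus> k) = U h \<oplus> U k"
      by (rule eq_if_inner_eq) (use hk T in \<open>auto simp: U(1) inner_add_right U(2)[symmetric]\<close>)
    then show "restrict U (carrier H) (h \<oplus> k) = restrict U (carrier H) h \<oplus> restrict U (carrier H) k"
      using hk by simp
  next
    fix z h assume h: "h \<in> carrier H"
    have "U (z \<odot> h) = z \<odot> U h"
      by (rule eq_if_inner_eq) (use h T in \<open>auto simp: U(1) inner_smult_right U(2)[symmetric]\<close>)
    then show "restrict U (carrier H) (z \<odot> h) = z \<odot> restrict U (carrier H) h"
      using h by simp
  next
    fix h assume h: "h \<in> carrier H"
    \<comment> \<open>The defining identity at \<open>U h\<close> bounds the square of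
      \<open>nrm (U h)\<close> by \<open>C * nrm (U h) * nrm h\<close>; one factor is then
      cancelled.\<close>
    have "(nrm (U h))\<^sup>2 = cmod (ip (T (U h)) h)"
      using h U by (simp add: inner_self norm_power nrm_nonneg)
    also have "\<dots> \<le> nrm (T (U h)) * nrm h" using T U h by (intro Cauchy_Schwarz) auto
    also have "\<dots> \<le> C * nrm (U h) * nrm h" using C U h by (intro mult_right_mono nrm_nonneg) auto
    finally have "nrm (U h) * nrm (U h) \<le> nrm (U h) * (C * nrm h)"
      by (simp add: power2_eq_square mult_ac)
    then have "nrm (U h) \<le> C * nrm h"
      using nrm_nonneg[OF U(1)[OF h]] nrm_nonneg[OF h] C(1)
      by (cases "nrm (U h) = 0") (auto simp: mult_le_cancel_left_pos order.strict_iff_order)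
    then show "nrm (restrict U (carrier H) h) \<le> C * nrm h" using h by simp
  qed (use U in auto)
  then show ?thesis using U by (intro bexI[of _ "restrict U (carrier H)"]) auto
qed

lemma adjoint_unique:
  assumes "T' \<in> bop" "T'' \<in> bop"
    and "\<And>h k. \<lbrakk>h \<in> carrier H; k \<in> carrier H\<rbrakk> \<Longrightarrow> ip (T h) k = ip h (T' k)"
    and "\<And>h k. \<lbrakk>h \<in> carrier H; k \<in> carrier H\<rbrakk> \<Longrightarrow> ip (T h) k = ip h (T'' k)"
  shows "T' = T''"
  using assms by (intro bop_eq_innerI) auto

text \<open>Every adjoint below is computed with this rule: a bounded candidate with the right inner
  products is exhibited, and uniqueness resolves the \<open>THE\<close> in
  \<open>operator_algebra\<close>.\<close>

lemma star_eqI: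
  assumes "T' \<in> bop"
    and "\<And>h k. \<lbrakk>h \<in> carrier H; k \<in> carrier H\<rbrakk> \<Longrightarrow> ip (T h) k = ip h (T' k)"
  shows "star BH T = T'"
  unfolding operator_algebra_def cstar.simps
  by (rule the_equality) (use assms adjoint_unique in blast)+

lemma
  assumes T: "T \<in> bop"
  shows star_bop [simp]: "star BH T \<in> bop"
    and star_inner: "\<And>h k. \<lbrakk>h \<in> carrier H; k \<in> carrier H\<rbrakk> \<Longrightarrow> ip (T h) k = ip h (star BH T k)"
proof -
  obtain T' where T': "T' \<in> bop" "\<And>h k. \<lbrakk>h \<in> carrier H; k \<in> carrier H\<rbrakk> \<Longrightarrow> ip (T h) k = ip h (T' k)"
    using ex_adjoint[OF T] by blast
  have eq: "star BH T = T'" by (rule star_eqI) (use T' in auto)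
  show "star BH T \<in> bop" using eq T' by simp
  show "ip (T h) k = ip h (star BH T k)" if "h \<in> carrier H" "k \<in> carrier H" for h k
    using eq T' that by simp
qed

lemma star_inner': 
  "\<lbrakk>T \<in> bop; h \<in> carrier H; k \<in> carrier H\<rbrakk> \<Longrightarrow> ip h (T k) = ip (star BH T h) k"
  by (metis bop_mem inner_commute star_bop star_inner)

lemma bop_mult [simp]: "\<lbrakk>T \<in> bop; U \<in> bop\<rbrakk> \<Longrightarrow> T \<otimes>\<^bsub>BH\<^esub> U \<in> bop"
proof -
  assume T: "T \<in> bop" and U: "U \<in> bop"
  show ?thesis
  proof (rule bopI)
    fix h assume h: "h \<in> carrier H"
    have "nrm (T (U h)) \<le> cnorm BH T * nrm (U h)" using T U h by (intro opnorm_bound) auto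
    also have "\<dots> \<le> cnorm BH T * (cnorm BH U * nrm h)"
      using T U h by (intro mult_left_mono opnorm_bound opnorm_nonneg) auto
    finally show "nrm ((T \<otimes>\<^bsub>BH\<^esub> U) h) \<le> (cnorm BH T * cnorm BH U) * nrm h" using h by (simp add: mult_ac)
  qed (use T U in \<open>auto simp: bop_add bop_smult\<close>, simp add: operator_algebra_def)
qed

lemma bop_plus [simp]: "\<lbrakk>T \<in> bop; U \<in> bop\<rbrakk> \<Longrightarrow> T \<oplus>\<^bsub>BH\<^esub> U \<in> bop"
proof -
  assume T: "T \<in> bop" and U: "U \<in> bop"
  show ?thesis
  proof (rule bopI)
    fix h assume h: "h \<in> carrier H"
    have "nrm (T h \<oplus> U h) \<le> nrm (T h) + nrm (U h)" using T U h by (intro nrm_triangle) auto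
    also have "\<dots> \<le> cnorm BH T * nrm h + cnorm BH U * nrm h"
      using T U h by (intro add_mono opnorm_bound) auto
    finally show "nrm ((T \<oplus>\<^bsub>BH\<^esub> U) h) \<le> (cnorm BH T + cnorm BH U) * nrm h"
      using h by (simp add: algebra_simps)
  qed (use T U in \<open>auto simp: bop_add bop_smult smult_r_distr M.a_ac\<close>, simp add: operator_algebra_def)
qed

lemma bop_scale [simp]: "T \<in> bop \<Longrightarrow> z \<odot>\<^bsub>BH\<^esub> T \<in> bop"
proof -
  assume T: "T \<in> bop"
  show ?thesis
  proof (rule bopI)
    fix h assume h: "h \<in> carrier H"
    show "nrm ((z \<odot>\<^bsub>BH\<^esub> T) h) \<le> (cmod z * cnorm BH T) * nrm h"
      using T h mult_left_mono[OF opnorm_bound[OF T h], of "cmod z"] by (simp add: nrm_smult mult_ac)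
  next
    fix w h assume h: "h \<in> carrier H"
    show "(z \<odot>\<^bsub>BH\<^esub> T) (w \<odot> h) = w \<odot> (z \<odot>\<^bsub>BH\<^esub> T) h"
      using T h smult_assoc1[of w z "T h"] smult_assoc1[of z w "T h"] by (simp add: bop_smult mult_ac)
  qed (use T in \<open>auto simp: bop_add smult_r_distr\<close>, simp add: operator_algebra_def)
qed

lemma bop_zero [simp]: "(\<lambda>h\<in>carrier H. \<zero>) \<in> bop"
  by (rule bopI[where C = 0]) auto

section \<open>The C*-algebra axioms for bounded operators\<close>

lemma module_BH: "Module.module complex_ring BH"
proof (rule moduleI[OF cring_complex_ring])
  show "abelian_group BH"
  proof (rule abelian_groupI)
    fix T assume "T \<in> carrier BH"
    then show "\<exists>U\<in>carrier BH. U \<oplus>\<^bsub>BH\<^esub> T = \<zero>\<^bsub>BH\<^esub>"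
      by (intro bexI[of _ "(-1) \<odot>\<^bsub>BH\<^esub> T"] bop_eqI)
        (auto simp: M.l_neg smult_l_minus[of 1, simplified])
  qed (auto intro!: bop_eqI simp: M.a_ac)
next
  fix a b T assume "T \<in> carrier BH"
  then have T: "T \<in> bop" by simp
  show "(a \<oplus>\<^bsub>complex_ring\<^esub> b) \<odot>\<^bsub>BH\<^esub> T = a \<odot>\<^bsub>BH\<^esub> T \<oplus>\<^bsub>BH\<^esub> b \<odot>\<^bsub>BH\<^esub> T"
    "(a \<otimes>\<^bsub>complex_ring\<^esub> b) \<odot>\<^bsub>BH\<^esub> T = a \<odot>\<^bsub>BH\<^esub> (b \<odot>\<^bsub>BH\<^esub> T)"
    "\<one>\<^bsub>complex_ring\<^esub> \<odot>\<^bsub>BH\<^esub> T = T"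
    using T smult_l_distr[of a b] smult_assoc1[of a b] smult_one by (auto intro!: bop_eqI)
qed (auto intro!: bop_eqI simp: smult_r_distr)

lemma minus_BH_apply:
  "\<lbrakk>T \<in> bop; U \<in> bop; h \<in> carrier H\<rbrakk> \<Longrightarrow> (T \<ominus>\<^bsub>BH\<^esub> U) h = T h \<ominus> U h"
  by (simp add: complex_module_minus[OF module_BH] minus_smult)

lemma bop_diff [simp]: "\<lbrakk>T \<in> bop; U \<in> bop\<rbrakk> \<Longrightarrow> T \<ominus>\<^bsub>BH\<^esub> U \<in> bop"
  by (simp add: complex_module_minus[OF module_BH])

lemma star_star_BH: "T \<in> bop \<Longrightarrow> star BH (star BH T) = T"
  by (rule star_eqI) (auto simp: star_inner' )

lemma opnorm_mult: 
  assumes "T \<in> bop" "U \<in> bop"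
  shows "cnorm BH (T \<otimes>\<^bsub>BH\<^esub> U) \<le> cnorm BH T * cnorm BH U"
proof (rule opnorm_le)
  fix h assume h: "h \<in> carrier H"
  have "nrm (T (U h)) \<le> cnorm BH T * nrm (U h)" using assms h by (intro opnorm_bound) auto
  also have "\<dots> \<le> cnorm BH T * (cnorm BH U * nrm h)"
    using assms h by (intro mult_left_mono opnorm_bound opnorm_nonneg) auto
  finally show "nrm ((T \<otimes>\<^bsub>BH\<^esub> U) h) \<le> cnorm BH T * cnorm BH U * nrm h" using h by (simp add: mult_ac)
qed (simp add: assms opnorm_nonneg)

text \<open>The squared norm of \<open>T h\<close> is the inner product of \<open>h\<close> with T^*
  T h, so Cauchy-Schwarz applies. This is the half of the C*-identity that submultiplicativity does
  not give.\<close>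

lemma opnorm_sq_le:
  assumes "T \<in> bop"
  shows "(cnorm BH T)\<^sup>2 \<le> cnorm BH (star BH T \<otimes>\<^bsub>BH\<^esub> T)"
proof -
  let ?c = "cnorm BH (star BH T \<otimes>\<^bsub>BH\<^esub> T)"
  have c: "0 \<le> ?c" using assms by (simp add: opnorm_nonneg)
  have "cnorm BH T \<le> sqrt ?c"
  proof (rule opnorm_le)
    fix h assume h: "h \<in> carrier H"
    have "(nrm (T h))\<^sup>2 = cmod (ip h ((star BH T \<otimes>\<^bsub>BH\<^esub> T) h))"
      using h assms by (simp add: inner_self nrm_nonneg norm_power star_inner[symmetric])
    also have "\<dots> \<le> nrm h * nrm ((star BH T \<otimes>\<^bsub>BH\<^esub> T) h)"
      by (rule Cauchy_Schwarz[OF h]) (use h assms in simp)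
    also have "\<dots> \<le> nrm h * (?c * nrm h)"
      by (rule mult_left_mono[OF opnorm_bound nrm_nonneg]) (use h assms in simp_all)
    also have "\<dots> = (sqrt ?c * nrm h)\<^sup>2" using c by (simp add: power_mult_distrib power2_eq_square)
    finally show "nrm (T h) \<le> sqrt ?c * nrm h"
      by (rule power2_le_imp_le) (use c h in \<open>auto simp: nrm_nonneg\<close>)
  qed (use c in auto)
  then have "(cnorm BH T)\<^sup>2 \<le> (sqrt ?c)\<^sup>2" using assms opnorm_nonneg by (intro power_mono) auto
  then show ?thesis using c by simp
qed

text \<open>Since |U|^2 \<le> |U^* U| \<le> |U^*| |U|, cancelling gives |U| \<le> |U^*|; this is
  applied to the adjoint of \<open>T\<close>.\<close>

lemma opnorm_star_le: "T \<in> bop \<Longrightarrow> cnorm BH (star BH T) \<le> cnorm BH T"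
proof -
  assume T: "T \<in> bop"
  have le: "cnorm BH U \<le> cnorm BH (star BH U)" if U: "U \<in> bop" for U
  proof -
    have "cnorm BH U * cnorm BH U \<le> cnorm BH (star BH U) * cnorm BH U"
      using opnorm_sq_le[OF U] opnorm_mult[of "star BH U" U] U by (simp add: power2_eq_square)
    then show ?thesis
      using opnorm_nonneg[OF U] opnorm_nonneg[of "star BH U"] U
      by (cases "cnorm BH U = 0") (auto simp: mult_le_cancel_right)
  qed
  from le[of "star BH T"] T show ?thesis by (simp add: star_star_BH)
qed

text \<open>The limit operator is the pointwise limit; it is a limit in norm because the Cauchy
  estimate is uniform relative to \<open>nrm h\<close>.\<close>

lemma opnorm_complete:
  assumes x: "range x \<subseteq> bop"
    and Cauchy: "\<forall>e>0. \<exists>N. \<forall>m\<ge>N. \<forall>n\<ge>N. cnorm BH (x m \<ominus>\<^bsub>BH\<^esub> x n) < e"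
  shows "\<exists>a\<in>bop. (\<lambda>n. cnorm BH (x n \<ominus>\<^bsub>BH\<^esub> a)) \<longlonglongrightarrow> 0"
proof -
  have x': "x n \<in> bop" for n using x by auto
  have diff: "nrm (x m h \<ominus> x n h) \<le> cnorm BH (x m \<ominus>\<^bsub>BH\<^esub> x n) * nrm h" if "h \<in> carrier H" for m n h
    using opnorm_bound[of "x m \<ominus>\<^bsub>BH\<^esub> x n" h] that x' by (simp add: minus_BH_apply)
  have "\<exists>l\<in>carrier H. (\<lambda>n. nrm (x n h \<ominus> l)) \<longlonglongrightarrow> 0" if h: "h \<in> carrier H" for h
  proof (rule hnorm_complete)
    show "\<forall>e>0. \<exists>N. \<forall>m\<ge>N. \<forall>n\<ge>N. nrm (x m h \<ominus> x n h) < e"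
    proof (intro allI impI)
      fix e :: real assume "e > 0"
      then have "e / (nrm h + 1) > 0" using nrm_nonneg[OF h] by simp
      then obtain N where N: "\<And>m n. \<lbrakk>m \<ge> N; n \<ge> N\<rbrakk> \<Longrightarrow> cnorm BH (x m \<ominus>\<^bsub>BH\<^esub> x n) < e / (nrm h + 1)"
        using Cauchy by blast
      have "nrm (x m h \<ominus> x n h) < e" if "m \<ge> N" "n \<ge> N" for m n
      proof -
        have "nrm (x m h \<ominus> x n h) \<le> e / (nrm h + 1) * nrm h"
          using diff[OF h, of m n] mult_right_mono[OF less_imp_le[OF N[OF that]] nrm_nonneg[OF h]]
          by linarith
        also have "\<dots> < e" using \<open>e > 0\<close> nrm_nonneg[OF h] by (simp add: field_simps)
        finally show ?thesis .
      qed
      then show "\<exists>N. \<forall>m\<ge>N. \<forall>n\<ge>N. nrm (x m h \<ominus> x n h) < e" by blast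
    qed
  qed (use x' h in auto)
  then obtain L where L: "\<And>h. h \<in> carrier H \<Longrightarrow> L h \<in> carrier H"
    "\<And>h. h \<in> carrier H \<Longrightarrow> (\<lambda>n. nrm (x n h \<ominus> L h)) \<longlonglongrightarrow> 0" by metis
  \<comment> \<open>Limits of inner products are unique and inner products determine vectors, so
    additivity and homogeneity pass to \<open>L\<close>.\<close>
  have lim_ip: "(\<lambda>n. ip (x n h) k) \<longlonglongrightarrow> ip (L h) k" if h: "h \<in> carrier H" and k: "k \<in> carrier H" for h k
  proof -
    have "(\<lambda>n. ip (x n h \<ominus> L h) k) \<longlonglongrightarrow> 0"
    proof (rule Lim_null_comparison)
      show "\<forall>\<^sub>F n in sequentially. norm (ip (x n h \<ominus> L h) k) \<le> nrm (x n h \<ominus> L h) * nrm k"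
        using L h k x' by (intro always_eventually allI Cauchy_Schwarz) auto
      show "(\<lambda>n. nrm (x n h \<ominus> L h) * nrm k) \<longlonglongrightarrow> 0" by (rule tendsto_mult_left_zero[OF L(2)[OF h]])
    qed
    then have "(\<lambda>n. ip (x n h) k - ip (L h) k) \<longlonglongrightarrow> 0"
      using L h k x' by (simp add: inner_minus_left)
    then show ?thesis by (simp add: LIM_zero_iff)
  qed
  \<comment> \<open>The Cauchy estimate survives \<open>n\<close> tending to infinity:
    \<open>x n h\<close> is inserted between the two vectors at the price of an arbitrary slack
    \<open>d\<close>.\<close>
  have unif: "nrm (x m h \<ominus> L h) \<le> e * nrm h"
    if N: "\<And>m n. \<lbrakk>m \<ge> N; n \<ge> N\<rbrakk> \<Longrightarrow> cnorm BH (x m \<ominus>\<^bsub>BH\<^esub> x n) < e" and "m \<ge> N" "h \<in> carrier H"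
    for N e m h
  proof (rule field_le_epsilon)
    fix d :: real assume "d > 0"
    then have "\<forall>\<^sub>F n in sequentially. nrm (x n h \<ominus> L h) < d"
      by (rule order_tendstoD(2)[OF L(2)[OF that(3)]])
    then have "\<forall>\<^sub>F n in sequentially. n \<ge> N \<and> nrm (x n h \<ominus> L h) < d"
      using eventually_ge_at_top[of N] by (rule eventually_conj[rotated])
    then obtain n where n: "n \<ge> N" "nrm (x n h \<ominus> L h) < d"
      using eventually_happens'[OF sequentially_bot] by blast
    have "nrm (x m h \<ominus> L h) \<le> nrm (x m h \<ominus> x n h) + nrm (x n h \<ominus> L h)"
      using L x' that by (intro nrm_triangle_minus) auto
    also have "nrm (x m h \<ominus> x n h) \<le> e * nrm h"
      using diff[OF that(3), of m n] mult_right_mono[OF less_imp_le[OF N[OF that(2) n(1)]] nrm_nonneg[OF that(3)]]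
      by linarith
    finally show "nrm (x m h \<ominus> L h) \<le> e * nrm h + d" using n by linarith
  qed
  \<comment> \<open>A single index at distance 1 from the tail already bounds the limit, by 1 plus
    the norm of \<open>x N1\<close>.\<close>
  obtain N1 where N1: "\<And>m n. \<lbrakk>m \<ge> N1; n \<ge> N1\<rbrakk> \<Longrightarrow> cnorm BH (x m \<ominus>\<^bsub>BH\<^esub> x n) < 1"
    using Cauchy zero_less_one by blast
  have LB: "restrict L (carrier H) \<in> bop"
  proof (rule bopI)
    fix h k assume hk: "h \<in> carrier H" "k \<in> carrier H"
    have "L (h \<oplus> k) = L h \<oplus> L k"
    proof (rule eq_if_inner_eq')
      fix l assume l: "l \<in> carrier H"
      have "(\<lambda>n. ip (x n h) l + ip (x n k) l) \<longlonglongrightarrow> ip (L h) l + ip (L k) l"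
        using hk l by (intro tendsto_add lim_ip)
      moreover have "(\<lambda>n. ip (x n h) l + ip (x n k) l) \<longlonglongrightarrow> ip (L (h \<oplus> k)) l"
        using lim_ip[of "h \<oplus> k" l] hk l x' by (simp add: bop_add inner_add_left)
      ultimately show "ip (L (h \<oplus> k)) l = ip (L h \<oplus> L k) l"
        using LIMSEQ_unique hk l L by (simp add: inner_add_left) blast
    qed (use L hk in auto)
    then show "restrict L (carrier H) (h \<oplus> k) = restrict L (carrier H) h \<oplus> restrict L (carrier H) k"
      using hk by simp
  next
    fix z h assume h: "h \<in> carrier H"
    have "L (z \<odot> h) = z \<odot> L h"
    proof (rule eq_if_inner_eq')
      fix l assume l: "l \<in> carrier H"
      have "(\<lambda>n. z * ip (x n h) l) \<longlonglongrightarrow> z * ip (L h) l"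
        using h l by (intro tendsto_mult tendsto_const lim_ip)
      moreover have "(\<lambda>n. z * ip (x n h) l) \<longlonglongrightarrow> ip (L (z \<odot> h)) l"
        using lim_ip[of "z \<odot> h" l] h l x' by (simp add: bop_smult inner_smult_left)
      ultimately show "ip (L (z \<odot> h)) l = ip (z \<odot> L h) l"
        using LIMSEQ_unique h l L by (simp add: inner_smult_left) blast
    qed (use L h in auto)
    then show "restrict L (carrier H) (z \<odot> h) = z \<odot> restrict L (carrier H) h" using h by simp
  next
    fix h assume h: "h \<in> carrier H"
    have "nrm (L h) \<le> nrm (L h \<ominus> x N1 h) + nrm (x N1 h)"
      using L h x' by (intro nrm_diff_le) auto
    also have "nrm (L h \<ominus> x N1 h) \<le> 1 * nrm h"
      using unif[of N1 1 N1 h, OF N1] L h x' nrm_minus_commute[of "L h" "x N1 h"] by simp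
    also have "nrm (x N1 h) \<le> cnorm BH (x N1) * nrm h" using x' h by (intro opnorm_bound)
    finally show "nrm (restrict L (carrier H) h) \<le> (1 + cnorm BH (x N1)) * nrm h"
      using h by (simp add: algebra_simps)
  qed (use L in auto)
  have "(\<lambda>n. cnorm BH (x n \<ominus>\<^bsub>BH\<^esub> restrict L (carrier H))) \<longlonglongrightarrow> 0"
  proof (rule LIMSEQ_I)
    fix e :: real assume "e > 0"
    then obtain N where N: "\<And>m n. \<lbrakk>m \<ge> N; n \<ge> N\<rbrakk> \<Longrightarrow> cnorm BH (x m \<ominus>\<^bsub>BH\<^esub> x n) < e / 2"
      using Cauchy[rule_format, of "e / 2"] by auto
    have "cnorm BH (x n \<ominus>\<^bsub>BH\<^esub> restrict L (carrier H)) \<le> e / 2" if "n \<ge> N" for n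
      using unif[OF N that] \<open>e > 0\<close> x' LB by (intro opnorm_le) (auto simp: minus_BH_apply)
    then show "\<exists>N. \<forall>n\<ge>N. norm (cnorm BH (x n \<ominus>\<^bsub>BH\<^esub> restrict L (carrier H)) - 0) < e"
      using \<open>e > 0\<close> opnorm_nonneg x' LB by (intro exI[of _ N]) (force simp: abs_of_nonneg)
  qed
  with LB show ?thesis by blast
qed

lemma cstar_algebra_BH: "cstar_algebra BH"
proof (intro cstar_algebra.intro module_BH cstar_algebra_axioms.intro)
  fix T assume "T \<in> carrier BH"
  then have T: "T \<in> bop" by simp
  show "star BH T \<in> carrier BH" "star BH (star BH T) = T" "0 \<le> cnorm BH T"
    using T by (simp_all add: star_star_BH opnorm_nonneg)
  show "star BH (z \<odot>\<^bsub>BH\<^esub> T) = cnj z \<odot>\<^bsub>BH\<^esub> star BH T" for z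
    using T by (intro star_eqI) (auto simp: inner_smult_left inner_smult_right star_inner)
  show "cnorm BH T = 0 \<longleftrightarrow> T = \<zero>\<^bsub>BH\<^esub>"
  proof
    assume "cnorm BH T = 0"
    then have "nrm (T h) = 0" if "h \<in> carrier H" for h
      using opnorm_bound[OF T that] nrm_nonneg[of "T h"] T that by simp
    then show "T = \<zero>\<^bsub>BH\<^esub>" using T by (intro bop_eqI) (auto simp: nrm_eq_0)
  next
    assume "T = \<zero>\<^bsub>BH\<^esub>"
    then have "cnorm BH T \<le> 0" by (intro opnorm_le) auto
    then show "cnorm BH T = 0" using opnorm_nonneg[OF T] by simp
  qed
  have scale: "cnorm BH (z \<odot>\<^bsub>BH\<^esub> U) \<le> cmod z * cnorm BH U" if U: "U \<in> bop" for z U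
    using U opnorm_nonneg[OF U] mult_left_mono[OF opnorm_bound[OF U], of _ "cmod z"]
    by (intro opnorm_le) (auto simp: nrm_smult mult_ac)
  show "cnorm BH (z \<odot>\<^bsub>BH\<^esub> T) = cmod z * cnorm BH T" for z
  proof (cases "z = 0")
    case True
    then show ?thesis using scale[OF T, of z] opnorm_nonneg[of "z \<odot>\<^bsub>BH\<^esub> T"] T by simp
  next
    case False
    \<comment> \<open>The inequality \<open>scale\<close> for \<open>inverse z\<close> supplies the
      reverse inequality.\<close>
    have "inverse z \<odot>\<^bsub>BH\<^esub> (z \<odot>\<^bsub>BH\<^esub> T) = T"
      using T False smult_assoc1[of "inverse z" z, symmetric] smult_one
      by (intro bop_eqI) auto
    then have "cnorm BH T \<le> inverse (cmod z) * cnorm BH (z \<odot>\<^bsub>BH\<^esub> T)"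
      using scale[of "z \<odot>\<^bsub>BH\<^esub> T" "inverse z"] T by (simp add: norm_inverse)
    then show ?thesis using scale[OF T, of z] False by (simp add: field_simps)
  qed
  show "cnorm BH (star BH T \<otimes>\<^bsub>BH\<^esub> T) = (cnorm BH T)\<^sup>2"
  proof (rule antisym)
    show "cnorm BH (star BH T \<otimes>\<^bsub>BH\<^esub> T) \<le> (cnorm BH T)\<^sup>2"
      using opnorm_mult[of "star BH T" T] T mult_right_mono[OF opnorm_star_le[OF T] opnorm_nonneg[OF T]]
      by (simp add: power2_eq_square)
  qed (rule opnorm_sq_le[OF T])
next
  fix T U assume "T \<in> carrier BH" "U \<in> carrier BH"
  then have T: "T \<in> bop" and U: "U \<in> bop" by simp_all
  show "cnorm BH (T \<oplus>\<^bsub>BH\<^esub> U) \<le> cnorm BH T + cnorm BH U"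
  proof (rule opnorm_le)
    fix h assume h: "h \<in> carrier H"
    have "nrm (T h \<oplus> U h) \<le> nrm (T h) + nrm (U h)" using T U h by (intro nrm_triangle) auto
    also have "\<dots> \<le> cnorm BH T * nrm h + cnorm BH U * nrm h"
      using T U h by (intro add_mono opnorm_bound) auto
    finally show "nrm ((T \<oplus>\<^bsub>BH\<^esub> U) h) \<le> (cnorm BH T + cnorm BH U) * nrm h"
      using h by (simp add: algebra_simps)
  qed (use T U opnorm_nonneg in auto)
  show "star BH (T \<oplus>\<^bsub>BH\<^esub> U) = star BH T \<oplus>\<^bsub>BH\<^esub> star BH U"
    using T U by (intro star_eqI) (auto simp: inner_add_left inner_add_right star_inner)
  show "star BH (T \<otimes>\<^bsub>BH\<^esub> U) = star BH U \<otimes>\<^bsub>BH\<^esub> star BH T"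
    using T U by (intro star_eqI) (auto simp: star_inner)
qed (use opnorm_complete in \<open>auto intro!: bop_eqI simp: bop_add bop_smult opnorm_mult\<close>)

end

section \<open>Continuity of *-homomorphisms\<close>

context cstar_algebra
begin

section \<open>Norm estimates in an abstract C*-algebra\<close>

declare mult_closed [simp] star_closed [simp] smult_closed [simplified, simp]

lemma minus_smult: "\<lbrakk>a \<in> carrier A; b \<in> carrier A\<rbrakk> \<Longrightarrow> a \<ominus> b = a \<oplus> (-1) \<odot> b"
  by (rule complex_module_minus) unfold_locales

lemma cnorm_minus_commute: "\<lbrakk>a \<in> carrier A; b \<in> carrier A\<rbrakk> \<Longrightarrow> cnorm A (a \<ominus> b) = cnorm A (b \<ominus> a)"
proof -
  assume ab: "a \<in> carrier A" "b \<in> carrier A"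
  have "(-1) \<odot> (b \<ominus> a) = a \<ominus> b"
    using ab smult_assoc1[of "-1" "-1" a] smult_one[of a]
    by (simp add: minus_smult smult_r_distr[simplified] M.a_comm)
  then show ?thesis using ab cnorm_smult[of "b \<ominus> a" "-1"] by simp
qed

lemma cnorm_triangle_minus:
  "\<lbrakk>a \<in> carrier A; b \<in> carrier A; c \<in> carrier A\<rbrakk> \<Longrightarrow>
    cnorm A (a \<ominus> c) \<le> cnorm A (a \<ominus> b) + cnorm A (b \<ominus> c)"
  using cnorm_add[of "a \<ominus> b" "b \<ominus> c"] M.minus_add_minus[of a b c] by simp

lemma eq_if_cnorm_eq_0: "\<lbrakk>a \<in> carrier A; b \<in> carrier A; cnorm A (a \<ominus> b) = 0\<rbrakk> \<Longrightarrow> a = b"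
  using cnorm_eq_0[of "a \<ominus> b"] M.eq_if_minus_zero[of a b] by simp

text \<open>The C*-identity and submultiplicativity give |b|^2 \<le> |b^*| |b|. Cancelling, for
  \<open>a\<close> and for its adjoint, gives both inequalities.\<close>

lemma cnorm_star: "a \<in> carrier A \<Longrightarrow> cnorm A (star A a) = cnorm A a"
proof -
  assume a: "a \<in> carrier A"
  have le: "cnorm A b \<le> cnorm A (star A b)" if b: "b \<in> carrier A" for b
  proof -
    have "cnorm A b * cnorm A b \<le> cnorm A (star A b) * cnorm A b"
      using cstar_identity[OF b] cnorm_mult[of "star A b" b] b by (simp add: power2_eq_square)
    then show ?thesis
      using cnorm_nonneg[OF b] cnorm_nonneg[of "star A b"] b
      by (cases "cnorm A b = 0") (auto simp: mult_le_cancel_right)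
  qed
  from le[OF a] le[of "star A a"] a show ?thesis by (simp add: star_star)
qed

lemma star_minus: "\<lbrakk>a \<in> carrier A; b \<in> carrier A\<rbrakk> \<Longrightarrow> star A (a \<ominus> b) = star A a \<ominus> star A b"
  by (simp add: minus_smult star_add star_smult)

lemma mult_minus_right:
  "\<lbrakk>a \<in> carrier A; b \<in> carrier A; c \<in> carrier A\<rbrakk> \<Longrightarrow> a \<otimes> (b \<ominus> c) = a \<otimes> b \<ominus> a \<otimes> c"
  by (simp add: minus_smult mult_add_right smult_mult_right)

lemma mult_minus_left:
  "\<lbrakk>a \<in> carrier A; b \<in> carrier A; c \<in> carrier A\<rbrakk> \<Longrightarrow> (b \<ominus> c) \<otimes> a = b \<otimes> a \<ominus> c \<otimes> a"
  by (simp add: minus_smult mult_add_left smult_mult_left)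

text \<open>The splitting x^2 - y^2 = x (x - y) + (x - y) y is valid without commutativity.\<close>

lemma cnorm_square_diff:
  assumes x: "x \<in> carrier A" and y: "y \<in> carrier A"
  shows "cnorm A (x \<otimes> x \<ominus> y \<otimes> y) \<le> (cnorm A x + cnorm A y) * cnorm A (x \<ominus> y)"
proof -
  have "x \<otimes> x \<ominus> y \<otimes> y = x \<otimes> (x \<ominus> y) \<oplus> (x \<ominus> y) \<otimes> y"
    using x y by (simp add: mult_minus_right mult_minus_left M.minus_add_minus)
  then have "cnorm A (x \<otimes> x \<ominus> y \<otimes> y) \<le> cnorm A (x \<otimes> (x \<ominus> y)) + cnorm A ((x \<ominus> y) \<otimes> y)"
    using x y by (simp add: cnorm_add)
  also have "\<dots> \<le> cnorm A x * cnorm A (x \<ominus> y) + cnorm A (x \<ominus> y) * cnorm A y"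
    using x y by (intro add_mono cnorm_mult) auto
  finally show ?thesis by (simp add: algebra_simps)
qed

text \<open>
  The solution \<open>c\<close> is \<open>1 - sqrt (1 - b)\<close>: formally \<open>(1 - c)\<^sup>2 = 1 - b\<close>.
\<close>

lemma ex_one_minus_sqrt:
  assumes b: "b \<in> carrier A" "star A b = b" "cnorm A b \<le> 1/2"
  shows "\<exists>c\<in>carrier A. star A c = c \<and> c = (1/2) \<odot> (b \<oplus> c \<otimes> c)"
proof -
  \<comment> \<open>Fixed-point iteration from zero. The ball of radius 1/2 is invariant because
    (1/2 + 1/4)/2 is below 1/2, and on it \<open>\<Phi>\<close> contracts distances by the factor
    (1/2 + 1/2)/2 = 1/2.\<close>
  define \<Phi> where "\<Phi> x = (1/2) \<odot> (b \<oplus> x \<otimes> x)" for x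
  define c where "c n = (\<Phi> ^^ n) \<zero>" for n
  have c_0: "c 0 = \<zero>" and c_Suc: "c (Suc n) = \<Phi> (c n)" for n by (simp_all add: c_def)
  have \<Phi>_mem: "\<Phi> x \<in> carrier A" if "x \<in> carrier A" for x using that b by (simp add: \<Phi>_def)
  have c_mem: "c n \<in> carrier A" for n
    by (induction n) (auto simp: c_0 c_Suc \<Phi>_mem)
  have c_le: "cnorm A (c n) \<le> 1/2" for n
  proof (induction n)
    case 0
    then show ?case using cnorm_eq_0[of "\<zero>"] by (simp add: c_0)
  next
    case (Suc n)
    have "cnorm A (\<Phi> (c n)) = cnorm A (b \<oplus> c n \<otimes> c n) / 2"
      using b c_mem by (simp add: \<Phi>_def cnorm_smult norm_divide)
    also have "cnorm A (b \<oplus> c n \<otimes> c n) \<le> cnorm A b + cnorm A (c n) * cnorm A (c n)"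
      using b c_mem cnorm_add[of b "c n \<otimes> c n"] cnorm_mult[of "c n" "c n"] by simp
    also have "cnorm A (c n) * cnorm A (c n) \<le> (1/2) * (1/2)"
      using Suc cnorm_nonneg[OF c_mem] by (intro mult_mono) auto
    finally show ?case using b by (simp add: c_Suc)
  qed
  have star_c: "star A (c n) = c n" for n
  proof (induction n)
    case 0
    have "star A (0 \<odot> \<zero>) = 0 \<odot> star A \<zero>" using star_smult[of "\<zero>" 0] by simp
    then show ?case using smult_l_null[of "\<zero>"] smult_l_null[of "star A \<zero>"] by (simp add: c_0)
  next
    case (Suc n)
    then show ?case using b c_mem by (simp add: c_Suc \<Phi>_def star_smult star_add star_mult)
  qed
  have \<Phi>_diff: "cnorm A (\<Phi> x \<ominus> \<Phi> y) \<le> (cnorm A x + cnorm A y) / 2 * cnorm A (x \<ominus> y)"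
    if x: "x \<in> carrier A" and y: "y \<in> carrier A" for x y
  proof -
    have "\<Phi> x \<ominus> \<Phi> y = (1/2) \<odot> (x \<otimes> x \<ominus> y \<otimes> y)"
    proof -
      have "(b \<oplus> x \<otimes> x) \<ominus> (b \<oplus> y \<otimes> y) = x \<otimes> x \<ominus> y \<otimes> y"
      proof -
        have "(b \<oplus> x \<otimes> x) \<ominus> (b \<oplus> y \<otimes> y) = (x \<otimes> x \<oplus> b) \<oplus> (\<ominus> b \<ominus> y \<otimes> y)"
          using b x y by (simp add: a_minus_def M.minus_add M.a_comm)
        also have "\<dots> = x \<otimes> x \<ominus> y \<otimes> y"
          using M.minus_add_minus[of "x \<otimes> x" "\<ominus> b" "y \<otimes> y"] b x y by (simp add: a_minus_def)
        finally show ?thesis .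
      qed
      then show ?thesis
        using b x y smult_assoc1[of "-1" "1/2"] smult_assoc1[of "1/2" "-1"]
        by (simp add: \<Phi>_def minus_smult smult_r_distr[of "1/2", simplified, symmetric] mult.commute del: smult_assoc1)
    qed
    then show ?thesis using cnorm_square_diff[OF x y] x y by (simp add: cnorm_smult norm_divide)
  qed
  \<comment> \<open>Both points arise from \<open>c k\<close> and \<open>c 0\<close>, at distance at
    most 1, by \<open>n\<close> applications of the contraction.\<close>
  have near: "cnorm A (c (n + k) \<ominus> c n) \<le> (1/2) ^ n" for n k
  proof (induction n)
    case 0
    then show ?case using c_le[of k] c_mem[of k] smult_r_null[of "-1"] by (simp add: c_0 minus_smult)
  next
    case (Suc n)
    have "cnorm A (\<Phi> (c (n + k)) \<ominus> \<Phi> (c n)) \<le> 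
      (cnorm A (c (n + k)) + cnorm A (c n)) / 2 * cnorm A (c (n + k) \<ominus> c n)"
      by (rule \<Phi>_diff) (auto simp: c_mem)
    also have "\<dots> \<le> (1/2) * (1/2) ^ n"
      using Suc c_le[of "n + k"] c_le[of n] cnorm_nonneg[OF c_mem[of n]] cnorm_nonneg[OF c_mem[of "n+k"]]
        cnorm_nonneg[of "c (n + k) \<ominus> c n"] c_mem
      by (intro mult_mono) auto
    finally show ?case by (simp add: c_Suc)
  qed
  have "\<exists>l\<in>carrier A. (\<lambda>n. cnorm A (c n \<ominus> l)) \<longlonglongrightarrow> 0"
  proof (rule complete)
    show "\<forall>e>0. \<exists>N. \<forall>m\<ge>N. \<forall>n\<ge>N. cnorm A (c m \<ominus> c n) < e"
    proof (intro allI impI)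
      fix e :: real assume "e > 0"
      then obtain N where N: "(1/2::real) ^ N < e"
        using real_arch_pow_inv[of e "1/2"] by auto
      have "cnorm A (c m \<ominus> c n) < e" if "m \<ge> N" "n \<ge> N" for m n
      proof -
        have *: "cnorm A (c m \<ominus> c n) < e" if "N \<le> n" "n \<le> m" for m n
        proof -
          have "cnorm A (c m \<ominus> c n) \<le> (1/2) ^ n" using near[of n "m - n"] that by simp
          also have "\<dots> \<le> (1/2) ^ N" using that by (intro power_decreasing) auto
          finally show ?thesis using N by simp
        qed
        show ?thesis
          using *[of n m] *[of m n] that c_mem cnorm_minus_commute[of "c m" "c n"]
          by (cases "n \<le> m") auto
      qed
      then show "\<exists>N. \<forall>m\<ge>N. \<forall>n\<ge>N. cnorm A (c m \<ominus> c n) < e" by blast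
    qed
  qed (use c_mem in auto)
  then obtain l where l: "l \<in> carrier A" and lim: "(\<lambda>n. cnorm A (c n \<ominus> l)) \<longlonglongrightarrow> 0" by blast
  \<comment> \<open>Self-adjointness and the fixed-point equation pass to the limit in the same way:
    a fixed norm is dominated by a null sequence.\<close>
  have zeroI: "z = 0" if "\<And>n. z \<le> u n" "u \<longlonglongrightarrow> 0" "0 \<le> z" for z :: real and u
    using LIMSEQ_le_const[OF that(2)] that(1,3) by (metis antisym)
  have "star A l = l"
  proof (rule eq_if_cnorm_eq_0)
    have "cnorm A (star A l \<ominus> l) \<le> cnorm A (c n \<ominus> l) + cnorm A (c n \<ominus> l)" for n
    proof -
      have "cnorm A (star A l \<ominus> c n) = cnorm A (star A (l \<ominus> c n))"
        using l c_mem by (simp add: star_minus star_c)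
      also have "\<dots> = cnorm A (c n \<ominus> l)" using l c_mem by (simp add: cnorm_star cnorm_minus_commute)
      finally show ?thesis using cnorm_triangle_minus[of "star A l" "c n" l] l c_mem by simp
    qed
    then show "cnorm A (star A l \<ominus> l) = 0"
      by (rule zeroI) (use tendsto_add[OF lim lim] l cnorm_nonneg in auto)
  qed (use l in auto)
  moreover have "l = \<Phi> l"
  proof (rule eq_if_cnorm_eq_0)
    have "cnorm A (l \<ominus> \<Phi> l) \<le> cnorm A (c (Suc n) \<ominus> l) + (1/2 + cnorm A l) / 2 * cnorm A (c n \<ominus> l)" for n
    proof -
      have "cnorm A (l \<ominus> \<Phi> l) \<le> cnorm A (l \<ominus> c (Suc n)) + cnorm A (\<Phi> (c n) \<ominus> \<Phi> l)"
        unfolding c_Suc[symmetric] by (rule cnorm_triangle_minus) (use l \<Phi>_mem c_mem in auto)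
      also have "cnorm A (\<Phi> (c n) \<ominus> \<Phi> l) \<le> (cnorm A (c n) + cnorm A l) / 2 * cnorm A (c n \<ominus> l)"
        by (rule \<Phi>_diff) (use l c_mem in auto)
      also have "\<dots> \<le> (1/2 + cnorm A l) / 2 * cnorm A (c n \<ominus> l)"
        using c_le[of n] cnorm_nonneg[of "c n \<ominus> l"] l c_mem by (intro mult_right_mono) auto
      finally show ?thesis using cnorm_minus_commute[OF l c_mem] by simp
    qed
    moreover have "(\<lambda>n. cnorm A (c (Suc n) \<ominus> l) + (1/2 + cnorm A l) / 2 * cnorm A (c n \<ominus> l)) \<longlonglongrightarrow> 0"
      by (rule tendsto_add_zero[OF LIMSEQ_Suc[OF lim] tendsto_mult_right_zero[OF lim]])
    ultimately show "cnorm A (l \<ominus> \<Phi> l) = 0"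
      by (rule zeroI) (use l \<Phi>_mem cnorm_nonneg in auto)
  qed (use l \<Phi>_mem in auto)
  ultimately show ?thesis using l unfolding \<Phi>_def by blast
qed

end

text \<open>For |x| \<le> 1/2 choose a self-adjoint c with 2 c = x^* x + c^2. Pairing with
  \<open>h\<close> gives |h|^2 - |\<pi>(x) h|^2 = |h - \<pi>(c) h|^2, which is nonnegative. The
  factor 2 comes from rescaling \<open>a\<close> to norm 1/2.\<close>

lemma star_hom_bounded:
  assumes "cstar_algebra A" "hilbert_space H" and \<pi>: "\<pi> \<in> star_hom A (operator_algebra H)"
    and a: "a \<in> carrier A" and h: "h \<in> carrier H"
  shows "hnorm H (\<pi> a h) \<le> 2 * cnorm A a * hnorm H h"
proof -
  interpret A: cstar_algebra A by (rule assms(1))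
  interpret H: hilbert_space H by (rule assms(2))
  have mem: "\<pi> x \<in> H.bop" if "x \<in> carrier A" for x using \<pi> that by (auto simp: star_hom_def)
  have add: "\<pi> (x \<oplus>\<^bsub>A\<^esub> y) = \<pi> x \<oplus>\<^bsub>H.BH\<^esub> \<pi> y" and mult: "\<pi> (x \<otimes>\<^bsub>A\<^esub> y) = \<pi> x \<otimes>\<^bsub>H.BH\<^esub> \<pi> y"
    if "x \<in> carrier A" "y \<in> carrier A" for x y using \<pi> that by (auto simp: star_hom_def)
  have smult: "\<pi> (z \<odot>\<^bsub>A\<^esub> x) = z \<odot>\<^bsub>H.BH\<^esub> \<pi> x" and star: "\<pi> (star A x) = star H.BH (\<pi> x)"
    if "x \<in> carrier A" for x z using \<pi> that by (auto simp: star_hom_def)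
  have contr: "hnorm H (\<pi> x h) \<le> hnorm H h" if x: "x \<in> carrier A" "cnorm A x \<le> 1/2" for x
  proof -
    define b where "b = star A x \<otimes>\<^bsub>A\<^esub> x"
    have b: "b \<in> carrier A" "star A b = b" using x by (simp_all add: b_def A.star_mult A.star_star)
    have "cnorm A b = cnorm A x * cnorm A x"
      using x by (simp add: b_def A.cstar_identity power2_eq_square)
    also have "\<dots> \<le> 1 * (1/2)" using x A.cnorm_nonneg[OF x(1)] by (intro mult_mono) auto
    finally obtain c where c: "c \<in> carrier A" "star A c = c"
      and eq: "c = (1/2) \<odot>\<^bsub>A\<^esub> (b \<oplus>\<^bsub>A\<^esub> c \<otimes>\<^bsub>A\<^esub> c)"
      using A.ex_one_minus_sqrt[of b] b by auto
    have "\<pi> c = (1/2) \<odot>\<^bsub>H.BH\<^esub> (\<pi> b \<oplus>\<^bsub>H.BH\<^esub> \<pi> c \<otimes>\<^bsub>H.BH\<^esub> \<pi> c)"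
      by (subst eq) (use b c in \<open>simp add: smult add mult\<close>)
    then have "\<pi> c h = ((1/2) \<odot>\<^bsub>H.BH\<^esub> (\<pi> b \<oplus>\<^bsub>H.BH\<^esub> \<pi> c \<otimes>\<^bsub>H.BH\<^esub> \<pi> c)) h"
      by (rule fun_cong)
    also have "\<dots> = (1/2) \<odot>\<^bsub>H\<^esub> (\<pi> b h \<oplus>\<^bsub>H\<^esub> \<pi> c (\<pi> c h))"
      using h by simp
    finally have ch: "\<pi> c h = (1/2) \<odot>\<^bsub>H\<^esub> (\<pi> b h \<oplus>\<^bsub>H\<^esub> \<pi> c (\<pi> c h))" .
    \<comment> \<open>Self-adjointness moves \<pi>(c) across the inner product; \<open>bh\<close>
      does the corresponding thing for x^* x.\<close>
    have cc: "inner_prod H (\<pi> c h) (\<pi> c h) = inner_prod H h (\<pi> c (\<pi> c h))"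
      using H.star_inner[OF mem[OF c(1)] h, of "\<pi> c h"] h c mem[OF c(1)] star[OF c(1)] by simp
    have bh: "inner_prod H h (\<pi> b h) = inner_prod H (\<pi> x h) (\<pi> x h)"
      using H.star_inner[OF mem[OF x(1)] h, of "\<pi> x h"] h mem[OF x(1)] x
      by (simp add: b_def mult star)
    have "inner_prod H h (\<pi> c h) = (1/2) * (inner_prod H h (\<pi> b h) + inner_prod H h (\<pi> c (\<pi> c h)))"
      by (subst ch) (use h mem[OF b(1)] mem[OF c(1)] in \<open>simp add: H.inner_smult_right H.inner_add_right\<close>)
    then have "2 * inner_prod H h (\<pi> c h) = inner_prod H (\<pi> x h) (\<pi> x h) + inner_prod H (\<pi> c h) (\<pi> c h)"
      unfolding bh cc by (simp add: mult.commute)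
    then have "Re (2 * inner_prod H h (\<pi> c h)) =
      Re (inner_prod H (\<pi> x h) (\<pi> x h) + inner_prod H (\<pi> c h) (\<pi> c h))" by (rule arg_cong)
    then have "2 * Re (inner_prod H h (\<pi> c h)) = (hnorm H (\<pi> x h))\<^sup>2 + (hnorm H (\<pi> c h))\<^sup>2"
      using h mem[OF x(1)] mem[OF c(1)] by (simp add: H.nrm_sq)
    moreover have "0 \<le> (hnorm H (h \<ominus>\<^bsub>H\<^esub> \<pi> c h))\<^sup>2" by simp
    ultimately have "(hnorm H (\<pi> x h))\<^sup>2 \<le> (hnorm H h)\<^sup>2"
      using h mem[OF c(1)] by (simp add: H.nrm_sq_minus)
    then show ?thesis by (rule power2_le_imp_le) (use h H.nrm_nonneg in simp)
  qed
  show ?thesis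
  proof (cases "cnorm A a = 0")
    case True
    then have "a = 0 \<odot>\<^bsub>A\<^esub> a" using a A.cnorm_eq_0[OF a] A.smult_l_null[of a] by simp
    then have "\<pi> a = 0 \<odot>\<^bsub>H.BH\<^esub> \<pi> a" using smult[OF a, of 0] by simp
    then have "\<pi> a h = 0 \<odot>\<^bsub>H\<^esub> \<pi> a h" using h by (metis operator_algebra_simps(5))
    then have "hnorm H (\<pi> a h) = 0"
      using H.nrm_smult[of "\<pi> a h" 0] h mem[OF a] by simp
    then show ?thesis using True by simp
  next
    case False
    then have pos: "cnorm A a > 0" using A.cnorm_nonneg[OF a] by simp
    \<comment> \<open>Rescales \<open>a\<close> to norm exactly 1/2, where \<open>contr\<close>
      applies; the division is why norm zero is treated separately.\<close>
    let ?z = "complex_of_real (1 / (2 * cnorm A a))"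
    have "hnorm H (\<pi> (?z \<odot>\<^bsub>A\<^esub> a) h) \<le> hnorm H h"
      by (rule contr) (use a pos in \<open>simp_all add: A.cnorm_smult norm_divide norm_mult\<close>)
    then show ?thesis
      using a h pos mem[OF a] by (simp add: smult H.nrm_smult norm_divide norm_mult field_simps)
  qed
qed

text \<open>The set on which the homomorphisms agree is a *-subalgebra, closed by
  \<open>star_hom_bounded\<close>, so it contains everything that \<open>G\<close>
  generates.\<close>

lemma star_hom_unique:
  assumes "cstar_algebra A" "hilbert_space H" and gen: "generates A G"
    and \<pi>: "\<pi> \<in> star_hom A (operator_algebra H)" and \<pi>': "\<pi>' \<in> star_hom A (operator_algebra H)"
    and eq: "\<And>a. a \<in> G \<Longrightarrow> \<pi> a = \<pi>' a"
  shows "\<pi> = \<pi>'"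
proof -
  interpret A: cstar_algebra A by (rule assms(1))
  interpret H: hilbert_space H by (rule assms(2))
  have mem: "\<pi> x \<in> H.bop" "\<pi>' x \<in> H.bop" if "x \<in> carrier A" for x
    using \<pi> \<pi>' that by (auto simp: star_hom_def)
  have add: "\<pi> (x \<oplus>\<^bsub>A\<^esub> y) = \<pi> x \<oplus>\<^bsub>H.BH\<^esub> \<pi> y" "\<pi>' (x \<oplus>\<^bsub>A\<^esub> y) = \<pi>' x \<oplus>\<^bsub>H.BH\<^esub> \<pi>' y"
    if "x \<in> carrier A" "y \<in> carrier A" for x y using \<pi> \<pi>' that by (auto simp: star_hom_def)
  have smult: "\<pi> (z \<odot>\<^bsub>A\<^esub> x) = z \<odot>\<^bsub>H.BH\<^esub> \<pi> x" "\<pi>' (z \<odot>\<^bsub>A\<^esub> x) = z \<odot>\<^bsub>H.BH\<^esub> \<pi>' x"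
    if "x \<in> carrier A" for x z using \<pi> \<pi>' that by (auto simp: star_hom_def)
  define E where "E = {a \<in> carrier A. \<pi> a = \<pi>' a}"
  have diff: "\<rho> (x \<ominus>\<^bsub>A\<^esub> y) h = \<rho> x h \<ominus>\<^bsub>H\<^esub> \<rho> y h"
    if "\<rho> \<in> {\<pi>, \<pi>'}" "x \<in> carrier A" "y \<in> carrier A" "h \<in> carrier H" for \<rho> x y h
    using that mem by (auto simp: A.minus_smult add smult H.minus_smult)
  have "closed_star_subalgebra A E"
    unfolding closed_star_subalgebra_def
  proof (intro conjI allI impI ballI)
    have "\<rho> \<zero>\<^bsub>A\<^esub> h = \<zero>\<^bsub>H\<^esub>" if "\<rho> \<in> {\<pi>, \<pi>'}" "h \<in> carrier H" for \<rho> h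
    proof -
      have "\<rho> (0 \<odot>\<^bsub>A\<^esub> \<zero>\<^bsub>A\<^esub>) = 0 \<odot>\<^bsub>H.BH\<^esub> \<rho> \<zero>\<^bsub>A\<^esub>" using that(1) smult[of "\<zero>\<^bsub>A\<^esub>" 0] by auto
      moreover have "0 \<odot>\<^bsub>A\<^esub> \<zero>\<^bsub>A\<^esub> = \<zero>\<^bsub>A\<^esub>" using A.smult_l_null[of "\<zero>\<^bsub>A\<^esub>"] by simp
      ultimately have "\<rho> \<zero>\<^bsub>A\<^esub> h = (0 \<odot>\<^bsub>H.BH\<^esub> \<rho> \<zero>\<^bsub>A\<^esub>) h" by simp
      also have "\<dots> = 0 \<odot>\<^bsub>H\<^esub> \<rho> \<zero>\<^bsub>A\<^esub> h" using that(2) by simp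
      also have "\<dots> = \<zero>\<^bsub>H\<^esub>"
        using that mem[of "\<zero>\<^bsub>A\<^esub>"] H.smult_l_null[of "\<rho> \<zero>\<^bsub>A\<^esub> h"] by auto
      finally show ?thesis .
    qed
    from this[of \<pi>] this[of \<pi>'] show "\<zero>\<^bsub>A\<^esub> \<in> E" using mem[of "\<zero>\<^bsub>A\<^esub>"] by (auto simp: E_def intro!: H.bop_eqI)
    fix x a assume x: "range x \<subseteq> E" and a: "a \<in> carrier A"
      and lim: "(\<lambda>n. cnorm A (x n \<ominus>\<^bsub>A\<^esub> a)) \<longlonglongrightarrow> 0"
    have xA: "x n \<in> carrier A" and x_eq: "\<pi> (x n) = \<pi>' (x n)" for n using x by (auto simp: E_def)
    have "\<pi> a h = \<pi>' a h" if h: "h \<in> carrier H" for h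
    proof -
      \<comment> \<open>The common value at \<open>x n\<close> is inserted. Each homomorphism
        contributes a factor 2 from \<open>star_hom_bounded\<close>, together 4.\<close>
      have le: "hnorm H (\<pi> a h \<ominus>\<^bsub>H\<^esub> \<pi>' a h) \<le> 4 * hnorm H h * cnorm A (x n \<ominus>\<^bsub>A\<^esub> a)" for n
      proof -
        have "hnorm H (\<pi> a h \<ominus>\<^bsub>H\<^esub> \<pi>' a h) \<le>
          hnorm H (\<pi> (a \<ominus>\<^bsub>A\<^esub> x n) h) + hnorm H (\<pi>' (x n \<ominus>\<^bsub>A\<^esub> a) h)"
          using H.nrm_triangle_minus[of "\<pi> a h" "\<pi> (x n) h" "\<pi>' a h"] mem a xA h
          by (simp add: diff) (simp add: x_eq)
        also have "\<dots> \<le> 2 * cnorm A (a \<ominus>\<^bsub>A\<^esub> x n) * hnorm H h + 2 * cnorm A (x n \<ominus>\<^bsub>A\<^esub> a) * hnorm H h"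
          using a xA h \<pi> \<pi>' assms(1,2) by (intro add_mono star_hom_bounded) auto
        finally show ?thesis using A.cnorm_minus_commute[OF a xA[of n]] by simp
      qed
      have "(\<lambda>n. 4 * hnorm H h * cnorm A (x n \<ominus>\<^bsub>A\<^esub> a)) \<longlonglongrightarrow> 0" by (rule tendsto_mult_right_zero[OF lim])
      from LIMSEQ_le_const[OF this] le have "hnorm H (\<pi> a h \<ominus>\<^bsub>H\<^esub> \<pi>' a h) \<le> 0" by blast
      then have "hnorm H (\<pi> a h \<ominus>\<^bsub>H\<^esub> \<pi>' a h) = 0" using H.nrm_nonneg mem a h by (simp add: order_antisym)
      then have "\<pi> a h \<ominus>\<^bsub>H\<^esub> \<pi>' a h = \<zero>\<^bsub>H\<^esub>"
        using H.nrm_eq_0[of "\<pi> a h \<ominus>\<^bsub>H\<^esub> \<pi>' a h"] mem a h by simp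
      then show ?thesis by (rule H.M.eq_if_minus_zero[rotated -1]) (use mem a h in auto)
    qed
    then show "a \<in> E" using a mem by (auto simp: E_def intro!: H.bop_eqI)
  qed (use \<pi> \<pi>' in \<open>auto simp: E_def star_hom_def\<close>)
  moreover have "G \<subseteq> E" using gen eq by (auto simp: E_def generates_def)
  ultimately have "E = carrier A" using gen by (auto simp: generates_def)
  moreover have "\<pi> \<in> carrier A \<rightarrow>\<^sub>E H.bop" "\<pi>' \<in> carrier A \<rightarrow>\<^sub>E H.bop"
    using \<pi> \<pi>' by (auto simp: star_hom_def)
  ultimately show ?thesis by (intro PiE_ext[of \<pi> "carrier A" "\<lambda>_. H.bop" \<pi>']) (auto simp: E_def)
qed

section \<open>The space of square-integrable functions\<close>

lemma borel_measurable_cnj [measurable (raw)]: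
  "f \<in> borel_measurable M \<Longrightarrow> (\<lambda>x. cnj (f x)) \<in> borel_measurable M"
  by (rule borel_measurable_continuous_on[OF continuous_on_cnj[OF continuous_on_id]])

lemma square_integrable_iff:
  "\<phi> \<in> square_integrable M \<longleftrightarrow>
    \<phi> \<in> borel_measurable M \<and> (\<integral>\<^sup>+x. ennreal ((cmod (\<phi> x))\<^sup>2) \<partial>M) < \<infinity>"
  by (auto simp: square_integrable_def integrable_iff_bounded)

lemma square_integrable_measurable [measurable_dest]:
  "\<phi> \<in> square_integrable M \<Longrightarrow> \<phi> \<in> borel_measurable M"
  by (simp add: square_integrable_def)

lemma cmod_add_squared_le: "(cmod (a + b))\<^sup>2 \<le> 2 * (cmod a)\<^sup>2 + 2 * (cmod b)\<^sup>2"
proof -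
  have "(cmod (a + b))\<^sup>2 \<le> (cmod a + cmod b)\<^sup>2" by (intro power_mono norm_triangle_ineq) auto
  also have "\<dots> \<le> 2 * (cmod a)\<^sup>2 + 2 * (cmod b)\<^sup>2"
    using zero_le_power2[of "cmod a - cmod b"] by (simp add: power2_sum power2_diff)
  finally show ?thesis .
qed

lemma square_integrable_add:
  assumes "\<phi> \<in> square_integrable M" "\<psi> \<in> square_integrable M"
  shows "(\<lambda>x. \<phi> x + \<psi> x) \<in> square_integrable M"
proof -
  have [measurable]: "\<phi> \<in> borel_measurable M" "\<psi> \<in> borel_measurable M"
    using assms by (simp_all add: square_integrable_def)
  have "integrable M (\<lambda>x. 2 * (cmod (\<phi> x))\<^sup>2 + 2 * (cmod (\<psi> x))\<^sup>2)"
    using assms by (simp add: square_integrable_def)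
  then have "integrable M (\<lambda>x. (cmod (\<phi> x + \<psi> x))\<^sup>2)"
    by (rule Bochner_Integration.integrable_bound) (auto simp: cmod_add_squared_le)
  then show ?thesis by (simp add: square_integrable_def)
qed

lemma square_integrable_scale:
  "\<phi> \<in> square_integrable M \<Longrightarrow> (\<lambda>x. z * \<phi> x) \<in> square_integrable M"
  by (auto simp: square_integrable_def norm_mult power_mult_distrib)

lemma square_integrable_zero: "(\<lambda>x. 0) \<in> square_integrable M"
  by (simp add: square_integrable_def)

lemma integrable_mult_cnj:
  assumes "\<phi> \<in> square_integrable M" "\<psi> \<in> square_integrable M"
  shows "integrable M (\<lambda>x. \<phi> x * cnj (\<psi> x))"
proof -
  have [measurable]: "\<phi> \<in> borel_measurable M" "\<psi> \<in> borel_measurable M"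
    using assms by (simp_all add: square_integrable_def)
  have "integrable M (\<lambda>x. (cmod (\<phi> x))\<^sup>2 + (cmod (\<psi> x))\<^sup>2)"
    using assms by (simp add: square_integrable_def)
  then show ?thesis
  proof (rule Bochner_Integration.integrable_bound, goal_cases)
    case 2
    have "norm (\<phi> x * cnj (\<psi> x)) \<le> norm ((cmod (\<phi> x))\<^sup>2 + (cmod (\<psi> x))\<^sup>2)" for x
  proof -
    have "2 * (cmod (\<phi> x) * cmod (\<psi> x)) \<le> (cmod (\<phi> x))\<^sup>2 + (cmod (\<psi> x))\<^sup>2"
      using zero_le_power2[of "cmod (\<phi> x) - cmod (\<psi> x)"] by (simp add: power2_diff)
    moreover have "0 \<le> cmod (\<phi> x) * cmod (\<psi> x)" by simp
    ultimately have "cmod (\<phi> x) * cmod (\<psi> x) \<le> (cmod (\<phi> x))\<^sup>2 + (cmod (\<psi> x))\<^sup>2" by linarith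
    then show ?thesis by (simp add: norm_mult)
  qed
  then show ?case by simp
  qed measurable
qed

lemma L2_class_eq_iff:
  assumes "\<phi> \<in> borel_measurable M" "\<psi> \<in> borel_measurable M"
  shows "L2_class M \<phi> = L2_class M \<psi> \<longleftrightarrow> (AE x in M. \<phi> x = \<psi> x)"
proof
  assume "L2_class M \<phi> = L2_class M \<psi>"
  then have "\<phi> \<in> L2_class M \<psi>" using assms by (auto simp: L2_class_def)
  then show "AE x in M. \<phi> x = \<psi> x" by (simp add: L2_class_def)
next
  assume ae: "AE x in M. \<phi> x = \<psi> x"
  show "L2_class M \<phi> = L2_class M \<psi>"
    unfolding L2_class_def using ae by (auto elim: AE_mp)
qed

lemma
  assumes "\<phi> \<in> borel_measurable M"
  shows L2_rep_measurable: "L2_rep (L2_class M \<phi>) \<in> borel_measurable M"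
    and L2_rep_AE: "AE x in M. L2_rep (L2_class M \<phi>) x = \<phi> x"
proof -
  have "\<phi> \<in> L2_class M \<phi>" using assms by (simp add: L2_class_def)
  then have "L2_rep (L2_class M \<phi>) \<in> L2_class M \<phi>"
    unfolding L2_rep_def by (rule someI[where P = "\<lambda>\<psi>. \<psi> \<in> L2_class M \<phi>"])
  then show "L2_rep (L2_class M \<phi>) \<in> borel_measurable M" "AE x in M. L2_rep (L2_class M \<phi>) x = \<phi> x"
    by (simp_all add: L2_class_def)
qed

lemma carrier_L2: "carrier (L2 M) = L2_class M ` square_integrable M"
  and zero_L2: "\<zero>\<^bsub>L2 M\<^esub> = L2_class M (\<lambda>x. 0)"
  by (simp_all add: L2_def)

lemma L2_class_mem: "\<phi> \<in> square_integrable M \<Longrightarrow> L2_class M \<phi> \<in> carrier (L2 M)"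
  by (simp add: carrier_L2)

lemma L2_cases:
  assumes "a \<in> carrier (L2 M)"
  obtains \<phi> where "\<phi> \<in> square_integrable M" "a = L2_class M \<phi>"
  using assms by (auto simp: carrier_L2)

text \<open>The operations of \<open>L2\<close> go through the representative picked by
  \<open>L2_rep\<close>. This lemma and the next two replace it by whatever function is at
  hand.\<close>

lemma L2_add:
  assumes [measurable]: "\<phi> \<in> borel_measurable M" "\<psi> \<in> borel_measurable M"
  shows "L2_class M \<phi> \<oplus>\<^bsub>L2 M\<^esub> L2_class M \<psi> = L2_class M (\<lambda>x. \<phi> x + \<psi> x)"
proof -
  note [measurable] = L2_rep_measurable[OF assms(1)] L2_rep_measurable[OF assms(2)]
  have "L2_class M (\<lambda>x. L2_rep (L2_class M \<phi>) x + L2_rep (L2_class M \<psi>) x) = L2_class M (\<lambda>x. \<phi> x + \<psi> x)"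
    using L2_rep_AE[OF assms(1)] L2_rep_AE[OF assms(2)] by (subst L2_class_eq_iff) auto
  then show ?thesis by (simp add: L2_def)
qed

lemma L2_smult:
  assumes [measurable]: "\<phi> \<in> borel_measurable M"
  shows "z \<odot>\<^bsub>L2 M\<^esub> L2_class M \<phi> = L2_class M (\<lambda>x. z * \<phi> x)"
proof -
  note [measurable] = L2_rep_measurable[OF assms(1)]
  have "L2_class M (\<lambda>x. z * L2_rep (L2_class M \<phi>) x) = L2_class M (\<lambda>x. z * \<phi> x)"
    using L2_rep_AE[OF assms(1)] by (subst L2_class_eq_iff) auto
  then show ?thesis by (simp add: L2_def)
qed

lemma L2_inner:
  assumes [measurable]: "\<phi> \<in> borel_measurable M" "\<psi> \<in> borel_measurable M"
  shows "inner_prod (L2 M) (L2_class M \<phi>) (L2_class M \<psi>) = (LINT x|M. \<phi> x * cnj (\<psi> x))"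
proof -
  note [measurable] = L2_rep_measurable[OF assms(1)] L2_rep_measurable[OF assms(2)]
  have "(LINT x|M. L2_rep (L2_class M \<phi>) x * cnj (L2_rep (L2_class M \<psi>) x)) = (LINT x|M. \<phi> x * cnj (\<psi> x))"
    using L2_rep_AE[OF assms(1)] L2_rep_AE[OF assms(2)] by (intro integral_cong_AE) auto
  then show ?thesis by (simp add: L2_def)
qed

lemma L2_inner_self:
  assumes "\<phi> \<in> borel_measurable M"
  shows "inner_prod (L2 M) (L2_class M \<phi>) (L2_class M \<phi>) = complex_of_real (LINT x|M. (cmod (\<phi> x))\<^sup>2)"
  unfolding L2_inner[OF assms assms] by (simp add: complex_norm_square[symmetric] of_real_power[symmetric] del: of_real_power)

lemma module_L2: "Module.module complex_ring (L2 M)"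
proof (rule moduleI[OF cring_complex_ring])
  show "abelian_group (L2 M)"
  proof (rule abelian_groupI)
    fix a b assume "a \<in> carrier (L2 M)" "b \<in> carrier (L2 M)"
    then show "a \<oplus>\<^bsub>L2 M\<^esub> b \<in> carrier (L2 M)" "a \<oplus>\<^bsub>L2 M\<^esub> b = b \<oplus>\<^bsub>L2 M\<^esub> a"
      by (auto elim!: L2_cases simp: L2_add add.commute intro!: L2_class_mem square_integrable_add)
  next
    fix a b c assume "a \<in> carrier (L2 M)" "b \<in> carrier (L2 M)" "c \<in> carrier (L2 M)"
    then show "(a \<oplus>\<^bsub>L2 M\<^esub> b) \<oplus>\<^bsub>L2 M\<^esub> c = a \<oplus>\<^bsub>L2 M\<^esub> (b \<oplus>\<^bsub>L2 M\<^esub> c)"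
      by (auto elim!: L2_cases simp: L2_add add.assoc)
  next
    fix a assume "a \<in> carrier (L2 M)"
    then obtain \<phi> where \<phi>: "\<phi> \<in> square_integrable M" "a = L2_class M \<phi>" by (rule L2_cases)
    then show "\<zero>\<^bsub>L2 M\<^esub> \<oplus>\<^bsub>L2 M\<^esub> a = a" by (simp add: zero_L2 L2_add square_integrable_measurable)
    show "\<exists>b\<in>carrier (L2 M). b \<oplus>\<^bsub>L2 M\<^esub> a = \<zero>\<^bsub>L2 M\<^esub>"
      using \<phi> square_integrable_scale[OF \<phi>(1), of "-1"]
      by (intro bexI[of _ "L2_class M (\<lambda>x. - \<phi> x)"])
        (auto simp: zero_L2 L2_add square_integrable_measurable intro!: L2_class_mem)
  qed (auto simp: zero_L2 intro!: L2_class_mem square_integrable_zero)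
qed (auto elim!: L2_cases simp: L2_add L2_smult distrib_left distrib_right mult.assoc
      intro!: L2_class_mem square_integrable_scale)

lemma L2_minus:
  assumes "\<phi> \<in> square_integrable M" "\<psi> \<in> square_integrable M"
  shows "L2_class M \<phi> \<ominus>\<^bsub>L2 M\<^esub> L2_class M \<psi> = L2_class M (\<lambda>x. \<phi> x - \<psi> x)"
  using complex_module_minus[OF module_L2 L2_class_mem[OF assms(1)] L2_class_mem[OF assms(2)]] assms
  by (simp add: L2_add L2_smult square_integrable_measurable)

lemma square_integrable_diff:
  "\<lbrakk>\<phi> \<in> square_integrable M; \<psi> \<in> square_integrable M\<rbrakk> \<Longrightarrow> (\<lambda>x. \<phi> x - \<psi> x) \<in> square_integrable M"
  using square_integrable_add[OF _ square_integrable_scale[of \<psi> M "-1"], of \<phi>] by simp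

text \<open>Norms become nonnegative integrals, to which Fatou's lemma and changes of variables
  apply with no integrability to check.\<close>

lemma hnorm_L2:
  assumes "\<phi> \<in> square_integrable M"
  shows "ennreal ((hnorm (L2 M) (L2_class M \<phi>))\<^sup>2) = (\<integral>\<^sup>+x. ennreal ((cmod (\<phi> x))\<^sup>2) \<partial>M)"
  using assms by (simp add: hnorm_def L2_inner_self square_integrable_def nn_integral_eq_integral)

text \<open>
  Riesz--Fischer: along a subsequence with fast decaying increments, \<open>\<Sum>k. 4^k |\<phi>\<^sub>k\<^sub>+\<^sub>1 - \<phi>\<^sub>k|\<^sup>2\<close> is
  integrable, hence the subsequence converges almost everywhere.
\<close>

lemma square_integrable_complete:
  fixes \<phi> :: "nat \<Rightarrow> 'x \<Rightarrow> complex"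
  assumes sq: "\<And>n. \<phi> n \<in> square_integrable M"
    and Cauchy: "\<And>e::real. e > 0 \<Longrightarrow>
      \<exists>N. \<forall>m\<ge>N. \<forall>n\<ge>N. (\<integral>\<^sup>+x. ennreal ((cmod (\<phi> m x - \<phi> n x))\<^sup>2) \<partial>M) \<le> ennreal e"
  shows "\<exists>\<psi>\<in>square_integrable M. \<forall>e>0. \<exists>N. \<forall>n\<ge>N.
      (\<integral>\<^sup>+x. ennreal ((cmod (\<phi> n x - \<psi> x))\<^sup>2) \<partial>M) \<le> ennreal e"
proof -
  have [measurable]: "\<phi> n \<in> borel_measurable M" for n by (rule square_integrable_measurable[OF sq])
  \<comment> \<open>The rate 1/8 beats the weight 4 used below: the \<open>k\<close>-th term of the
    series contributes at most (1/2)^k, in total 2.\<close>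
  have "\<forall>k. \<exists>N. \<forall>m\<ge>N. \<forall>n\<ge>N. (\<integral>\<^sup>+x. ennreal ((cmod (\<phi> m x - \<phi> n x))\<^sup>2) \<partial>M) \<le> ennreal ((1/8)^k)"
    by (intro allI Cauchy) simp
  then obtain N where N: "\<And>k m n. \<lbrakk>m \<ge> N k; n \<ge> N k\<rbrakk> \<Longrightarrow>
      (\<integral>\<^sup>+x. ennreal ((cmod (\<phi> m x - \<phi> n x))\<^sup>2) \<partial>M) \<le> ennreal ((1/8)^k)" by metis
  \<comment> \<open>Partial sums dominate all earlier thresholds at once, which is what
    \<open>r_ge\<close> extracts.\<close>
  define r where "r k = (\<Sum>i\<le>k. N i)" for k
  have r_ge: "N k \<le> r j" if "k \<le> j" for k j
    unfolding r_def using that by (intro member_le_sum) auto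
  define \<delta> where "\<delta> k x = \<phi> (r (Suc k)) x - \<phi> (r k) x" for k x
  have [measurable]: "\<delta> k \<in> borel_measurable M" for k unfolding \<delta>_def by measurable
  have "(\<integral>\<^sup>+x. (\<Sum>k. ennreal (4^k * (cmod (\<delta> k x))\<^sup>2)) \<partial>M) =
      (\<Sum>k. \<integral>\<^sup>+x. ennreal (4^k * (cmod (\<delta> k x))\<^sup>2) \<partial>M)"
    by (rule nn_integral_suminf) measurable
  also have "\<dots> \<le> (\<Sum>k. ennreal ((1/2)^k))"
  proof (rule suminf_le)
    fix k
    have "(\<integral>\<^sup>+x. ennreal (4^k * (cmod (\<delta> k x))\<^sup>2) \<partial>M) =
        ennreal (4^k) * (\<integral>\<^sup>+x. ennreal ((cmod (\<delta> k x))\<^sup>2) \<partial>M)"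
      by (subst nn_integral_cmult[symmetric]) (auto simp: ennreal_mult)
    also have "\<dots> \<le> ennreal (4^k) * ennreal ((1/8)^k)"
      unfolding \<delta>_def by (intro mult_left_mono N r_ge) auto
    also have "\<dots> = ennreal ((1/2)^k)"
      by (simp add: ennreal_mult'[symmetric] power_mult_distrib[symmetric])
    finally show "(\<integral>\<^sup>+x. ennreal (4^k * (cmod (\<delta> k x))\<^sup>2) \<partial>M) \<le> ennreal ((1/2)^k)" .
  qed auto
  also have "\<dots> = ennreal 2"
    using sums_unique[OF geometric_sums[of "1/2::real"]] summable_geometric[of "1/2::real"]
    by (subst suminf_ennreal2) auto
  finally have "(\<integral>\<^sup>+x. (\<Sum>k. ennreal (4^k * (cmod (\<delta> k x))\<^sup>2)) \<partial>M) \<noteq> \<infinity>"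
    by (auto simp: top_unique)
  then have "AE x in M. (\<Sum>k. ennreal (4^k * (cmod (\<delta> k x))\<^sup>2)) \<noteq> \<infinity>"
    by (intro nn_integral_PInf_AE) auto
  moreover have "convergent (\<lambda>k. \<phi> (r k) x)" if fin: "(\<Sum>k. ennreal (4^k * (cmod (\<delta> k x))\<^sup>2)) \<noteq> \<infinity>" for x
  proof -
    define F where "F k = ennreal (4^k * (cmod (\<delta> k x))\<^sup>2)" for k
    have "suminf F \<noteq> \<infinity>" using fin unfolding F_def .
    then obtain C where C: "0 \<le> C" "suminf F = ennreal C"
      using ennreal_cases[of "suminf F"] unfolding infinity_ennreal_def by blast
    \<comment> \<open>Each single term is below the finite sum \<open>C\<close>, so the increments
      decay geometrically.\<close>
    have le: "cmod (\<delta> k x) \<le> sqrt C * (1/2)^k" for k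
    proof (rule power2_le_imp_le)
      have "F k \<le> ennreal C"
        unfolding C(2)[symmetric] using sum_le_suminf[of F "{k}"] by simp
      then have "4^k * (cmod (\<delta> k x))\<^sup>2 \<le> C" using C(1) by (simp add: F_def)
      moreover have "((1/2::real)^k)\<^sup>2 = 1 / 4^k"
        unfolding power2_eq_square power_mult_distrib[symmetric] by (simp add: power_one_over)
      then have "(sqrt C * (1/2)^k)\<^sup>2 = C / 4^k"
        using C(1) by (simp only: power_mult_distrib real_sqrt_pow2) simp
      moreover have "(cmod (\<delta> k x))\<^sup>2 \<le> C / 4^k \<longleftrightarrow> 4^k * (cmod (\<delta> k x))\<^sup>2 \<le> C"
        by (subst pos_le_divide_eq) (auto simp: mult.commute)
      ultimately show "(cmod (\<delta> k x))\<^sup>2 \<le> (sqrt C * (1/2)^k)\<^sup>2" by simp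
    qed (use C(1) in simp)
    have "summable (\<lambda>k. \<delta> k x)"
      by (rule summable_comparison_test'[OF summable_mult[OF summable_geometric[of "1/2"]]]) (use le in auto)
    then have "convergent (\<lambda>n. \<phi> (r 0) x + (\<Sum>k<n. \<delta> k x))"
      by (intro convergent_add convergent_const) (simp add: summable_iff_convergent)
    moreover have "\<phi> (r 0) x + (\<Sum>k<n. \<delta> k x) = \<phi> (r n) x" for n
      unfolding \<delta>_def by (subst sum_lessThan_telescope) simp
    ultimately show ?thesis by simp
  qed
  ultimately have conv: "AE x in M. convergent (\<lambda>k. \<phi> (r k) x)" by (auto elim: AE_mp)
  \<comment> \<open>\<open>lim\<close> is total, so \<open>\<psi>\<close> is defined and measurable
    on the whole space; its values on the null set of divergence are arbitrary.\<close>
  define \<psi> where "\<psi> x = lim (\<lambda>k. \<phi> (r k) x)" for x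
  have [measurable]: "\<psi> \<in> borel_measurable M"
    unfolding \<psi>_def by (rule borel_measurable_lim_metric) measurable
  \<comment> \<open>Fatou's lemma, with the second index running along the subsequence.\<close>
  have bound: "(\<integral>\<^sup>+x. ennreal ((cmod (\<phi> m x - \<psi> x))\<^sup>2) \<partial>M) \<le> ennreal ((1/8)^k)" if m: "m \<ge> N k" for m k
  proof -
    have "(\<integral>\<^sup>+x. ennreal ((cmod (\<phi> m x - \<psi> x))\<^sup>2) \<partial>M) =
      (\<integral>\<^sup>+x. liminf (\<lambda>j. ennreal ((cmod (\<phi> m x - \<phi> (r j) x))\<^sup>2)) \<partial>M)"
    proof (rule nn_integral_cong_AE)
      show "AE x in M. ennreal ((cmod (\<phi> m x - \<psi> x))\<^sup>2) =
          liminf (\<lambda>j. ennreal ((cmod (\<phi> m x - \<phi> (r j) x))\<^sup>2))"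
        using conv
      proof (rule AE_mp, intro AE_I2 impI)
        fix x assume "convergent (\<lambda>k. \<phi> (r k) x)"
        then have "(\<lambda>k. \<phi> (r k) x) \<longlonglongrightarrow> \<psi> x" by (simp add: \<psi>_def convergent_LIMSEQ_iff)
        then have "(\<lambda>j. ennreal ((cmod (\<phi> m x - \<phi> (r j) x))\<^sup>2)) \<longlonglongrightarrow> ennreal ((cmod (\<phi> m x - \<psi> x))\<^sup>2)"
          by (intro tendsto_intros)
        then show "ennreal ((cmod (\<phi> m x - \<psi> x))\<^sup>2) = liminf (\<lambda>j. ennreal ((cmod (\<phi> m x - \<phi> (r j) x))\<^sup>2))"
          by (intro lim_imp_Liminf[symmetric]) auto
      qed
    qed
    also have "\<dots> \<le> liminf (\<lambda>j. \<integral>\<^sup>+x. ennreal ((cmod (\<phi> m x - \<phi> (r j) x))\<^sup>2) \<partial>M)"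
      by (rule nn_integral_liminf) measurable
    also have "\<dots> \<le> ennreal ((1/8)^k)"
    proof (rule order_trans[OF Liminf_le_Limsup])
      show "limsup (\<lambda>j. \<integral>\<^sup>+x. ennreal ((cmod (\<phi> m x - \<phi> (r j) x))\<^sup>2) \<partial>M) \<le> ennreal ((1/8)^k)"
        by (rule Limsup_bounded, rule eventually_mono[OF eventually_ge_at_top[of k]])
          (use m r_ge N in auto)
    qed auto
    finally show ?thesis .
  qed
  have "(\<lambda>x. \<phi> (N 0) x - \<psi> x) \<in> square_integrable M"
    using bound[of 0 "N 0"] by (auto simp: square_integrable_iff top_unique intro: le_less_trans)
  then have "\<psi> \<in> square_integrable M"
    using square_integrable_diff[OF sq[of "N 0"]] by fastforce
  moreover have "\<exists>N'. \<forall>n\<ge>N'. (\<integral>\<^sup>+x. ennreal ((cmod (\<phi> n x - \<psi> x))\<^sup>2) \<partial>M) \<le> ennreal e" if e: "e > 0" for e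
  proof -
    obtain k where "(1/8::real)^k < e" using real_arch_pow_inv[OF e, of "1/8"] by auto
    then show ?thesis using bound by (intro exI[of _ "N k"]) (force intro: order_trans ennreal_leI)
  qed
  ultimately show ?thesis by blast
qed

lemma hilbert_space_L2: "hilbert_space (L2 M)"
proof (intro hilbert_space.intro module_L2 hilbert_space_axioms.intro)
  fix a b c assume "a \<in> carrier (L2 M)" "b \<in> carrier (L2 M)" "c \<in> carrier (L2 M)"
  then show "inner_prod (L2 M) (a \<oplus>\<^bsub>L2 M\<^esub> b) c = inner_prod (L2 M) a c + inner_prod (L2 M) b c"
    by (auto elim!: L2_cases simp: L2_add L2_inner distrib_right integrable_mult_cnj)
next
  fix a b z assume "a \<in> carrier (L2 M)" "b \<in> carrier (L2 M)"
  then show "inner_prod (L2 M) (z \<odot>\<^bsub>L2 M\<^esub> a) b = z * inner_prod (L2 M) a b"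
    by (auto elim!: L2_cases simp: L2_smult L2_inner mult.assoc integrable_mult_cnj)
next
  fix a b assume "a \<in> carrier (L2 M)" "b \<in> carrier (L2 M)"
  then show "inner_prod (L2 M) a b = cnj (inner_prod (L2 M) b a)"
    by (auto elim!: L2_cases simp: L2_inner mult.commute simp flip: Bochner_Integration.integral_cnj)
next
  fix a assume "a \<in> carrier (L2 M)"
  then obtain \<phi> where \<phi>: "\<phi> \<in> square_integrable M" "a = L2_class M \<phi>" by (rule L2_cases)
  then have eq: "inner_prod (L2 M) a a = complex_of_real (LINT x|M. (cmod (\<phi> x))\<^sup>2)"
    by (simp add: L2_inner_self square_integrable_measurable)
  then show "0 \<le> Re (inner_prod (L2 M) a a)" by simp
  assume "inner_prod (L2 M) a a = 0"
  then have "(LINT x|M. (cmod (\<phi> x))\<^sup>2) = 0" using eq by simp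
  then have "AE x in M. \<phi> x = 0"
    using \<phi> by (subst (asm) integral_nonneg_eq_0_iff_AE) (auto simp: square_integrable_def)
  then show "a = \<zero>\<^bsub>L2 M\<^esub>"
    using \<phi> by (simp add: zero_L2 L2_class_eq_iff square_integrable_measurable)
next
  fix a :: "nat \<Rightarrow> _" assume a: "range a \<subseteq> carrier (L2 M)"
    and Cauchy: "\<forall>e>0. \<exists>N. \<forall>m\<ge>N. \<forall>n\<ge>N. hnorm (L2 M) (a m \<ominus>\<^bsub>L2 M\<^esub> a n) < e"
  have "\<forall>n. \<exists>\<phi>. \<phi> \<in> square_integrable M \<and> a n = L2_class M \<phi>" using a by (auto simp: carrier_L2)
  then obtain \<phi> where \<phi>: "\<And>n. \<phi> n \<in> square_integrable M" "\<And>n. a n = L2_class M (\<phi> n)" by metis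
  have nonneg: "0 \<le> hnorm (L2 M) (L2_class M \<psi>)" if "\<psi> \<in> square_integrable M" for \<psi>
    using that by (simp add: hnorm_def L2_inner_self square_integrable_measurable)
  have "\<exists>\<psi>\<in>square_integrable M. \<forall>e>0. \<exists>N. \<forall>n\<ge>N.
      (\<integral>\<^sup>+x. ennreal ((cmod (\<phi> n x - \<psi> x))\<^sup>2) \<partial>M) \<le> ennreal e"
  proof (rule square_integrable_complete)
    fix e :: real assume "e > 0"
    then obtain N where N: "\<And>m n. \<lbrakk>m \<ge> N; n \<ge> N\<rbrakk> \<Longrightarrow> hnorm (L2 M) (a m \<ominus>\<^bsub>L2 M\<^esub> a n) < sqrt e"
      using Cauchy[rule_format, of "sqrt e"] by auto
    have "(\<integral>\<^sup>+x. ennreal ((cmod (\<phi> m x - \<phi> n x))\<^sup>2) \<partial>M) \<le> ennreal e" if "m \<ge> N" "n \<ge> N" for m n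
    proof -
      have "(hnorm (L2 M) (L2_class M (\<lambda>x. \<phi> m x - \<phi> n x)))\<^sup>2 \<le> (sqrt e)\<^sup>2"
        using N[OF that] nonneg[OF square_integrable_diff] \<phi> by (intro power_mono) (auto simp: L2_minus)
      then show ?thesis
        using \<open>e > 0\<close> \<phi> by (subst hnorm_L2[symmetric]) (auto simp: square_integrable_diff)
    qed
    then show "\<exists>N. \<forall>m\<ge>N. \<forall>n\<ge>N. (\<integral>\<^sup>+x. ennreal ((cmod (\<phi> m x - \<phi> n x))\<^sup>2) \<partial>M) \<le> ennreal e" by blast
  qed (rule \<phi>(1))
  then obtain \<psi> where \<psi>: "\<psi> \<in> square_integrable M"
    and lim: "\<And>e. e > 0 \<Longrightarrow> \<exists>N. \<forall>n\<ge>N. (\<integral>\<^sup>+x. ennreal ((cmod (\<phi> n x - \<psi> x))\<^sup>2) \<partial>M) \<le> ennreal e" by metis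
  have "(\<lambda>n. hnorm (L2 M) (a n \<ominus>\<^bsub>L2 M\<^esub> L2_class M \<psi>)) \<longlonglongrightarrow> 0"
  proof (rule LIMSEQ_I)
    fix e :: real assume "e > 0"
    then obtain N where N: "\<And>n. n \<ge> N \<Longrightarrow>
        (\<integral>\<^sup>+x. ennreal ((cmod (\<phi> n x - \<psi> x))\<^sup>2) \<partial>M) \<le> ennreal ((e / 2)\<^sup>2)"
      using lim[of "(e / 2)\<^sup>2"] by auto
    have "norm (hnorm (L2 M) (a n \<ominus>\<^bsub>L2 M\<^esub> L2_class M \<psi>) - 0) < e" if "n \<ge> N" for n
    proof -
      have "(hnorm (L2 M) (L2_class M (\<lambda>x. \<phi> n x - \<psi> x)))\<^sup>2 \<le> (e / 2)\<^sup>2"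
        using N[OF that] unfolding hnorm_L2[OF square_integrable_diff[OF \<phi>(1)[of n] \<psi>], symmetric]
        by (subst (asm) ennreal_le_iff) auto
      then have "hnorm (L2 M) (L2_class M (\<lambda>x. \<phi> n x - \<psi> x)) \<le> e / 2"
        by (rule power2_le_imp_le) (use \<open>e > 0\<close> in simp)
      then show ?thesis
        using \<open>e > 0\<close> nonneg[OF square_integrable_diff[OF \<phi>(1)[of n] \<psi>]] \<phi> \<psi> by (simp add: L2_minus)
    qed
    then show "\<exists>N. \<forall>n\<ge>N. norm (hnorm (L2 M) (a n \<ominus>\<^bsub>L2 M\<^esub> L2_class M \<psi>) - 0) < e" by blast
  qed
  then show "\<exists>h\<in>carrier (L2 M). (\<lambda>n. hnorm (L2 M) (a n \<ominus>\<^bsub>L2 M\<^esub> h)) \<longlonglongrightarrow> 0"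
    using \<psi> by (intro bexI[of _ "L2_class M \<psi>"]) (auto intro: L2_class_mem)
qed

section \<open>Combinatorics of higher-rank graphs\<close>

lemma edges_mor: "e \<in> edges \<Lambda> \<Longrightarrow> e \<in> mor \<Lambda>"
  by (auto simp: edges_def paths_def)

lemma edge_deg: "e \<in> edges \<Lambda> \<Longrightarrow> \<exists>i. deg \<Lambda> e = axis i 1"
  by (auto simp: edges_def paths_def)

lemma vertex_mor: "v \<in> vertices \<Lambda> \<Longrightarrow> v \<in> mor \<Lambda>"
  by (simp add: paths_def)

context k_graph
begin

text \<open>The number of edges in any factorization of the path into edges; the measure for
  inductions on paths.\<close>

definition len :: "'m \<Rightarrow> nat" where "len \<mu> = (\<Sum>i\<in>UNIV. deg \<Lambda> \<mu> $ i)"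

lemma factorize:
  assumes "\<mu> \<in> mor \<Lambda>" "deg \<Lambda> \<mu> = n + m"
  obtains \<nu> \<alpha> where "\<nu> \<in> mor \<Lambda>" "\<alpha> \<in> mor \<Lambda>" "deg \<Lambda> \<nu> = n" "deg \<Lambda> \<alpha> = m" "src \<Lambda> \<nu> = rng \<Lambda> \<alpha>" "\<mu> = cmp \<Lambda> \<nu> \<alpha>"
  using factorization[OF assms] by blast

text \<open>Heads of equal degree leave tails of equal degree, so both pairs are the unique
  factorization for the same splitting of the degree.\<close>

lemma factorize_unique:
  assumes "\<nu> \<in> mor \<Lambda>" "\<alpha> \<in> mor \<Lambda>" "src \<Lambda> \<nu> = rng \<Lambda> \<alpha>"
    and "\<nu>' \<in> mor \<Lambda>" "\<alpha>' \<in> mor \<Lambda>" "src \<Lambda> \<nu>' = rng \<Lambda> \<alpha>'"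
    and eq: "cmp \<Lambda> \<nu> \<alpha> = cmp \<Lambda> \<nu>' \<alpha>'" and deg: "deg \<Lambda> \<nu> = deg \<Lambda> \<nu>'"
  shows "\<nu> = \<nu>'" "\<alpha> = \<alpha>'"
proof -
  have "deg \<Lambda> \<nu> + deg \<Lambda> \<alpha> = deg \<Lambda> \<nu>' + deg \<Lambda> \<alpha>'"
    using deg_cmp[OF assms(1-3)] deg_cmp[OF assms(4-6)] eq by simp
  then have "deg \<Lambda> \<alpha> = deg \<Lambda> \<alpha>'" using deg by simp
  let ?Q = "\<lambda>p. case p of (x, y) \<Rightarrow> x \<in> mor \<Lambda> \<and> y \<in> mor \<Lambda> \<and> deg \<Lambda> x = deg \<Lambda> \<nu> \<and>
    deg \<Lambda> y = deg \<Lambda> \<alpha> \<and> src \<Lambda> x = rng \<Lambda> y \<and> cmp \<Lambda> \<nu> \<alpha> = cmp \<Lambda> x y"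
  have "\<exists>!p. ?Q p"
    by (rule factorization[OF cmp_closed[OF assms(1-3)] deg_cmp[OF assms(1-3)]])
  moreover have "?Q (\<nu>, \<alpha>)" "?Q (\<nu>', \<alpha>')"
    using assms \<open>deg \<Lambda> \<alpha> = deg \<Lambda> \<alpha>'\<close> by simp_all
  ultimately have "(\<nu>, \<alpha>) = (\<nu>', \<alpha>')" by blast
  then show "\<nu> = \<nu>'" "\<alpha> = \<alpha>'" by simp_all
qed

lemma vertex_iff_len: "\<mu> \<in> mor \<Lambda> \<Longrightarrow> \<mu> \<in> vertices \<Lambda> \<longleftrightarrow> len \<mu> = 0"
  by (auto simp: paths_def len_def vec_eq_iff)

lemma vertexD: "v \<in> vertices \<Lambda> \<Longrightarrow> rng \<Lambda> v = v" "v \<in> vertices \<Lambda> \<Longrightarrow> src \<Lambda> v = v"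
  by (simp_all add: vertices_eq_objects)

lemma rng_vertex: "\<mu> \<in> mor \<Lambda> \<Longrightarrow> rng \<Lambda> \<mu> \<in> vertices \<Lambda>"
  and src_vertex: "\<mu> \<in> mor \<Lambda> \<Longrightarrow> src \<Lambda> \<mu> \<in> vertices \<Lambda>"
  by (simp_all add: paths_def rng_closed src_closed deg_rng deg_src)

lemma len_cmp:
  "\<lbrakk>\<mu> \<in> mor \<Lambda>; \<nu> \<in> mor \<Lambda>; src \<Lambda> \<mu> = rng \<Lambda> \<nu>\<rbrakk> \<Longrightarrow> len (cmp \<Lambda> \<mu> \<nu>) = len \<mu> + len \<nu>"
  by (simp add: len_def deg_cmp sum.distrib)

lemma len_edge: "e \<in> edges \<Lambda> \<Longrightarrow> len e = 1"
  by (auto simp: edges_def paths_def len_def axis_def)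

lemma first_edge:
  assumes "\<mu> \<in> mor \<Lambda>" "\<mu> \<notin> vertices \<Lambda>"
  obtains e \<mu>' where "e \<in> edges \<Lambda>" "\<mu>' \<in> mor \<Lambda>" "src \<Lambda> e = rng \<Lambda> \<mu>'" "\<mu> = cmp \<Lambda> e \<mu>'"
proof -
  obtain i where i: "deg \<Lambda> \<mu> $ i \<noteq> 0" using assms by (auto simp: paths_def vec_eq_iff)
  have "deg \<Lambda> \<mu> = axis i 1 + (deg \<Lambda> \<mu> - axis i 1)"
    using i by (auto simp: vec_eq_iff axis_def)
  from factorize[OF assms(1) this] obtain e \<mu>' where
    "e \<in> mor \<Lambda>" "\<mu>' \<in> mor \<Lambda>" "deg \<Lambda> e = axis i 1" "src \<Lambda> e = rng \<Lambda> \<mu>'" "\<mu> = cmp \<Lambda> e \<mu>'" by metis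
  then show ?thesis using that[of e \<mu>'] by (auto simp: edges_def paths_def)
qed

lemma path_induct [consumes 1, case_names vertex cons]:
  assumes "\<mu> \<in> mor \<Lambda>"
    and vertex: "\<And>v. v \<in> vertices \<Lambda> \<Longrightarrow> Q v"
    and cons: "\<And>e \<mu>. \<lbrakk>e \<in> edges \<Lambda>; \<mu> \<in> mor \<Lambda>; src \<Lambda> e = rng \<Lambda> \<mu>; Q \<mu>\<rbrakk> \<Longrightarrow> Q (cmp \<Lambda> e \<mu>)"
  shows "Q \<mu>"
  using assms(1)
proof (induction "len \<mu>" arbitrary: \<mu> rule: less_induct)
  case less
  show ?case
  proof (cases "\<mu> \<in> vertices \<Lambda>")
    case False
    from first_edge[OF less.prems False] obtain e \<mu>' where
      e: "e \<in> edges \<Lambda>" "\<mu>' \<in> mor \<Lambda>" "src \<Lambda> e = rng \<Lambda> \<mu>'" "\<mu> = cmp \<Lambda> e \<mu>'" .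
    then have "len \<mu>' < len \<mu>" by (simp add: len_cmp len_edge edges_mor)
    then show ?thesis using less.hyps e cons by simp
  qed (rule vertex)
qed

text \<open>By unique factorization distinct initial edges of one path have different colours i and
  j. The initial segment of degree e_i + e_j factors in both orders, which is the commuting
  square.\<close>

lemma edge_square:
  assumes e: "e \<in> edges \<Lambda>" "\<mu> \<in> mor \<Lambda>" "src \<Lambda> e = rng \<Lambda> \<mu>"
    and e': "e' \<in> edges \<Lambda>" "\<mu>' \<in> mor \<Lambda>" "src \<Lambda> e' = rng \<Lambda> \<mu>'"
    and eq: "cmp \<Lambda> e \<mu> = cmp \<Lambda> e' \<mu>'" and ne: "e \<noteq> e'"
  obtains a b \<rho> where "a \<in> edges \<Lambda>" "b \<in> edges \<Lambda>" "\<rho> \<in> mor \<Lambda>"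
    "src \<Lambda> e = rng \<Lambda> a" "src \<Lambda> e' = rng \<Lambda> b" "src \<Lambda> a = rng \<Lambda> \<rho>" "src \<Lambda> b = rng \<Lambda> \<rho>"
    "cmp \<Lambda> e a = cmp \<Lambda> e' b" "\<mu> = cmp \<Lambda> a \<rho>" "\<mu>' = cmp \<Lambda> b \<rho>"
proof -
  note em = edges_mor[OF e(1)] edges_mor[OF e'(1)]
  obtain i j where i: "deg \<Lambda> e = axis i 1" and j: "deg \<Lambda> e' = axis j 1"
    using e(1) e'(1) edge_deg by metis
  have "i \<noteq> j" using factorize_unique(1)[OF em(1) e(2,3) em(2) e'(2,3) eq] i j ne by auto
  have dd: "axis i 1 + deg \<Lambda> \<mu> = axis j 1 + deg \<Lambda> \<mu>'"
    using deg_cmp[OF em(1) e(2,3)] deg_cmp[OF em(2) e'(2,3)] eq i j by simp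
  have "deg \<Lambda> \<mu> $ j \<noteq> 0"
    using arg_cong[OF dd, of "\<lambda>d. d $ j"] \<open>i \<noteq> j\<close> by (simp add: axis_def)
  then have "deg \<Lambda> (cmp \<Lambda> e \<mu>) = (axis i 1 + axis j 1) + (deg \<Lambda> \<mu> - axis j 1)"
    using deg_cmp[OF em(1) e(2,3)] i by (auto simp: vec_eq_iff axis_def)
  from factorize[OF cmp_closed[OF em(1) e(2,3)] this] obtain \<kappa> \<rho> where
    \<kappa>: "\<kappa> \<in> mor \<Lambda>" "\<rho> \<in> mor \<Lambda>" "deg \<Lambda> \<kappa> = axis i 1 + axis j 1" "src \<Lambda> \<kappa> = rng \<Lambda> \<rho>"
    "cmp \<Lambda> e \<mu> = cmp \<Lambda> \<kappa> \<rho>" by metis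
  from factorize[OF \<kappa>(1,3)] obtain e1 a where
    a: "e1 \<in> mor \<Lambda>" "a \<in> mor \<Lambda>" "deg \<Lambda> e1 = axis i 1" "deg \<Lambda> a = axis j 1" "src \<Lambda> e1 = rng \<Lambda> a" "\<kappa> = cmp \<Lambda> e1 a" by metis
  have "deg \<Lambda> \<kappa> = axis j 1 + axis i 1" using \<kappa>(3) by (simp add: add.commute)
  from factorize[OF \<kappa>(1) this] obtain e2 b where
    b: "e2 \<in> mor \<Lambda>" "b \<in> mor \<Lambda>" "deg \<Lambda> e2 = axis j 1" "deg \<Lambda> b = axis i 1" "src \<Lambda> e2 = rng \<Lambda> b" "\<kappa> = cmp \<Lambda> e2 b" by metis
  have src_a: "src \<Lambda> a = rng \<Lambda> \<rho>" using src_cmp[OF a(1,2,5)] a(6) \<kappa>(4) by simp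
  have src_b: "src \<Lambda> b = rng \<Lambda> \<rho>" using src_cmp[OF b(1,2,5)] b(6) \<kappa>(4) by simp
  have "cmp \<Lambda> e \<mu> = cmp \<Lambda> e1 (cmp \<Lambda> a \<rho>)"
    using \<kappa>(5) a(6) cmp_assoc[OF a(1,2) \<kappa>(2) a(5) src_a] by simp
  then have 1: "e = e1" "\<mu> = cmp \<Lambda> a \<rho>"
    using factorize_unique[OF em(1) e(2,3) a(1) cmp_closed[OF a(2) \<kappa>(2) src_a]]
      a(5) rng_cmp[OF a(2) \<kappa>(2) src_a] i a(3) by auto
  have "cmp \<Lambda> e' \<mu>' = cmp \<Lambda> e2 (cmp \<Lambda> b \<rho>)"
    using \<kappa>(5) b(6) cmp_assoc[OF b(1,2) \<kappa>(2) b(5) src_b] eq by simp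
  then have 2: "e' = e2" "\<mu>' = cmp \<Lambda> b \<rho>"
    using factorize_unique[OF em(2) e'(2,3) b(1) cmp_closed[OF b(2) \<kappa>(2) src_b]]
      b(5) rng_cmp[OF b(2) \<kappa>(2) src_b] j b(3) by auto
  show ?thesis
    by (rule that[of a b \<rho>]) (use a b 1 2 \<kappa> src_a src_b in \<open>auto simp: edges_def paths_def\<close>)
qed

text \<open>A relation, because a path may have several initial edges and a recursive function would
  have to choose one; single-valuedness is proved under the square hypothesis.\<close>

inductive path_value :: "('m \<Rightarrow> 'c \<Rightarrow> 'c) \<Rightarrow> ('m \<Rightarrow> 'c) \<Rightarrow> 'm \<Rightarrow> 'c \<Rightarrow> bool"
  for step :: "'m \<Rightarrow> 'c \<Rightarrow> 'c" and base :: "'m \<Rightarrow> 'c" where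
  vertex: "v \<in> vertices \<Lambda> \<Longrightarrow> path_value step base v (base v)"
| cons: "\<lbrakk>e \<in> edges \<Lambda>; \<mu> \<in> mor \<Lambda>; src \<Lambda> e = rng \<Lambda> \<mu>; path_value step base \<mu> z\<rbrakk> \<Longrightarrow>
    path_value step base (cmp \<Lambda> e \<mu>) (step e z)"

text \<open>
  Two factorizations of a path with different initial edges are compared through a third one, which
  starts with both edges of a commuting square.
\<close>

lemma extend_to_paths:
  fixes step :: "'m \<Rightarrow> 'c \<Rightarrow> 'c"
  assumes base: "\<And>v. v \<in> vertices \<Lambda> \<Longrightarrow> base v \<in> Z"
    and step: "\<And>e z. \<lbrakk>e \<in> edges \<Lambda>; z \<in> Z\<rbrakk> \<Longrightarrow> step e z \<in> Z"
    and square: "\<And>e a e' b z. \<lbrakk>e \<in> edges \<Lambda>; a \<in> edges \<Lambda>; e' \<in> edges \<Lambda>; b \<in> edges \<Lambda>;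
      src \<Lambda> e = rng \<Lambda> a; src \<Lambda> e' = rng \<Lambda> b; cmp \<Lambda> e a = cmp \<Lambda> e' b; z \<in> Z\<rbrakk> \<Longrightarrow>
      step e (step a z) = step e' (step b z)"
  obtains F where "\<And>v. v \<in> vertices \<Lambda> \<Longrightarrow> F v = base v"
    and "\<And>e \<mu>. \<lbrakk>e \<in> edges \<Lambda>; \<mu> \<in> mor \<Lambda>; src \<Lambda> e = rng \<Lambda> \<mu>\<rbrakk> \<Longrightarrow> F (cmp \<Lambda> e \<mu>) = step e (F \<mu>)"
    and "\<And>\<mu>. \<mu> \<in> mor \<Lambda> \<Longrightarrow> F \<mu> \<in> Z"
proof -
  let ?V = "path_value step base"
  have Z: "z \<in> Z" if "?V \<mu> z" for \<mu> z
    using that by induction (auto intro: base step)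
  have ex: "\<exists>z. ?V \<mu> z" if "\<mu> \<in> mor \<Lambda>" for \<mu>
    using that by (induction rule: path_induct) (auto intro: path_value.intros)
  have uniq: "z = z'" if "?V \<mu> z" "?V \<mu> z'" for \<mu> z z'
    using that
  proof (induction "len \<mu>" arbitrary: \<mu> z z' rule: less_induct)
    case less
    show ?case
    proof (cases "\<mu> \<in> vertices \<Lambda>")
      case True
      \<comment> \<open>A derivation by \<open>cons\<close> ends in a path of positive length, so at
        a vertex only the base value can arise.\<close>
      have "y = base \<mu>" if "?V \<mu> y" for y
        using that
      proof cases
        case (cons e \<mu>' z')
        then have "len \<mu> \<noteq> 0" by (simp add: len_cmp len_edge edges_mor)
        then show ?thesis using True vertex_iff_len[of \<mu>] by (simp add: vertex_mor)
      qed simp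
      from this[OF less.prems(1)] this[OF less.prems(2)] show ?thesis by simp
    next
      case False
      from less.prems(1) False obtain e \<mu>1 z1 where 1: "\<mu> = cmp \<Lambda> e \<mu>1" "z = step e z1"
        "e \<in> edges \<Lambda>" "\<mu>1 \<in> mor \<Lambda>" "src \<Lambda> e = rng \<Lambda> \<mu>1" "?V \<mu>1 z1" by cases auto
      from less.prems(2) False obtain e' \<mu>2 z2 where 2: "\<mu> = cmp \<Lambda> e' \<mu>2" "z' = step e' z2"
        "e' \<in> edges \<Lambda>" "\<mu>2 \<in> mor \<Lambda>" "src \<Lambda> e' = rng \<Lambda> \<mu>2" "?V \<mu>2 z2" by cases auto
      have len: "len \<mu>1 < len \<mu>" "len \<mu>2 < len \<mu>"
        using 1 2 by (simp_all add: len_cmp len_edge edges_mor) (metis 1(1) len_cmp len_edge edges_mor lessI plus_1_eq_Suc)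
      show ?thesis
      proof (cases "e = e'")
        case True
        then have "\<mu>1 = \<mu>2" using factorize_unique(2)[of e \<mu>1 e' \<mu>2] 1 2 by (simp add: edges_mor)
        then have "z1 = z2" using less.hyps[OF len(1)] 1 2 by simp
        then show ?thesis using 1 2 True by simp
      next
        case False
        have "cmp \<Lambda> e \<mu>1 = cmp \<Lambda> e' \<mu>2" using 1 2 by simp
        from edge_square[OF 1(3-5) 2(3-5) this False] obtain a b \<rho> where
          ab: "a \<in> edges \<Lambda>" "b \<in> edges \<Lambda>" "\<rho> \<in> mor \<Lambda>" "src \<Lambda> e = rng \<Lambda> a" "src \<Lambda> e' = rng \<Lambda> b"
          "src \<Lambda> a = rng \<Lambda> \<rho>" "src \<Lambda> b = rng \<Lambda> \<rho>" "cmp \<Lambda> e a = cmp \<Lambda> e' b"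
          "\<mu>1 = cmp \<Lambda> a \<rho>" "\<mu>2 = cmp \<Lambda> b \<rho>" .
        obtain y where y: "?V \<rho> y" using ex[OF ab(3)] by blast
        have "z1 = step a y" using less.hyps[OF len(1) 1(6)] ab y by (auto intro: path_value.cons)
        moreover have "z2 = step b y" using less.hyps[OF len(2) 2(6)] ab y by (auto intro: path_value.cons)
        ultimately show ?thesis
          using square[OF 1(3) ab(1) 2(3) ab(2,4,5,8) Z[OF y]] 1 2 by simp
      qed
    qed
  qed
  define F where "F \<mu> = (THE z. ?V \<mu> z)" for \<mu>
  have F: "F \<mu> = z" if "?V \<mu> z" for \<mu> z
    unfolding F_def by (rule the_equality[where P = "?V \<mu>", OF that uniq[OF _ that]])
  have V: "?V \<mu> (F \<mu>)" if "\<mu> \<in> mor \<Lambda>" for \<mu> using ex[OF that] F by blast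
  show ?thesis
    by (rule that[of F]) (auto intro: F V Z path_value.intros)
qed

section \<open>Minimal common extensions\<close>

lemma Lambda_minD:
  assumes "(\<alpha>, \<beta>) \<in> Lambda_min \<Lambda> \<mu> \<nu>"
  shows "\<alpha> \<in> mor \<Lambda>" "\<beta> \<in> mor \<Lambda>" "src \<Lambda> \<mu> = rng \<Lambda> \<alpha>" "src \<Lambda> \<nu> = rng \<Lambda> \<beta>"
    "cmp \<Lambda> \<mu> \<alpha> = cmp \<Lambda> \<nu> \<beta>" "deg \<Lambda> (cmp \<Lambda> \<mu> \<alpha>) = (\<chi> i. max (deg \<Lambda> \<mu> $ i) (deg \<Lambda> \<nu> $ i))"
  using assms by (auto simp: Lambda_min_def)

text \<open>The initial segment of the common extension whose degree is the join of the two degrees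
  is itself a common extension, by uniqueness of factorizations; \<open>\<tau>\<close> is what
  remains.\<close>

lemma Lambda_min_factor:
  assumes \<mu>: "\<mu> \<in> mor \<Lambda>" "\<alpha> \<in> mor \<Lambda>" "src \<Lambda> \<mu> = rng \<Lambda> \<alpha>"
    and \<nu>: "\<nu> \<in> mor \<Lambda>" "\<beta> \<in> mor \<Lambda>" "src \<Lambda> \<nu> = rng \<Lambda> \<beta>"
    and eq: "cmp \<Lambda> \<mu> \<alpha> = cmp \<Lambda> \<nu> \<beta>"
  obtains \<alpha>' \<beta>' \<tau> where "(\<alpha>', \<beta>') \<in> Lambda_min \<Lambda> \<mu> \<nu>" "\<tau> \<in> mor \<Lambda>"
    "src \<Lambda> \<alpha>' = rng \<Lambda> \<tau>" "\<alpha> = cmp \<Lambda> \<alpha>' \<tau>"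
proof -
  let ?\<xi> = "cmp \<Lambda> \<mu> \<alpha>"
  define n where "n = (\<chi> i. max (deg \<Lambda> \<mu> $ i) (deg \<Lambda> \<nu> $ i))"
  have d1: "deg \<Lambda> ?\<xi> = deg \<Lambda> \<mu> + deg \<Lambda> \<alpha>" by (rule deg_cmp[OF \<mu>])
  have d2: "deg \<Lambda> ?\<xi> = deg \<Lambda> \<nu> + deg \<Lambda> \<beta>" unfolding eq by (rule deg_cmp[OF \<nu>])
  have le: "deg \<Lambda> \<mu> $ i \<le> deg \<Lambda> ?\<xi> $ i" "deg \<Lambda> \<nu> $ i \<le> deg \<Lambda> ?\<xi> $ i" for i
    unfolding d1 by simp (simp add: d1[symmetric] d2)
  \<comment> \<open>Subtraction of degrees is truncated in each coordinate; \<open>le\<close> makes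
    it exact.\<close>
  have "deg \<Lambda> ?\<xi> = n + (deg \<Lambda> ?\<xi> - n)"
    using le by (auto simp: vec_eq_iff n_def)
  from factorize[OF cmp_closed[OF \<mu>] this] obtain \<zeta> \<tau> where
    \<zeta>: "\<zeta> \<in> mor \<Lambda>" "\<tau> \<in> mor \<Lambda>" "deg \<Lambda> \<zeta> = n" "src \<Lambda> \<zeta> = rng \<Lambda> \<tau>" "?\<xi> = cmp \<Lambda> \<zeta> \<tau>" by metis
  have "deg \<Lambda> \<zeta> = deg \<Lambda> \<mu> + (n - deg \<Lambda> \<mu>)" unfolding \<zeta>(3) by (auto simp: vec_eq_iff n_def)
  from factorize[OF \<zeta>(1) this] obtain \<mu>1 \<alpha>' where
    1: "\<mu>1 \<in> mor \<Lambda>" "\<alpha>' \<in> mor \<Lambda>" "deg \<Lambda> \<mu>1 = deg \<Lambda> \<mu>" "src \<Lambda> \<mu>1 = rng \<Lambda> \<alpha>'" "\<zeta> = cmp \<Lambda> \<mu>1 \<alpha>'" by metis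
  have "deg \<Lambda> \<zeta> = deg \<Lambda> \<nu> + (n - deg \<Lambda> \<nu>)" unfolding \<zeta>(3) by (auto simp: vec_eq_iff n_def)
  from factorize[OF \<zeta>(1) this] obtain \<nu>1 \<beta>' where
    2: "\<nu>1 \<in> mor \<Lambda>" "\<beta>' \<in> mor \<Lambda>" "deg \<Lambda> \<nu>1 = deg \<Lambda> \<nu>" "src \<Lambda> \<nu>1 = rng \<Lambda> \<beta>'" "\<zeta> = cmp \<Lambda> \<nu>1 \<beta>'" by metis
  have s1: "src \<Lambda> \<alpha>' = rng \<Lambda> \<tau>" using src_cmp[OF 1(1,2,4)] 1(5) \<zeta>(4) by simp
  have s2: "src \<Lambda> \<beta>' = rng \<Lambda> \<tau>" using src_cmp[OF 2(1,2,4)] 2(5) \<zeta>(4) by simp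
  have c1: "cmp \<Lambda> \<mu> \<alpha> = cmp \<Lambda> \<mu>1 (cmp \<Lambda> \<alpha>' \<tau>)"
    using \<zeta>(5) 1(5) cmp_assoc[OF 1(1,2) \<zeta>(2) 1(4) s1] by simp
  have c2: "cmp \<Lambda> \<nu> \<beta> = cmp \<Lambda> \<nu>1 (cmp \<Lambda> \<beta>' \<tau>)"
    using \<zeta>(5) 2(5) cmp_assoc[OF 2(1,2) \<zeta>(2) 2(4) s2] eq by simp
  have p1: "src \<Lambda> \<mu>1 = rng \<Lambda> (cmp \<Lambda> \<alpha>' \<tau>)" using rng_cmp[OF 1(2) \<zeta>(2) s1] 1(4) by simp
  have p2: "src \<Lambda> \<nu>1 = rng \<Lambda> (cmp \<Lambda> \<beta>' \<tau>)" using rng_cmp[OF 2(2) \<zeta>(2) s2] 2(4) by simp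
  note m1 = factorize_unique[OF \<mu> 1(1) cmp_closed[OF 1(2) \<zeta>(2) s1] p1 c1 1(3)[symmetric]]
  note m2 = factorize_unique(1)[OF \<nu> 2(1) cmp_closed[OF 2(2) \<zeta>(2) s2] p2 c2 2(3)[symmetric]]
  have "(\<alpha>', \<beta>') \<in> Lambda_min \<Lambda> \<mu> \<nu>"
    unfolding Lambda_min_def n_def[symmetric] mem_Collect_eq prod.case
    using 1(2,4,5)[folded m1(1)] 2(2,4,5)[folded m2] \<zeta>(3) by metis
  then show ?thesis using that[of \<alpha>' \<beta>' \<tau>] \<zeta>(2) s1 m1(2) by blast
qed

end

text \<open>
  \<open>P \<mu>\<close> is the set of points whose itinerary starts with the path \<open>\<mu>\<close>, and \<open>g e\<close> removes the
  initial edge \<open>e\<close>.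
\<close>

locale itineraries = finitely_aligned_k_graph \<Lambda> for \<Lambda> :: "('m, 'k::finite) kgraph" +
  fixes P :: "'m \<Rightarrow> 'x set" and g :: "'m \<Rightarrow> 'x \<Rightarrow> 'x"
  assumes P_cons: "\<lbrakk>e \<in> edges \<Lambda>; \<mu> \<in> mor \<Lambda>; src \<Lambda> e = rng \<Lambda> \<mu>\<rbrakk> \<Longrightarrow>
      P (cmp \<Lambda> e \<mu>) = {x \<in> P e. g e x \<in> P \<mu>}"
    and P_edge_rng: "e \<in> edges \<Lambda> \<Longrightarrow> P e \<subseteq> P (rng \<Lambda> e)"
    and P_vertex_disjoint: "\<lbrakk>v \<in> vertices \<Lambda>; w \<in> vertices \<Lambda>; v \<noteq> w\<rbrakk> \<Longrightarrow> P v \<inter> P w = {}"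
    and P_edge_disjoint: "\<lbrakk>e \<in> paths \<Lambda> (axis i 1); e' \<in> paths \<Lambda> (axis i 1); e \<noteq> e'\<rbrakk> \<Longrightarrow> P e \<inter> P e' = {}"
    and P_edge_min: "\<lbrakk>e \<in> edges \<Lambda>; e' \<in> edges \<Lambda>; rng \<Lambda> e = rng \<Lambda> e'; deg \<Lambda> e \<noteq> deg \<Lambda> e';
      x \<in> P e; x \<in> P e'\<rbrakk> \<Longrightarrow> \<exists>(\<alpha>, \<beta>)\<in>Lambda_min \<Lambda> e e'. x \<in> P (cmp \<Lambda> e \<alpha>)"
    and P_edge_exhaustive: "\<lbrakk>v \<in> vertices \<Lambda>; finite E; E \<subseteq> edges \<Lambda>; exhaustive \<Lambda> v E\<rbrakk> \<Longrightarrow>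
      P v \<subseteq> (\<Union>e\<in>E. P e)"
begin

section \<open>Paths on a common itinerary\<close>

lemma P_rng: "\<mu> \<in> mor \<Lambda> \<Longrightarrow> P \<mu> \<subseteq> P (rng \<Lambda> \<mu>)"
proof (induction rule: path_induct)
  case (vertex v)
  then show ?case by (simp add: vertexD)
next
  case (cons e \<mu>)
  then show ?case using P_edge_rng[of e] P_cons[of e \<mu>] rng_cmp[of e \<mu>] by (auto simp: edges_mor)
qed

text \<open>\<open>P_cons\<close> applied to \<open>e\<close> followed by its source vertex.\<close>

lemma P_src: "\<lbrakk>e \<in> edges \<Lambda>; x \<in> P e\<rbrakk> \<Longrightarrow> g e x \<in> P (src \<Lambda> e)"
proof -
  assume e: "e \<in> edges \<Lambda>" and x: "x \<in> P e"
  have "P (cmp \<Lambda> e (src \<Lambda> e)) = {x \<in> P e. g e x \<in> P (src \<Lambda> e)}"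
    using e by (intro P_cons) (auto simp: edges_mor src_closed rng_src)
  moreover have "cmp \<Lambda> e (src \<Lambda> e) = e" using e by (simp add: edges_mor cmp_src)
  ultimately show ?thesis using x by auto
qed

lemma P_cmp_subset:
  "\<lbrakk>\<mu> \<in> mor \<Lambda>; \<nu> \<in> mor \<Lambda>; src \<Lambda> \<mu> = rng \<Lambda> \<nu>\<rbrakk> \<Longrightarrow> P (cmp \<Lambda> \<mu> \<nu>) \<subseteq> P \<mu>"
proof (induction rule: path_induct)
  case (vertex v)
  then show ?case using P_rng[of \<nu>] cmp_rng[of \<nu>] by (simp add: vertexD)
next
  case (cons e \<mu>)
  have s: "src \<Lambda> \<mu> = rng \<Lambda> \<nu>" using cons src_cmp[of e \<mu>] by (simp add: edges_mor)
  have "cmp \<Lambda> (cmp \<Lambda> e \<mu>) \<nu> = cmp \<Lambda> e (cmp \<Lambda> \<mu> \<nu>)"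
    using cons s by (intro cmp_assoc) (auto simp: edges_mor)
  then show ?case
    using cons s P_cons[of e "cmp \<Lambda> \<mu> \<nu>"] P_cons[of e \<mu>] rng_cmp[of \<mu> \<nu>] cmp_closed[of \<mu> \<nu>] by auto
qed

lemma same_range:
  assumes "\<mu> \<in> mor \<Lambda>" "\<nu> \<in> mor \<Lambda>" "x \<in> P \<mu>" "x \<in> P \<nu>"
  shows "rng \<Lambda> \<mu> = rng \<Lambda> \<nu>"
  using P_vertex_disjoint[OF rng_vertex rng_vertex, of \<mu> \<nu>] P_rng assms by blast

text \<open>Induction on the total length. If the initial edges \<open>e\<close> and
  \<open>f\<close> differ, the edge axiom yields a square e a = f b on the itinerary. The tail of
  \<open>\<mu>\<close> is first extended against \<open>a\<close>, which produces an extension of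
  \<open>\<mu>\<close> starting with \<open>f\<close>; its tail is then extended against the tail of
  \<open>\<nu>\<close>.\<close>

lemma common_extension:
  assumes "\<mu> \<in> mor \<Lambda>" "\<nu> \<in> mor \<Lambda>" "x \<in> P \<mu>" "x \<in> P \<nu>"
  shows "\<exists>(\<alpha>, \<beta>)\<in>Lambda_min \<Lambda> \<mu> \<nu>. x \<in> P (cmp \<Lambda> \<mu> \<alpha>)"
  using assms
proof (induction "len \<mu> + len \<nu>" arbitrary: \<mu> \<nu> x rule: less_induct)
  case less
  note \<mu> = less.prems(1) and \<nu> = less.prems(2)
  have r: "rng \<Lambda> \<mu> = rng \<Lambda> \<nu>" by (rule same_range[OF less.prems])
  consider "\<mu> \<in> vertices \<Lambda>" | "\<nu> \<in> vertices \<Lambda>" | "\<mu> \<notin> vertices \<Lambda>" "\<nu> \<notin> vertices \<Lambda>" by blast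
  then show ?case
  proof cases
    case 1
    then have "\<mu> = rng \<Lambda> \<nu>" using r vertexD by simp
    then have "(\<nu>, src \<Lambda> \<nu>) \<in> Lambda_min \<Lambda> \<mu> \<nu>" "cmp \<Lambda> \<mu> \<nu> = \<nu>"
      using \<nu> by (auto simp: Lambda_min_def src_closed src_rng rng_src cmp_rng cmp_src deg_rng vec_eq_iff)
    then show ?thesis using less.prems(4) by (intro bexI[of _ "(\<nu>, src \<Lambda> \<nu>)"]) auto
  next
    case 2
    then have "\<nu> = rng \<Lambda> \<mu>" using r vertexD by simp
    then have "(src \<Lambda> \<mu>, \<mu>) \<in> Lambda_min \<Lambda> \<mu> \<nu>" "cmp \<Lambda> \<mu> (src \<Lambda> \<mu>) = \<mu>"
      using \<mu> by (auto simp: Lambda_min_def src_closed src_rng rng_src cmp_rng cmp_src deg_rng vec_eq_iff)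
    then show ?thesis using less.prems(3) by (intro bexI[of _ "(src \<Lambda> \<mu>, \<mu>)"]) auto
  next
    case 3
    obtain e \<mu>' where e: "e \<in> edges \<Lambda>" "\<mu>' \<in> mor \<Lambda>" "src \<Lambda> e = rng \<Lambda> \<mu>'" "\<mu> = cmp \<Lambda> e \<mu>'"
      using first_edge[OF \<mu> 3(1)] .
    obtain f \<nu>' where f: "f \<in> edges \<Lambda>" "\<nu>' \<in> mor \<Lambda>" "src \<Lambda> f = rng \<Lambda> \<nu>'" "\<nu> = cmp \<Lambda> f \<nu>'"
      using first_edge[OF \<nu> 3(2)] .
    note em = edges_mor[OF e(1)] and fm = edges_mor[OF f(1)]
    have len: "len \<mu> = 1 + len \<mu>'" "len \<nu> = 1 + len \<nu>'"
      using e f em fm by (simp_all add: len_cmp len_edge)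
    have d\<mu>: "deg \<Lambda> \<mu> = deg \<Lambda> e + deg \<Lambda> \<mu>'" and d\<nu>: "deg \<Lambda> \<nu> = deg \<Lambda> f + deg \<Lambda> \<nu>'"
      using e f em fm by (simp_all add: deg_cmp)
    have s\<mu>: "src \<Lambda> \<mu> = src \<Lambda> \<mu>'" and s\<nu>: "src \<Lambda> \<nu> = src \<Lambda> \<nu>'"
      using e f em fm by (simp_all add: src_cmp)
    have xe: "x \<in> P e" "g e x \<in> P \<mu>'" using less.prems(3) P_cons[OF e(1-3)] e(4) by auto
    have xf: "x \<in> P f" "g f x \<in> P \<nu>'" using less.prems(4) P_cons[OF f(1-3)] f(4) by auto
    show ?thesis
    proof (cases "e = f")
      case True
      obtain \<alpha> \<beta> where ab: "(\<alpha>, \<beta>) \<in> Lambda_min \<Lambda> \<mu>' \<nu>'" "g e x \<in> P (cmp \<Lambda> \<mu>' \<alpha>)"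
        using less.hyps[OF _ e(2) f(2) xe(2)] xf(2) True len by auto
      note ab' = Lambda_minD[OF ab(1)]
      have 1: "cmp \<Lambda> \<mu> \<alpha> = cmp \<Lambda> e (cmp \<Lambda> \<mu>' \<alpha>)"
        unfolding e(4) by (rule cmp_assoc[OF em e(2) ab'(1) e(3) ab'(3)])
      have 2: "cmp \<Lambda> \<nu> \<beta> = cmp \<Lambda> e (cmp \<Lambda> \<nu>' \<beta>)"
        unfolding f(4) True by (rule cmp_assoc[OF fm f(2) ab'(2) f(3) ab'(4)])
      have c: "cmp \<Lambda> \<mu>' \<alpha> \<in> mor \<Lambda>" "src \<Lambda> e = rng \<Lambda> (cmp \<Lambda> \<mu>' \<alpha>)"
        using e(3) cmp_closed[OF e(2) ab'(1,3)] rng_cmp[OF e(2) ab'(1,3)] by simp_all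
      have "deg \<Lambda> (cmp \<Lambda> \<mu> \<alpha>) = (\<chi> i. max (deg \<Lambda> \<mu> $ i) (deg \<Lambda> \<nu> $ i))"
        unfolding 1 deg_cmp[OF em c] d\<mu> d\<nu> ab'(6) unfolding True by (auto simp: vec_eq_iff)
      then have "(\<alpha>, \<beta>) \<in> Lambda_min \<Lambda> \<mu> \<nu>"
        using ab' 1 2 s\<mu> s\<nu> by (auto simp: Lambda_min_def)
      moreover have "x \<in> P (cmp \<Lambda> \<mu> \<alpha>)" unfolding 1 P_cons[OF e(1) c] using xe(1) ab(2) by simp
      ultimately show ?thesis by blast
    next
      case False
      obtain i j where i: "deg \<Lambda> e = axis i 1" and j: "deg \<Lambda> f = axis j 1"
        using edge_deg[OF e(1)] edge_deg[OF f(1)] by blast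
      \<comment> \<open>Edges of one colour with a common point coincide, so \<open>e\<close> and
        \<open>f\<close> have different colours.\<close>
      have ij: "i \<noteq> j"
        using P_edge_disjoint[of e i f] i j em fm False xe(1) xf(1) by (auto simp: paths_def)
      have "rng \<Lambda> e = rng \<Lambda> f" by (rule same_range[OF em fm xe(1) xf(1)])
      moreover have "deg \<Lambda> e \<noteq> deg \<Lambda> f" using i j ij by (simp add: axis_eq_axis)
      ultimately obtain a b where ab: "(a, b) \<in> Lambda_min \<Lambda> e f" "x \<in> P (cmp \<Lambda> e a)"
        using P_edge_min[OF e(1) f(1) _ _ xe(1) xf(1)] by auto
      note ab' = Lambda_minD[OF ab(1)]
      \<comment> \<open>For distinct colours the join of two edge degrees is their sum, so
        \<open>a\<close> is an edge of the colour of \<open>f\<close>.\<close>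
      have "deg \<Lambda> e + deg \<Lambda> a = axis i 1 + axis j 1"
        using ab'(6) deg_cmp[OF em ab'(1,3)] i j ij by (auto simp: vec_eq_iff axis_def)
      then have da: "deg \<Lambda> a = axis j 1" using i by simp
      then have la: "len a = 1" by (simp add: len_def axis_def)
      have ga: "g e x \<in> P a" using ab(2) P_cons[OF e(1) ab'(1,3)] by auto
      obtain \<delta> \<delta>' where dd: "(\<delta>, \<delta>') \<in> Lambda_min \<Lambda> \<mu>' a" "g e x \<in> P (cmp \<Lambda> \<mu>' \<delta>)"
        using less.hyps[OF _ e(2) ab'(1) xe(2) ga] len la by auto
      note dd' = Lambda_minD[OF dd(1)]
      define \<gamma> where "\<gamma> = cmp \<Lambda> e (cmp \<Lambda> \<mu>' \<delta>)"
      have c: "cmp \<Lambda> \<mu>' \<delta> \<in> mor \<Lambda>" "src \<Lambda> e = rng \<Lambda> (cmp \<Lambda> \<mu>' \<delta>)"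
        using e(3) cmp_closed[OF e(2) dd'(1,3)] rng_cmp[OF e(2) dd'(1,3)] by simp_all
      have x\<gamma>: "x \<in> P \<gamma>" unfolding \<gamma>_def P_cons[OF e(1) c] using xe(1) dd(2) by simp
      have \<gamma>1: "\<gamma> = cmp \<Lambda> \<mu> \<delta>"
        unfolding \<gamma>_def e(4) by (rule cmp_assoc[OF em e(2) dd'(1) e(3) dd'(3), symmetric])
      have s: "src \<Lambda> b = rng \<Lambda> \<delta>'"
        using src_cmp[OF em ab'(1,3)] src_cmp[OF fm ab'(2,4)] ab'(5) dd'(4) by simp
      have \<gamma>2: "\<gamma> = cmp \<Lambda> f (cmp \<Lambda> b \<delta>')"
        unfolding \<gamma>_def dd'(5) cmp_assoc[OF em ab'(1) dd'(2) ab'(3) dd'(4), symmetric] ab'(5)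
        by (rule cmp_assoc[OF fm ab'(2) dd'(2) ab'(4) s])
      have c2: "cmp \<Lambda> b \<delta>' \<in> mor \<Lambda>" "src \<Lambda> f = rng \<Lambda> (cmp \<Lambda> b \<delta>')"
        using ab'(4) cmp_closed[OF ab'(2) dd'(2) s] rng_cmp[OF ab'(2) dd'(2) s] by simp_all
      have gf: "g f x \<in> P (cmp \<Lambda> b \<delta>')" using x\<gamma> unfolding \<gamma>2 P_cons[OF f(1) c2] by simp
      have d\<gamma>: "deg \<Lambda> \<gamma> = deg \<Lambda> e + (\<chi> l. max (deg \<Lambda> \<mu>' $ l) (deg \<Lambda> a $ l))"
        unfolding \<gamma>_def deg_cmp[OF em c] dd'(6) ..
      have d\<gamma>': "deg \<Lambda> \<gamma> = deg \<Lambda> f + deg \<Lambda> (cmp \<Lambda> b \<delta>')" unfolding \<gamma>2 by (rule deg_cmp[OF fm c2])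
      \<comment> \<open>\<open>\<gamma>\<close> is at most one edge longer than
        \<open>\<mu>\<close>. Removing \<open>f\<close> leaves at most \<open>len \<mu>\<close>
        edges, and \<open>\<nu>'\<close> is shorter than \<open>\<nu>\<close>, so the induction
        hypothesis applies a second time.\<close>
      have "len \<gamma> \<le> len e + (len \<mu>' + len a)"
        unfolding len_def d\<gamma> sum.distrib[symmetric] by (intro sum_mono) auto
      moreover have "len \<gamma> = 1 + len (cmp \<Lambda> b \<delta>')"
        unfolding \<gamma>2 using len_cmp[OF fm c2] len_edge[OF f(1)] by simp
      ultimately have "len \<nu>' + len (cmp \<Lambda> b \<delta>') < len \<mu> + len \<nu>"
        using len la len_edge[OF e(1)] by simp
      from less.hyps[OF this f(2) c2(1) xf(2) gf] obtain \<epsilon> \<epsilon>' where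
        ee: "(\<epsilon>, \<epsilon>') \<in> Lambda_min \<Lambda> \<nu>' (cmp \<Lambda> b \<delta>')" "g f x \<in> P (cmp \<Lambda> \<nu>' \<epsilon>)" by auto
      note ee' = Lambda_minD[OF ee(1)]
      have c3: "cmp \<Lambda> \<nu>' \<epsilon> \<in> mor \<Lambda>" "src \<Lambda> f = rng \<Lambda> (cmp \<Lambda> \<nu>' \<epsilon>)"
        using f(3) cmp_closed[OF f(2) ee'(1,3)] rng_cmp[OF f(2) ee'(1,3)] by simp_all
      have \<nu>\<epsilon>: "cmp \<Lambda> \<nu> \<epsilon> = cmp \<Lambda> f (cmp \<Lambda> \<nu>' \<epsilon>)"
        unfolding f(4) by (rule cmp_assoc[OF fm f(2) ee'(1) f(3) ee'(3)])
      have s2: "src \<Lambda> \<delta> = rng \<Lambda> \<epsilon>'"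
        using src_cmp[OF \<mu> dd'(1)] \<gamma>1 \<gamma>2 src_cmp[OF fm c2] ee'(4) s\<mu> dd'(3) by simp
      have \<gamma>\<epsilon>: "cmp \<Lambda> f (cmp \<Lambda> \<nu>' \<epsilon>) = cmp \<Lambda> \<mu> (cmp \<Lambda> \<delta> \<epsilon>')"
      proof -
        have "cmp \<Lambda> f (cmp \<Lambda> \<nu>' \<epsilon>) = cmp \<Lambda> \<gamma> \<epsilon>'"
          unfolding ee'(5) \<gamma>2 by (rule cmp_assoc[OF fm c2(1) ee'(2) c2(2) ee'(4), symmetric])
        also have "\<dots> = cmp \<Lambda> \<mu> (cmp \<Lambda> \<delta> \<epsilon>')"
          unfolding \<gamma>1 by (rule cmp_assoc[OF \<mu> dd'(1) ee'(2)]) (use s\<mu> dd'(3) s2 in auto)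
        finally show ?thesis .
      qed
      \<comment> \<open>The degree is the join of those of \<open>\<mu>\<close>,
        \<open>\<nu>\<close> and the square. The last is absorbed because \<open>\<mu>\<close>
        starts with \<open>e\<close> and \<open>\<nu>\<close> with \<open>f\<close>. Only coordinate
        \<open>j\<close> is special, being that of both \<open>a\<close> and
        \<open>f\<close>.\<close>
      have "deg \<Lambda> (cmp \<Lambda> f (cmp \<Lambda> \<nu>' \<epsilon>)) = (\<chi> l. max (deg \<Lambda> \<mu> $ l) (deg \<Lambda> \<nu> $ l))"
      proof (subst vec_eq_iff, intro allI)
        fix l
        have "(deg \<Lambda> e + (\<chi> l. max (deg \<Lambda> \<mu>' $ l) (deg \<Lambda> a $ l))) $ l = (deg \<Lambda> f + deg \<Lambda> (cmp \<Lambda> b \<delta>')) $ l"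
          using d\<gamma> d\<gamma>' by simp
        then have "deg \<Lambda> e $ l + max (deg \<Lambda> \<mu>' $ l) (deg \<Lambda> a $ l) = deg \<Lambda> f $ l + deg \<Lambda> (cmp \<Lambda> b \<delta>') $ l"
          by simp
        then show "deg \<Lambda> (cmp \<Lambda> f (cmp \<Lambda> \<nu>' \<epsilon>)) $ l = (\<chi> l. max (deg \<Lambda> \<mu> $ l) (deg \<Lambda> \<nu> $ l)) $ l"
          unfolding deg_cmp[OF fm c3] ee'(6) d\<mu> d\<nu> i j da using ij by (cases "l = j") (auto simp: axis_def)
      qed
      then have "(cmp \<Lambda> \<delta> \<epsilon>', \<epsilon>) \<in> Lambda_min \<Lambda> \<mu> \<nu>"
        using \<gamma>\<epsilon> \<nu>\<epsilon> dd' ee' s2 s\<mu> s\<nu> by (auto simp: Lambda_min_def cmp_closed rng_cmp)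
      moreover have "x \<in> P (cmp \<Lambda> \<mu> (cmp \<Lambda> \<delta> \<epsilon>'))"
        unfolding \<gamma>\<epsilon>[symmetric] P_cons[OF f(1) c3] using xf(1) ee(2) by simp
      ultimately show ?thesis by blast
    qed
  qed
qed

text \<open>A minimal common extension has both paths as initial segments of equal degree.\<close>

lemma same_degree_disjoint:
  assumes "\<mu> \<in> mor \<Lambda>" "\<nu> \<in> mor \<Lambda>" "deg \<Lambda> \<mu> = deg \<Lambda> \<nu>" "x \<in> P \<mu>" "x \<in> P \<nu>"
  shows "\<mu> = \<nu>"
proof -
  obtain \<alpha> \<beta> where ab: "(\<alpha>, \<beta>) \<in> Lambda_min \<Lambda> \<mu> \<nu>" using common_extension[OF assms(1,2,4,5)] by blast
  note ab' = Lambda_minD[OF ab]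
  show ?thesis by (rule factorize_unique(1)[OF assms(1) ab'(1,3) assms(2) ab'(2,4,5) assms(3)])
qed

text \<open>
  The induction removes an initial edge \<open>e\<close> of a member of \<open>E\<close>: the tails \<open>\<alpha>\<close> of the minimal common
  extensions of \<open>e\<close> with members of \<open>E\<close> form an exhaustive set at \<open>s(e)\<close> with smaller degree bound.
\<close>

lemma exhaustive_cover:
  assumes "v \<in> vertices \<Lambda>" "finite E" "exhaustive \<Lambda> v E" "x \<in> P v"
    and "\<And>\<mu> i. \<mu> \<in> E \<Longrightarrow> deg \<Lambda> \<mu> $ i \<le> N i"
  shows "\<exists>\<mu>\<in>E. x \<in> P \<mu>"
  using assms
proof (induction "\<Sum>i\<in>UNIV. N i" arbitrary: v E x N rule: less_induct)
  case less
  note v = less.prems(1) and fin = less.prems(2) and ex = less.prems(3) and x = less.prems(4) and N = less.prems(5)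
  have E: "\<mu> \<in> mor \<Lambda>" "rng \<Lambda> \<mu> = v" if "\<mu> \<in> E" for \<mu> using ex that by (auto simp: exhaustive_def)
  show ?case
  proof (cases "v \<in> E")
    case True
    then show ?thesis using x by blast
  next
    case False
    have "\<exists>e \<mu>'. e \<in> edges \<Lambda> \<and> \<mu>' \<in> mor \<Lambda> \<and> src \<Lambda> e = rng \<Lambda> \<mu>' \<and> \<mu> = cmp \<Lambda> e \<mu>'" if "\<mu> \<in> E" for \<mu>
    proof -
      have "\<mu> \<notin> vertices \<Lambda>" using E[OF that] that False vertexD(1) by auto
      then show ?thesis using first_edge[OF E(1)[OF that]] by metis
    qed
    then obtain h t where ht: "\<And>\<mu>. \<mu> \<in> E \<Longrightarrow> h \<mu> \<in> edges \<Lambda>" "\<And>\<mu>. \<mu> \<in> E \<Longrightarrow> t \<mu> \<in> mor \<Lambda>"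
      "\<And>\<mu>. \<mu> \<in> E \<Longrightarrow> src \<Lambda> (h \<mu>) = rng \<Lambda> (t \<mu>)" "\<And>\<mu>. \<mu> \<in> E \<Longrightarrow> \<mu> = cmp \<Lambda> (h \<mu>) (t \<mu>)" by metis
    \<comment> \<open>A common extension with a member of \<open>E\<close> is also one with its
      initial edge, and it factors through a minimal one. Hence the initial edges are exhaustive and
      the edge axiom \<open>P_edge_exhaustive\<close> applies.\<close>
    have "exhaustive \<Lambda> v (h ` E)"
      unfolding exhaustive_def
    proof (intro conjI ballI impI)
      show "h ` E \<subseteq> {\<nu> \<in> mor \<Lambda>. rng \<Lambda> \<nu> = v}"
      proof
        fix e assume "e \<in> h ` E"
        then obtain \<mu> where \<mu>: "\<mu> \<in> E" "e = h \<mu>" by blast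
        note h = ht[OF \<mu>(1)]
        show "e \<in> {\<nu> \<in> mor \<Lambda>. rng \<Lambda> \<nu> = v}"
          using E[OF \<mu>(1)] rng_cmp[OF edges_mor[OF h(1)] h(2,3)] h(4) edges_mor[OF h(1)] \<mu>(2) by simp
      qed
    next
      fix \<mu> assume \<mu>: "\<mu> \<in> mor \<Lambda>" "rng \<Lambda> \<mu> = v"
      then obtain \<nu> where "\<nu> \<in> E" "Lambda_min \<Lambda> \<mu> \<nu> \<noteq> {}" using ex unfolding exhaustive_def by blast
      then obtain \<alpha> \<beta> where \<nu>: "\<nu> \<in> E" "(\<alpha>, \<beta>) \<in> Lambda_min \<Lambda> \<mu> \<nu>" by auto
      note ab = Lambda_minD[OF \<nu>(2)]
      note h = ht[OF \<nu>(1)]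
      have s: "src \<Lambda> (t \<nu>) = rng \<Lambda> \<beta>" using src_cmp[OF edges_mor[OF h(1)] h(2,3)] h(4) ab(4) by simp
      have "cmp \<Lambda> \<mu> \<alpha> = cmp \<Lambda> (cmp \<Lambda> (h \<nu>) (t \<nu>)) \<beta>" using ab(5) h(4) by simp
      also have "\<dots> = cmp \<Lambda> (h \<nu>) (cmp \<Lambda> (t \<nu>) \<beta>)"
        by (rule cmp_assoc[OF edges_mor[OF h(1)] h(2) ab(2) h(3) s])
      finally have "Lambda_min \<Lambda> \<mu> (h \<nu>) \<noteq> {}"
        using Lambda_min_factor[OF \<mu>(1) ab(1,3) edges_mor[OF h(1)] cmp_closed[OF h(2) ab(2) s]]
          rng_cmp[OF h(2) ab(2) s] h(3) by auto
      then show "\<exists>\<nu>\<in>h ` E. Lambda_min \<Lambda> \<mu> \<nu> \<noteq> {}" using \<nu>(1) by blast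
    qed
    then have "P v \<subseteq> (\<Union>e\<in>h ` E. P e)"
      using ht(1) fin v by (intro P_edge_exhaustive) auto
    then obtain \<mu>0 where \<mu>0: "\<mu>0 \<in> E" "x \<in> P (h \<mu>0)" using x by auto
    define e where "e = h \<mu>0"
    have e: "e \<in> edges \<Lambda>" "e \<in> mor \<Lambda>" "x \<in> P e" using \<mu>0 ht(1) by (auto simp: e_def edges_mor)
    have re: "rng \<Lambda> e = v"
      using rng_cmp[OF e(2), of "t \<mu>0"] ht[OF \<mu>0(1)] E[OF \<mu>0(1)] by (simp add: e_def)
    obtain i where i: "deg \<Lambda> e = axis i 1" using edge_deg[OF e(1)] by blast
    have "deg \<Lambda> \<mu>0 = axis i 1 + deg \<Lambda> (t \<mu>0)"
      using deg_cmp[OF e(2), of "t \<mu>0"] ht[OF \<mu>0(1)] i by (simp add: e_def)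
    then have "1 \<le> deg \<Lambda> \<mu>0 $ i" by (simp add: axis_def)
    then have Ni: "1 \<le> N i" using N[OF \<mu>0(1), of i] by simp
    \<comment> \<open>The bound drops by one at the colour of \<open>e\<close>. As
      \<open>\<mu>0\<close> starts with \<open>e\<close>, \<open>N i\<close> is positive and the
      total really decreases.\<close>
    define N' where "N' = N(i := N i - 1)"
    define E' where "E' = fst ` (\<Union>\<mu>\<in>E. Lambda_min \<Lambda> e \<mu>)"
    have E'I: "\<alpha> \<in> E'" if "\<mu> \<in> E" "(\<alpha>, \<beta>) \<in> Lambda_min \<Lambda> e \<mu>" for \<alpha> \<beta> \<mu> using that by (force simp: E'_def)
    have E'D: "\<exists>\<mu>\<in>E. \<exists>\<beta>. (\<alpha>, \<beta>) \<in> Lambda_min \<Lambda> e \<mu>" if "\<alpha> \<in> E'" for \<alpha> using that by (force simp: E'_def)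
    have "\<exists>\<alpha>\<in>E'. g e x \<in> P \<alpha>"
    proof (rule less.hyps)
      have "(\<Sum>j\<in>UNIV. N j) = N i + (\<Sum>j\<in>UNIV - {i}. N j)" "(\<Sum>j\<in>UNIV. N' j) = N' i + (\<Sum>j\<in>UNIV - {i}. N' j)"
        by (simp_all add: sum.remove)
      moreover have "(\<Sum>j\<in>UNIV - {i}. N' j) = (\<Sum>j\<in>UNIV - {i}. N j)" by (intro sum.cong) (auto simp: N'_def)
      ultimately show "(\<Sum>j\<in>UNIV. N' j) < (\<Sum>j\<in>UNIV. N j)" using Ni by (simp add: N'_def)
      show "src \<Lambda> e \<in> vertices \<Lambda>" by (rule src_vertex[OF e(2)])
      show "finite E'" unfolding E'_def using fin E(1) e(2) finite_Lambda_min by auto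
      show "g e x \<in> P (src \<Lambda> e)" by (rule P_src[OF e(1,3)])
      show "exhaustive \<Lambda> (src \<Lambda> e) E'"
        unfolding exhaustive_def
      proof (intro conjI ballI impI subsetI)
        fix \<alpha> assume "\<alpha> \<in> E'"
        then show "\<alpha> \<in> {\<nu> \<in> mor \<Lambda>. rng \<Lambda> \<nu> = src \<Lambda> e}" using E'D Lambda_minD by fastforce
      next
        fix \<nu> assume \<nu>: "\<nu> \<in> mor \<Lambda>" "rng \<Lambda> \<nu> = src \<Lambda> e"
        \<comment> \<open>Extend e \<nu> together with a member \<open>\<mu>\<close> of
          \<open>E\<close>. As a common extension of \<open>e\<close> and \<open>\<mu>\<close> this
          factors through a minimal one with tail \<open>\<alpha>\<close>, so \<nu> and
          \<open>\<alpha>\<close> have a common extension too.\<close>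
        have "cmp \<Lambda> e \<nu> \<in> mor \<Lambda>" "rng \<Lambda> (cmp \<Lambda> e \<nu>) = v"
          using \<nu> e(2) re by (simp_all add: cmp_closed rng_cmp)
        then obtain \<mu> where "\<mu> \<in> E" "Lambda_min \<Lambda> (cmp \<Lambda> e \<nu>) \<mu> \<noteq> {}"
          using ex unfolding exhaustive_def by blast
        then obtain \<gamma> \<delta> where \<mu>: "\<mu> \<in> E" "(\<gamma>, \<delta>) \<in> Lambda_min \<Lambda> (cmp \<Lambda> e \<nu>) \<mu>" by auto
        note cd = Lambda_minD[OF \<mu>(2)]
        have s: "src \<Lambda> \<nu> = rng \<Lambda> \<gamma>" using cd(3) src_cmp[OF e(2) \<nu>(1)] \<nu>(2) by simp
        have "cmp \<Lambda> e (cmp \<Lambda> \<nu> \<gamma>) = cmp \<Lambda> \<mu> \<delta>"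
          using cd(5) cmp_assoc[OF e(2) \<nu>(1) cd(1)] \<nu>(2) s by simp
        from Lambda_min_factor[OF e(2) cmp_closed[OF \<nu>(1) cd(1) s] _ E(1)[OF \<mu>(1)] cd(2,4) this]
        obtain \<alpha> \<beta> \<tau> where at: "(\<alpha>, \<beta>) \<in> Lambda_min \<Lambda> e \<mu>" "\<tau> \<in> mor \<Lambda>" "src \<Lambda> \<alpha> = rng \<Lambda> \<tau>" "cmp \<Lambda> \<nu> \<gamma> = cmp \<Lambda> \<alpha> \<tau>"
          using rng_cmp[OF \<nu>(1) cd(1) s] \<nu>(2) by metis
        from Lambda_min_factor[OF \<nu>(1) cd(1) s Lambda_minD(1)[OF at(1)] at(2,3,4)]
        have "Lambda_min \<Lambda> \<nu> \<alpha> \<noteq> {}" by blast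
        then show "\<exists>\<alpha>\<in>E'. Lambda_min \<Lambda> \<nu> \<alpha> \<noteq> {}" using E'I[OF \<mu>(1) at(1)] by blast
      qed
      fix \<alpha> l assume "\<alpha> \<in> E'"
      then obtain \<mu> \<beta> where \<mu>: "\<mu> \<in> E" "(\<alpha>, \<beta>) \<in> Lambda_min \<Lambda> e \<mu>" using E'D by blast
      note ab = Lambda_minD[OF \<mu>(2)]
      \<comment> \<open>At colour \<open>i\<close> both entries of the maximum are at most
        \<open>N i\<close>, and \<open>e\<close> accounts for one unit of the sum.\<close>
      have "(deg \<Lambda> e + deg \<Lambda> \<alpha>) $ l = max (deg \<Lambda> e $ l) (deg \<Lambda> \<mu> $ l)"
        unfolding deg_cmp[OF e(2) ab(1,3), symmetric] ab(6) by simp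
      then show "deg \<Lambda> \<alpha> $ l \<le> N' l"
        using N[OF \<mu>(1), of l] Ni i by (auto simp: N'_def axis_def)
    qed
    then obtain \<alpha> \<mu> \<beta> where \<mu>: "\<mu> \<in> E" "(\<alpha>, \<beta>) \<in> Lambda_min \<Lambda> e \<mu>" "g e x \<in> P \<alpha>" using E'D by blast
    note ab = Lambda_minD[OF \<mu>(2)]
    have "x \<in> P (cmp \<Lambda> e \<alpha>)" unfolding P_cons[OF e(1) ab(1,3)] using e(3) \<mu>(3) by simp
    then have "x \<in> P \<mu>" using P_cmp_subset[OF E(1)[OF \<mu>(1)] ab(2,4)] ab(5) by auto
    then show ?thesis using \<mu>(1) by blast
  qed
qed

lemma P_exhaustive:
  assumes "v \<in> vertices \<Lambda>" "finite E" "exhaustive \<Lambda> v E"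
  shows "P v = (\<Union>\<mu>\<in>E. P \<mu>)"
proof
  show "P v \<subseteq> (\<Union>\<mu>\<in>E. P \<mu>)"
  proof
    fix x assume x: "x \<in> P v"
    \<comment> \<open>The sum of the degrees over \<open>E\<close> is a crude common bound.\<close>
    have "\<exists>\<mu>\<in>E. x \<in> P \<mu>"
      by (rule exhaustive_cover[OF assms x, where N = "\<lambda>i. \<Sum>\<mu>\<in>E. deg \<Lambda> \<mu> $ i"])
        (use assms(2) in \<open>auto intro: member_le_sum\<close>)
    then show "x \<in> (\<Union>\<mu>\<in>E. P \<mu>)" by blast
  qed
  show "(\<Union>\<mu>\<in>E. P \<mu>) \<subseteq> P v" using assms(3) P_rng by (fastforce simp: exhaustive_def)
qed

end

section \<open>Branching systems\<close>

locale branching = finitely_aligned_k_graph \<Lambda> + branching_system \<Lambda> M D R f g + sigma_finite_measure M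
  for \<Lambda> :: "('m, 'k::finite) kgraph" and M :: "'x measure"
    and D R :: "'m \<Rightarrow> 'x set" and f g :: "'m \<Rightarrow> 'x \<Rightarrow> 'x"
begin

section \<open>Null sets along edges and the good set\<close>

abbreviation "MD e \<equiv> restrict_space M (D (src \<Lambda> e))"
abbreviation "MR e \<equiv> restrict_space M (R e)"

lemma edge_rng: "e \<in> edges \<Lambda> \<Longrightarrow> rng \<Lambda> e \<in> vertices \<Lambda>"
  and edge_src: "e \<in> edges \<Lambda> \<Longrightarrow> src \<Lambda> e \<in> vertices \<Lambda>"
  by (simp_all add: rng_vertex src_vertex edges_mor)

lemma D_src_sets: "e \<in> edges \<Lambda> \<Longrightarrow> D (src \<Lambda> e) \<in> sets M"
  by (intro D_sets edge_src)

lemma space_MD: "e \<in> edges \<Lambda> \<Longrightarrow> space (MD e) = D (src \<Lambda> e)"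
  and space_MR: "e \<in> edges \<Lambda> \<Longrightarrow> space (MR e) = R e"
  using D_src_sets R_sets by (auto simp: space_restrict_space dest: sets.sets_into_space)

lemma f_mem: "\<lbrakk>e \<in> edges \<Lambda>; x \<in> D (src \<Lambda> e)\<rbrakk> \<Longrightarrow> f e x \<in> R e"
  using measurable_space[OF f_measurable] by (auto simp: space_MD space_MR)

lemma g_mem: "\<lbrakk>e \<in> edges \<Lambda>; x \<in> R e\<rbrakk> \<Longrightarrow> g e x \<in> D (src \<Lambda> e)"
  using measurable_space[OF g_measurable] by (auto simp: space_MD space_MR)

lemma AE_MD: "e \<in> edges \<Lambda> \<Longrightarrow> (AE x in MD e. Q x) \<longleftrightarrow> (AE x in M. x \<in> D (src \<Lambda> e) \<longrightarrow> Q x)"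
  and AE_MR: "e \<in> edges \<Lambda> \<Longrightarrow> (AE x in MR e. Q x) \<longleftrightarrow> (AE x in M. x \<in> R e \<longrightarrow> Q x)"
  using D_src_sets R_sets by (auto intro!: AE_restrict_space_iff)

text \<open>Absolute continuity of the image measure says that preimages of null sets under
  \<open>g e\<close> are null; \<open>AE_f\<close> is the same for \<open>f e\<close>.\<close>

lemma AE_g:
  assumes "e \<in> edges \<Lambda>" "AE x in M. Q x"
  shows "AE x in M. x \<in> R e \<longrightarrow> Q (g e x)"
proof -
  have "AE x in MD e. Q x" using assms by (subst AE_MD) auto
  then have "AE x in distr (MR e) (MD e) (g e). Q x"
    by (rule absolutely_continuous_AE[OF _ g_absolutely_continuous[OF assms(1)], rotated]) simp
  then have "AE x in MR e. Q (g e x)" by (rule AE_distrD[OF g_measurable[OF assms(1)]])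
  then show ?thesis by (simp add: AE_MR assms(1))
qed

lemma AE_f:
  assumes "e \<in> edges \<Lambda>" "AE x in M. Q x"
  shows "AE x in M. x \<in> D (src \<Lambda> e) \<longrightarrow> Q (f e x)"
proof -
  have "AE x in MR e. Q x" using assms by (subst AE_MR) auto
  then have "AE x in distr (MD e) (MR e) (f e). Q x"
    by (rule absolutely_continuous_AE[OF _ f_absolutely_continuous[OF assms(1)], rotated]) simp
  then have "AE x in MD e. Q (f e x)" by (rule AE_distrD[OF f_measurable[OF assms(1)]])
  then show ?thesis by (simp add: AE_MD assms(1))
qed

definition relations_at :: "'x \<Rightarrow> bool" where
  "relations_at x \<longleftrightarrow>
    (\<forall>\<mu>\<in>edges \<Lambda>. \<forall>\<nu>\<in>edges \<Lambda>. deg \<Lambda> \<mu> = deg \<Lambda> \<nu> \<and> \<mu> \<noteq> \<nu> \<longrightarrow> x \<notin> R \<mu> \<inter> R \<nu>) \<and>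
    (\<forall>v\<in>vertices \<Lambda>. \<forall>w\<in>vertices \<Lambda>. v \<noteq> w \<longrightarrow> x \<notin> D v \<inter> D w) \<and>
    (\<forall>\<mu>\<in>edges \<Lambda>. (x \<in> R \<mu> \<longrightarrow> x \<in> D (rng \<Lambda> \<mu>) \<and> f \<mu> (g \<mu> x) = x) \<and>
      (x \<in> D (src \<Lambda> \<mu>) \<longrightarrow> g \<mu> (f \<mu> x) = x)) \<and>
    (\<forall>\<mu>\<in>edges \<Lambda>. \<forall>\<nu>\<in>edges \<Lambda>. \<forall>\<alpha>\<in>edges \<Lambda>. \<forall>\<beta>\<in>edges \<Lambda>.
      src \<Lambda> \<mu> = rng \<Lambda> \<nu> \<and> src \<Lambda> \<alpha> = rng \<Lambda> \<beta> \<and> cmp \<Lambda> \<mu> \<nu> = cmp \<Lambda> \<alpha> \<beta> \<longrightarrow>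
      x \<in> D (src \<Lambda> \<nu>) \<longrightarrow> f \<mu> (f \<nu> x) = f \<alpha> (f \<beta> x)) \<and>
    (\<forall>\<mu>\<in>edges \<Lambda>. \<forall>\<nu>\<in>edges \<Lambda>. rng \<Lambda> \<mu> = rng \<Lambda> \<nu> \<and> deg \<Lambda> \<mu> \<noteq> deg \<Lambda> \<nu> \<longrightarrow>
      x \<notin> f \<mu> ` (D (src \<Lambda> \<mu>) - (\<Union>(\<alpha>, \<beta>)\<in>Lambda_min \<Lambda> \<mu> \<nu>. R \<alpha>)) \<inter>
          f \<nu> ` (D (src \<Lambda> \<nu>) - (\<Union>(\<alpha>, \<beta>)\<in>Lambda_min \<Lambda> \<mu> \<nu>. R \<beta>))) \<and>
    (\<forall>v\<in>vertices \<Lambda>. \<forall>E\<in>{E. finite E \<and> E \<subseteq> edges \<Lambda>}. exhaustive \<Lambda> v E \<longrightarrow>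
      (x \<in> (\<Union>\<mu>\<in>E. R \<mu>) \<longleftrightarrow> x \<in> D v))"

lemma countable_edges: "countable (edges \<Lambda>)"
  by (rule countable_subset[OF _ countable_mor]) (auto intro: edges_mor)

lemma countable_vertices: "countable (vertices \<Lambda>)"
  by (rule countable_subset[OF _ countable_mor]) (auto intro: vertex_mor)

text \<open>Edges, vertices and finite sets of edges form countable families, so the exceptional
  null sets may be united.\<close>

lemma AE_relations_at: "AE x in M. relations_at x"
  unfolding relations_at_def
proof (intro AE_conjI AE_ball_countable' countable_edges countable_vertices
    countable_Collect_finite_subset AE_impI)
  fix \<mu> \<nu> assume e: "\<mu> \<in> edges \<Lambda>" "\<nu> \<in> edges \<Lambda>" and ne: "deg \<Lambda> \<mu> = deg \<Lambda> \<nu> \<and> \<mu> \<noteq> \<nu>"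
  obtain i where "deg \<Lambda> \<mu> = axis i 1" using edge_deg[OF e(1)] by blast
  then have "\<mu> \<in> paths \<Lambda> (axis i 1)" "\<nu> \<in> paths \<Lambda> (axis i 1)"
    using e ne by (simp_all add: paths_def edges_mor)
  then show "AE x in M. x \<notin> R \<mu> \<inter> R \<nu>" using ne by (intro R_disjoint) simp_all
next
  fix v w assume "v \<in> vertices \<Lambda>" "w \<in> vertices \<Lambda>" "v \<noteq> w"
  then show "AE x in M. x \<notin> D v \<inter> D w" by (rule D_disjoint)
next
  fix \<mu> assume e: "\<mu> \<in> edges \<Lambda>"
  show "AE x in M. x \<in> R \<mu> \<longrightarrow> x \<in> D (rng \<Lambda> \<mu>) \<and> f \<mu> (g \<mu> x) = x"
    using R_subset_D[OF e] f_g[OF e] by eventually_elim simp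
  show "AE x in M. x \<in> D (src \<Lambda> \<mu>) \<longrightarrow> g \<mu> (f \<mu> x) = x" by (rule g_f[OF e])
next
  fix \<mu> \<nu> \<alpha> \<beta> assume "\<mu> \<in> edges \<Lambda>" "\<nu> \<in> edges \<Lambda>" "\<alpha> \<in> edges \<Lambda>" "\<beta> \<in> edges \<Lambda>"
    "src \<Lambda> \<mu> = rng \<Lambda> \<nu> \<and> src \<Lambda> \<alpha> = rng \<Lambda> \<beta> \<and> cmp \<Lambda> \<mu> \<nu> = cmp \<Lambda> \<alpha> \<beta>"
  then show "AE x in M. x \<in> D (src \<Lambda> \<nu>) \<longrightarrow> f \<mu> (f \<nu> x) = f \<alpha> (f \<beta> x)"
    by (intro f_commute) simp_all
next
  fix \<mu> \<nu> assume "\<mu> \<in> edges \<Lambda>" "\<nu> \<in> edges \<Lambda>" "rng \<Lambda> \<mu> = rng \<Lambda> \<nu> \<and> deg \<Lambda> \<mu> \<noteq> deg \<Lambda> \<nu>"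
  then show "AE x in M. x \<notin> f \<mu> ` (D (src \<Lambda> \<mu>) - (\<Union>(\<alpha>, \<beta>)\<in>Lambda_min \<Lambda> \<mu> \<nu>. R \<alpha>)) \<inter>
      f \<nu> ` (D (src \<Lambda> \<nu>) - (\<Union>(\<alpha>, \<beta>)\<in>Lambda_min \<Lambda> \<mu> \<nu>. R \<beta>))"
    by (intro f_images_disjoint) simp_all
next
  fix v E assume "v \<in> vertices \<Lambda>" "E \<in> {E. finite E \<and> E \<subseteq> edges \<Lambda>}" "exhaustive \<Lambda> v E"
  then show "AE x in M. x \<in> (\<Union>\<mu>\<in>E. R \<mu>) \<longleftrightarrow> x \<in> D v" by (intro exhaustive_union) simp_all
qed

text \<open>
  Every point reached from a point of the good set by finitely many maps \<open>f\<^sub>e\<close>, \<open>g\<^sub>e\<close> satisfies all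
  relations exactly. Since the maps are nonsingular, almost every point is good.
\<close>

definition step :: "bool \<times> 'm \<Rightarrow> 'x \<Rightarrow> 'x" where
  "step s x = (case s of (b, e) \<Rightarrow>
     if b then if x \<in> D (src \<Lambda> e) then f e x else x else if x \<in> R e then g e x else x)"

text \<open>\<open>step\<close> acts as the identity where its map is undefined, so every word acts
  on every point. Quantifying over whole words is what makes the set invariant.\<close>

definition good :: "'x set" where
  "good = {x \<in> space M. \<forall>w\<in>lists (UNIV \<times> edges \<Lambda>). relations_at (fold step w x)}"

lemma AE_step:
  assumes "s \<in> UNIV \<times> edges \<Lambda>" "AE x in M. Q x"
  shows "AE x in M. Q (step s x)"
proof -
  obtain b e where s: "s = (b, e)" "e \<in> edges \<Lambda>" using assms(1) by auto
  from assms(2) AE_f[OF s(2) assms(2)] AE_g[OF s(2) assms(2)] show ?thesis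
    by eventually_elim (auto simp: step_def s)
qed

lemma AE_good: "AE x in M. x \<in> good"
proof -
  \<comment> \<open>The null set for \<open>w\<close> is pulled back along the letter that acts
    first.\<close>
  have orbit: "AE x in M. Q (fold step w x)" if "w \<in> lists (UNIV \<times> edges \<Lambda>)" "AE x in M. Q x" for w Q
    using that
  proof (induction w arbitrary: Q)
    case (Cons s w)
    then have s: "s \<in> UNIV \<times> edges \<Lambda>" and "AE x in M. Q (fold step w x)" by auto
    from AE_step[OF this] show ?case by simp
  qed simp
  have "AE x in M. \<forall>w\<in>lists (UNIV \<times> edges \<Lambda>). relations_at (fold step w x)"
    by (rule AE_ball_countable'[OF orbit[OF _ AE_relations_at]])
      (auto intro!: countable_lists countable_SIGMA countable_edges)
  then show ?thesis unfolding good_def by (auto elim: AE_mp)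
qed

lemma good_relations: "x \<in> good \<Longrightarrow> relations_at x"
  unfolding good_def by (auto dest: bspec[where x = "[]"])

text \<open>A word acting on the new point is a word acting on \<open>x\<close> with
  \<open>s\<close> prefixed.\<close>

lemma good_step:
  assumes "x \<in> good" "s \<in> UNIV \<times> edges \<Lambda>" "step s x \<in> space M"
  shows "step s x \<in> good"
proof -
  have "relations_at (fold step w (step s x))" if "w \<in> lists (UNIV \<times> edges \<Lambda>)" for w
  proof -
    have "s # w \<in> lists (UNIV \<times> edges \<Lambda>)" using that assms(2) by simp
    then have "relations_at (fold step (s # w) x)" using assms(1) unfolding good_def by blast
    then show ?thesis by simp
  qed
  then show ?thesis using assms(3) by (simp add: good_def)
qed

lemma good_f: "\<lbrakk>x \<in> good; e \<in> edges \<Lambda>; x \<in> D (src \<Lambda> e)\<rbrakk> \<Longrightarrow> f e x \<in> good"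
  using good_step[of x "(True, e)"] f_mem[of e x] R_sets[of e] by (auto simp: step_def dest: sets.sets_into_space)

lemma good_g: "\<lbrakk>x \<in> good; e \<in> edges \<Lambda>; x \<in> R e\<rbrakk> \<Longrightarrow> g e x \<in> good"
  using good_step[of x "(False, e)"] g_mem[of e x] D_src_sets[of e]
  by (auto simp: step_def dest: sets.sets_into_space)

lemma
  assumes "x \<in> good" "e \<in> edges \<Lambda>"
  shows good_f_g: "x \<in> R e \<Longrightarrow> f e (g e x) = x"
    and good_g_f: "x \<in> D (src \<Lambda> e) \<Longrightarrow> g e (f e x) = x"
    and good_R_D: "x \<in> R e \<Longrightarrow> x \<in> D (rng \<Lambda> e)"
proof -
  have "\<forall>e\<in>edges \<Lambda>. (x \<in> R e \<longrightarrow> x \<in> D (rng \<Lambda> e) \<and> f e (g e x) = x) \<and>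
      (x \<in> D (src \<Lambda> e) \<longrightarrow> g e (f e x) = x)"
    using good_relations[OF assms(1)] unfolding relations_at_def by (elim conjE)
  from bspec[OF this assms(2)] show "x \<in> R e \<Longrightarrow> f e (g e x) = x"
    "x \<in> D (src \<Lambda> e) \<Longrightarrow> g e (f e x) = x" "x \<in> R e \<Longrightarrow> x \<in> D (rng \<Lambda> e)" by simp_all
qed

text \<open>Go from \<open>x\<close> down one side of the square to \<open>z\<close> and return
  along the other side: \<open>f e (f a z) = f e' (f b z)\<close> recovers \<open>x\<close>, and the
  values of \<open>f b\<close> and \<open>f e'\<close> lie in the required ranges.\<close>

lemma good_square:
  assumes x: "x \<in> good" "x \<in> R e" "g e x \<in> R a"
    and e: "e \<in> edges \<Lambda>" "a \<in> edges \<Lambda>" "e' \<in> edges \<Lambda>" "b \<in> edges \<Lambda>"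
    and sq: "src \<Lambda> e = rng \<Lambda> a" "src \<Lambda> e' = rng \<Lambda> b" "cmp \<Lambda> e a = cmp \<Lambda> e' b"
  shows "x \<in> R e'" "g e' x \<in> R b" "g b (g e' x) = g a (g e x)"
proof -
  define z where "z = g a (g e x)"
  have s: "src \<Lambda> a = src \<Lambda> b" using src_cmp[of e a] src_cmp[of e' b] e sq by (simp add: edges_mor)
  have ge: "g e x \<in> good" by (rule good_g[OF x(1) e(1) x(2)])
  have z: "z \<in> good" "z \<in> D (src \<Lambda> a)" "z \<in> D (src \<Lambda> b)"
    using good_g[OF ge e(2) x(3)] g_mem[OF e(2) x(3)] s by (simp_all add: z_def)
  have fe: "f e (f a z) = x"
    using good_f_g[OF ge e(2) x(3)] good_f_g[OF x(1) e(1) x(2)] by (simp add: z_def)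
  have "f e (f a z) = f e' (f b z)"
    using good_relations[OF z(1)] e sq z(2) unfolding relations_at_def by blast
  then have x_eq: "x = f e' (f b z)" using fe by simp
  have fb: "f b z \<in> R b" "f b z \<in> good" using f_mem[OF e(4) z(3)] good_f[OF z(1) e(4) z(3)] by simp_all
  then have fb': "f b z \<in> D (src \<Lambda> e')" using good_R_D[OF fb(2) e(4)] sq by simp
  show "x \<in> R e'" using f_mem[OF e(3) fb'] x_eq by simp
  have gx: "g e' x = f b z" using good_g_f[OF fb(2) e(3) fb'] x_eq by simp
  show "g e' x \<in> R b" "g b (g e' x) = g a (g e x)"
    using gx fb good_g_f[OF z(1) e(4) z(3)] by (simp_all add: z_def)
qed

text \<open>For two different colours the join of the degrees is their sum, so each tail has the
  degree of the other edge.\<close>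

lemma Lambda_min_edges:
  assumes "e \<in> edges \<Lambda>" "e' \<in> edges \<Lambda>" "deg \<Lambda> e \<noteq> deg \<Lambda> e'" "(\<alpha>, \<beta>) \<in> Lambda_min \<Lambda> e e'"
  shows "\<alpha> \<in> edges \<Lambda>" "\<beta> \<in> edges \<Lambda>"
proof -
  note ab = Lambda_minD[OF assms(4)]
  obtain i j where ij: "deg \<Lambda> e = axis i 1" "deg \<Lambda> e' = axis j 1" using assms(1,2) edge_deg by metis
  then have ne: "i \<noteq> j" using assms(3) by auto
  have sum: "deg \<Lambda> (cmp \<Lambda> e \<alpha>) = axis i 1 + axis j 1"
    unfolding ab(6) ij using ne by (auto simp: vec_eq_iff axis_def)
  have "axis i 1 + deg \<Lambda> \<alpha> = axis i 1 + axis j 1"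
    using sum deg_cmp[of e \<alpha>] ab ij assms(1) by (simp add: edges_mor)
  moreover have "axis j 1 + deg \<Lambda> \<beta> = axis j 1 + axis i 1"
    using sum deg_cmp[of e' \<beta>] ab(2,4,5) ij assms(2) by (simp add: edges_mor add.commute)
  ultimately show "\<alpha> \<in> edges \<Lambda>" "\<beta> \<in> edges \<Lambda>" using ab(1,2) by (auto simp: edges_def paths_def)
qed

text \<open>Intersecting with \<open>good\<close> at every stage turns the almost-everywhere
  relations into the exact set identities that the itinerary axioms demand.\<close>

lemma ex_itineraries:
  obtains P where "itineraries \<Lambda> P g" "\<And>v. v \<in> vertices \<Lambda> \<Longrightarrow> P v = D v \<inter> good"
    "\<And>e \<mu>. \<lbrakk>e \<in> edges \<Lambda>; \<mu> \<in> mor \<Lambda>; src \<Lambda> e = rng \<Lambda> \<mu>\<rbrakk> \<Longrightarrow>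
      P (cmp \<Lambda> e \<mu>) = {x \<in> R e \<inter> good. g e x \<in> P \<mu>}"
proof -
  obtain P where Pv: "\<And>v. v \<in> vertices \<Lambda> \<Longrightarrow> P v = D v \<inter> good"
    and Pc: "\<And>e \<mu>. \<lbrakk>e \<in> edges \<Lambda>; \<mu> \<in> mor \<Lambda>; src \<Lambda> e = rng \<Lambda> \<mu>\<rbrakk> \<Longrightarrow>
      P (cmp \<Lambda> e \<mu>) = {x \<in> R e \<inter> good. g e x \<in> P \<mu>}"
  proof (rule extend_to_paths[where base = "\<lambda>v. D v \<inter> good" and Z = UNIV and
        step = "\<lambda>e Q. {x \<in> R e \<inter> good. g e x \<in> Q}"])
    \<comment> \<open>\<open>good_square\<close> can be read from either side of the square, so one
      inclusion yields both.\<close>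
    have sub: "{x \<in> R e \<inter> good. g e x \<in> {x \<in> R a \<inter> good. g a x \<in> Q}} \<subseteq>
        {x \<in> R e' \<inter> good. g e' x \<in> {x \<in> R b \<inter> good. g b x \<in> Q}}"
      if e: "e \<in> edges \<Lambda>" "a \<in> edges \<Lambda>" "e' \<in> edges \<Lambda>" "b \<in> edges \<Lambda>"
        and sq: "src \<Lambda> e = rng \<Lambda> a" "src \<Lambda> e' = rng \<Lambda> b" "cmp \<Lambda> e a = cmp \<Lambda> e' b" for e a e' b Q
    proof
      fix x assume "x \<in> {x \<in> R e \<inter> good. g e x \<in> {x \<in> R a \<inter> good. g a x \<in> Q}}"
      then have x: "x \<in> good" "x \<in> R e" "g e x \<in> R a" "g a (g e x) \<in> Q" by simp_all
      note good_square[OF x(1-3) e sq]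
      then show "x \<in> {x \<in> R e' \<inter> good. g e' x \<in> {x \<in> R b \<inter> good. g b x \<in> Q}}"
        using x good_g[OF x(1) e(3)] by simp
    qed
    fix e a e' b Q
    assume "e \<in> edges \<Lambda>" "a \<in> edges \<Lambda>" "e' \<in> edges \<Lambda>" "b \<in> edges \<Lambda>"
      "src \<Lambda> e = rng \<Lambda> a" "src \<Lambda> e' = rng \<Lambda> b" "cmp \<Lambda> e a = cmp \<Lambda> e' b"
    then show "{x \<in> R e \<inter> good. g e x \<in> {x \<in> R a \<inter> good. g a x \<in> Q}} =
        {x \<in> R e' \<inter> good. g e' x \<in> {x \<in> R b \<inter> good. g b x \<in> Q}}"
      by (intro equalityI sub) simp_all
  qed auto
  have Pe: "P e = R e \<inter> good" if e: "e \<in> edges \<Lambda>" for e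
  proof -
    have "P (cmp \<Lambda> e (src \<Lambda> e)) = {x \<in> R e \<inter> good. g e x \<in> D (src \<Lambda> e) \<inter> good}"
      using e Pc[of e "src \<Lambda> e"] Pv[OF edge_src[OF e]] by (simp add: edges_mor src_closed rng_src)
    then show ?thesis using e g_mem good_g by (auto simp: edges_mor cmp_src)
  qed
  have "itineraries \<Lambda> P g"
  proof unfold_locales
    fix e \<mu> assume "e \<in> edges \<Lambda>" "\<mu> \<in> mor \<Lambda>" "src \<Lambda> e = rng \<Lambda> \<mu>"
    then show "P (cmp \<Lambda> e \<mu>) = {x \<in> P e. g e x \<in> P \<mu>}" using Pc Pe by simp
  next
    fix e assume "e \<in> edges \<Lambda>"
    then show "P e \<subseteq> P (rng \<Lambda> e)" using Pe Pv edge_rng good_R_D by auto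
  next
    fix v w assume "v \<in> vertices \<Lambda>" "w \<in> vertices \<Lambda>" "v \<noteq> w"
    moreover have "x \<notin> D v \<inter> D w" if "x \<in> good" for x
      using good_relations[OF that] calculation unfolding relations_at_def by metis
    ultimately show "P v \<inter> P w = {}" by (auto simp: Pv)
  next
    fix e e' i assume e: "e \<in> paths \<Lambda> (axis i 1)" "e' \<in> paths \<Lambda> (axis i 1)" "e \<noteq> e'"
    then have "e \<in> edges \<Lambda>" "e' \<in> edges \<Lambda>" "deg \<Lambda> e = deg \<Lambda> e'" by (auto simp: edges_def paths_def)
    moreover have "x \<notin> R e \<inter> R e'" if "x \<in> good" for x
      using good_relations[OF that] calculation e(3) unfolding relations_at_def by metis
    ultimately show "P e \<inter> P e' = {}" by (auto simp: Pe)
  next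
    fix e e' x
    assume e: "e \<in> edges \<Lambda>" "e' \<in> edges \<Lambda>" "rng \<Lambda> e = rng \<Lambda> e'" "deg \<Lambda> e \<noteq> deg \<Lambda> e'"
      and "x \<in> P e" "x \<in> P e'"
    then have x: "x \<in> good" "x \<in> R e" "x \<in> R e'" by (simp_all add: Pe)
    have fg: "x = f e (g e x)" "x = f e' (g e' x)" using x e good_f_g by simp_all
    \<comment> \<open>By \<open>fg\<close> the point is the image of its two shifts. Disjointness of
      the reduced images therefore puts one shift into some \<open>R \<alpha>\<close> or
      \<open>R \<beta>\<close>; in either case \<open>x\<close> lies in \<open>P\<close> of the
      common composite.\<close>
    have "x \<notin> f e ` (D (src \<Lambda> e) - (\<Union>(\<alpha>, \<beta>)\<in>Lambda_min \<Lambda> e e'. R \<alpha>)) \<inter>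
        f e' ` (D (src \<Lambda> e') - (\<Union>(\<alpha>, \<beta>)\<in>Lambda_min \<Lambda> e e'. R \<beta>))"
      using good_relations[OF x(1)] e unfolding relations_at_def by blast
    then consider \<alpha> \<beta> where "(\<alpha>, \<beta>) \<in> Lambda_min \<Lambda> e e'" "g e x \<in> R \<alpha>"
      | \<alpha> \<beta> where "(\<alpha>, \<beta>) \<in> Lambda_min \<Lambda> e e'" "g e' x \<in> R \<beta>"
      using fg g_mem[OF e(1) x(2)] g_mem[OF e(2) x(3)] by fast
    then show "\<exists>(\<alpha>, \<beta>)\<in>Lambda_min \<Lambda> e e'. x \<in> P (cmp \<Lambda> e \<alpha>)"
    proof cases
      case 1
      have "x \<in> P (cmp \<Lambda> e \<alpha>)"
        using 1 x e good_g Lambda_min_edges[OF e(1,2,4) 1(1)] Lambda_minD(1,3)[OF 1(1)] by (simp add: Pc Pe)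
      then show ?thesis using 1(1) by blast
    next
      case 2
      have "x \<in> P (cmp \<Lambda> e' \<beta>)"
        using 2 x e good_g Lambda_min_edges[OF e(1,2,4) 2(1)] Lambda_minD(2,4)[OF 2(1)] by (simp add: Pc Pe)
      then have "x \<in> P (cmp \<Lambda> e \<alpha>)" using Lambda_minD(5)[OF 2(1)] by simp
      then show ?thesis using 2(1) by blast
    qed
  next
    fix v E assume E: "v \<in> vertices \<Lambda>" "finite E" "E \<subseteq> edges \<Lambda>" "exhaustive \<Lambda> v E"
    have "x \<in> (\<Union>\<mu>\<in>E. R \<mu>) \<longleftrightarrow> x \<in> D v" if "x \<in> good" for x
      using good_relations[OF that] E unfolding relations_at_def by blast
    then show "P v \<subseteq> (\<Union>e\<in>E. P e)" using E Pe Pv by blast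
  qed
  then show ?thesis using Pv Pc that by blast
qed

section \<open>Radon-Nikodym weights of edges and commuting squares\<close>

abbreviation weight :: "'m \<Rightarrow> 'x \<Rightarrow> real" where "weight \<equiv> branching_deriv \<Lambda> M D R f"

lemma weight_nonneg [simp]: "0 \<le> weight e x"
  by (simp add: branching_deriv_def)

lemma weight_measurable: "e \<in> edges \<Lambda> \<Longrightarrow> weight e \<in> borel_measurable (MR e)"
  unfolding branching_deriv_def by measurable

text \<open>The weight is the density on \<open>R e\<close> of the image under \<open>f e\<close>,
  and \<open>g e\<close> carries this image back because it inverts \<open>f e\<close> almost
  everywhere.\<close>

lemma distr_density_weight:
  assumes e: "e \<in> edges \<Lambda>"
  shows "distr (density (MR e) (\<lambda>x. ennreal (weight e x))) (MD e) (g e) = MD e"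
proof -
  note [measurable] = f_measurable[OF e] g_measurable[OF e]
  let ?N = "distr (MD e) (MR e) (f e)"
  interpret MR: sigma_finite_measure "MR e"
    by (rule sigma_finite_measure_restrict_space[OF sigma_finite_measure_axioms R_sets[OF e]])
  interpret MD: sigma_finite_measure "MD e"
    by (rule sigma_finite_measure_restrict_space[OF sigma_finite_measure_axioms D_src_sets[OF e]])
  have "distr ?N (MD e) (g e) = distr (MD e) (MD e) (g e \<circ> f e)"
    by (rule distr_distr) measurable
  also have "\<dots> = distr (MD e) (MD e) (\<lambda>x. x)"
    by (rule distr_cong_AE) (use g_f[OF e] in \<open>auto simp: AE_MD e\<close>)
  finally have 1: "distr ?N (MD e) (g e) = MD e" by simp
  \<comment> \<open>Its image under \<open>g e\<close> is sigma-finite, hence so is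
    \<open>?N\<close>. The derivative is then finite almost everywhere and \<open>enn2real\<close>
    loses nothing.\<close>
  have "sigma_finite_measure ?N"
    by (rule sigma_finite_measure_distr[where f = "g e" and N = "MD e"])
      (auto simp: 1 MD.sigma_finite_measure_axioms)
  then have "AE x in MR e. RN_deriv (MR e) ?N x \<noteq> \<infinity>"
    by (rule MR.RN_deriv_finite[OF _ f_absolutely_continuous[OF e]]) simp
  then have "density (MR e) (\<lambda>x. ennreal (weight e x)) = density (MR e) (RN_deriv (MR e) ?N)"
    using weight_measurable[OF e]
    by (intro density_cong) (auto simp: branching_deriv_def less_top elim!: AE_mp)
  also have "\<dots> = ?N"
    by (rule MR.density_RN_deriv[OF f_absolutely_continuous[OF e]]) simp
  finally show ?thesis using 1 by simp
qed

text \<open>Change of variables \<open>y = g e x\<close>; the norm estimates for edge operators rest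
  on it.\<close>

lemma nn_integral_weight:
  assumes e: "e \<in> edges \<Lambda>" and h: "h \<in> borel_measurable (MD e)"
  shows "(\<integral>\<^sup>+x. ennreal (weight e x) * h (g e x) * indicator (R e) x \<partial>M) =
    (\<integral>\<^sup>+y. h y * indicator (D (src \<Lambda> e)) y \<partial>M)"
proof -
  note [measurable] = g_measurable[OF e] weight_measurable[OF e] h
  have "(\<integral>\<^sup>+y. h y \<partial>MD e) = (\<integral>\<^sup>+y. h y \<partial>distr (density (MR e) (\<lambda>x. ennreal (weight e x))) (MD e) (g e))"
    by (simp add: distr_density_weight[OF e])
  also have "\<dots> = (\<integral>\<^sup>+x. h (g e x) \<partial>density (MR e) (\<lambda>x. ennreal (weight e x)))"
    by (rule nn_integral_distr) measurable
  also have "\<dots> = (\<integral>\<^sup>+x. ennreal (weight e x) * h (g e x) \<partial>MR e)"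
    by (rule nn_integral_density) measurable
  finally show ?thesis using D_src_sets[OF e] R_sets[OF e] by (simp add: nn_integral_restrict_space)
qed

lemma integral_weight:
  fixes h :: "'x \<Rightarrow> complex"
  assumes e: "e \<in> edges \<Lambda>" and h: "h \<in> borel_measurable (MD e)"
  shows "(LINT x|M. indicator (R e) x *\<^sub>R (weight e x *\<^sub>R h (g e x))) =
    (LINT y|M. indicator (D (src \<Lambda> e)) y *\<^sub>R h y)"
proof -
  note [measurable] = g_measurable[OF e] weight_measurable[OF e] h
  have "(LINT y|MD e. h y) = (LINT y|distr (density (MR e) (\<lambda>x. ennreal (weight e x))) (MD e) (g e). h y)"
    by (simp add: distr_density_weight[OF e])
  also have "\<dots> = (LINT x|density (MR e) (\<lambda>x. ennreal (weight e x)). h (g e x))"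
    by (rule integral_distr) measurable
  also have "\<dots> = (LINT x|MR e. weight e x *\<^sub>R h (g e x))"
    by (rule integral_density[OF _ weight_measurable[OF e]]) simp_all
  finally show ?thesis using D_src_sets[OF e] R_sets[OF e] by (simp add: integral_restrict_space)
qed

text \<open>Test the change of variables with the indicator of the points \<open>y\<close> at which
  the weight vanishes at \<open>f e y\<close>: the weighted side is zero, so almost no such
  \<open>y\<close> exist. Pulling back along \<open>g e\<close> gives the claim.\<close>

lemma weight_pos:
  assumes e: "e \<in> edges \<Lambda>"
  shows "AE x in M. x \<in> R e \<longrightarrow> 0 < weight e x"
proof -
  note [measurable] = f_measurable[OF e] g_measurable[OF e] weight_measurable[OF e] R_sets[OF e] D_src_sets[OF e]
  define h where "h y = (if weight e (f e y) = 0 then 1 else 0 :: ennreal)" for y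
  have [measurable]: "h \<in> borel_measurable (MD e)" unfolding h_def by measurable
  have "(\<integral>\<^sup>+y. h y * indicator (D (src \<Lambda> e)) y \<partial>M) =
      (\<integral>\<^sup>+x. ennreal (weight e x) * h (g e x) * indicator (R e) x \<partial>M)"
    by (rule nn_integral_weight[OF e, symmetric]) measurable
  also have "\<dots> = (\<integral>\<^sup>+x. 0 \<partial>M)"
    using f_g[OF e] by (intro nn_integral_cong_AE) (auto simp: h_def split: split_indicator elim!: AE_mp)
  finally have "(\<integral>\<^sup>+y. h y \<partial>MD e) = 0" by (simp add: nn_integral_restrict_space)
  then have "AE y in MD e. h y = 0" by (subst (asm) nn_integral_0_iff_AE) auto
  then have "AE y in M. y \<in> D (src \<Lambda> e) \<longrightarrow> weight e (f e y) \<noteq> 0"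
    by (auto simp: AE_MD[OF e] h_def elim!: AE_mp)
  from AE_g[OF e this] f_g[OF e] show ?thesis
  proof eventually_elim
    case (elim x)
    then show ?case using g_mem[OF e, of x] weight_nonneg[of e x] by (auto simp: order_less_le)
  qed
qed

text \<open>
  Both sides are densities of the same measure, the image under \<open>f\<^sub>e f\<^sub>a\<close> of \<open>M\<close> restricted
  to \<open>D (src \<Lambda> a)\<close>.
\<close>

lemma weight_square:
  assumes e: "e \<in> edges \<Lambda>" "a \<in> edges \<Lambda>" "e' \<in> edges \<Lambda>" "b \<in> edges \<Lambda>"
    and sq: "src \<Lambda> e = rng \<Lambda> a" "src \<Lambda> e' = rng \<Lambda> b" "cmp \<Lambda> e a = cmp \<Lambda> e' b"
  shows "AE x in M. x \<in> R e \<and> g e x \<in> R a \<longrightarrow>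
    weight e x * weight a (g e x) = weight e' x * weight b (g e' x)"
proof -
  \<comment> \<open>Stated for a generic composable pair so that it can be used on both sides of the
    square; the product weight is extended by zero.\<close>
  have two: "u e a \<in> borel_measurable M \<and>
      (\<integral>\<^sup>+x. u e a x * indicator A x \<partial>M) = (\<integral>\<^sup>+y. indicator A (f e (f a y)) * indicator (D (src \<Lambda> a)) y \<partial>M)"
    if u: "u = (\<lambda>e a x. if x \<in> R e then ennreal (weight e x) * (if g e x \<in> R a then ennreal (weight a (g e x)) else 0) else 0)"
      and e: "e \<in> edges \<Lambda>" "a \<in> edges \<Lambda>" "src \<Lambda> e = rng \<Lambda> a" and A: "A \<in> sets M"
    for u e a A
  proof -
    note [measurable] = f_measurable[OF e(1)] g_measurable[OF e(1)] weight_measurable[OF e(1)] R_sets[OF e(1)] D_src_sets[OF e(1)]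
      f_measurable[OF e(2)] g_measurable[OF e(2)] weight_measurable[OF e(2)] R_sets[OF e(2)] D_src_sets[OF e(2)] A
    have fa: "f a y \<in> D (src \<Lambda> e)" if "y \<in> good" "y \<in> D (src \<Lambda> a)" for y
      using f_mem[OF e(2) that(2)] good_R_D[OF good_f[OF that(1) e(2) that(2)] e(2)] e(3) by simp
    \<comment> \<open>Absorbing the inner weight into \<open>h\<close> permits two successive
      changes of variables, along \<open>e\<close> and then along \<open>a\<close>.\<close>
    define h where "h y = (if y \<in> R a then ennreal (weight a y) else 0)" for y
    have h [measurable]: "h \<in> borel_measurable M"
      unfolding h_def by (subst measurable_If_restrict_space_iff) auto
    have hD [measurable]: "h \<in> borel_measurable (MD e)" by (rule measurable_restrict_space1[OF h])
    have "u e a = (\<lambda>x. if x \<in> R e then ennreal (weight e x) * h (g e x) else 0)" by (auto simp: u h_def)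
    then have m: "u e a \<in> borel_measurable M"
      by (simp, subst measurable_If_restrict_space_iff) auto
    have fA: "(\<lambda>y. indicator A (f e y) :: ennreal) \<in> borel_measurable (MD e)"
    proof -
      have "(\<lambda>x. indicator A x :: ennreal) \<in> borel_measurable (MR e)" by (rule measurable_restrict_space1) measurable
      then show ?thesis by (rule measurable_compose[OF f_measurable[OF e(1)]])
    qed
    \<comment> \<open>Extending by zero off \<open>D (src \<Lambda> e)\<close> makes the test
      function measurable on all of \<open>M\<close>.\<close>
    define k where "k z = (if z \<in> D (src \<Lambda> e) then indicator A (f e z) else 0 :: ennreal)" for z
    have k [measurable]: "k \<in> borel_measurable M"
      unfolding k_def using fA by (subst measurable_If_restrict_space_iff) auto
    have "(\<integral>\<^sup>+x. u e a x * indicator A x \<partial>M) =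
        (\<integral>\<^sup>+x. ennreal (weight e x) * (h (g e x) * k (g e x)) * indicator (R e) x \<partial>M)"
      using f_g[OF e(1)] g_mem[OF e(1)]
      by (intro nn_integral_cong_AE) (auto simp: u h_def k_def elim!: AE_mp split: split_indicator)
    also have "\<dots> = (\<integral>\<^sup>+y. h y * k y * indicator (D (src \<Lambda> e)) y \<partial>M)"
      by (rule nn_integral_weight[OF e(1)]) (intro borel_measurable_times_ennreal hD measurable_restrict_space1 k)
    also have "\<dots> = (\<integral>\<^sup>+y. ennreal (weight a y) * k (f a (g a y)) * indicator (R a) y \<partial>M)"
      using f_g[OF e(2)] R_subset_D[OF e(2)]
      by (intro nn_integral_cong_AE) (auto simp: h_def k_def e(3) elim!: AE_mp split: split_indicator)
    also have "\<dots> = (\<integral>\<^sup>+y. k (f a y) * indicator (D (src \<Lambda> a)) y \<partial>M)"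
      by (rule nn_integral_weight[OF e(2)])
        (rule measurable_compose[OF f_measurable[OF e(2)] measurable_restrict_space1[OF k]])
    also have "\<dots> = (\<integral>\<^sup>+y. indicator A (f e (f a y)) * indicator (D (src \<Lambda> a)) y \<partial>M)"
      using AE_good fa by (intro nn_integral_cong_AE) (auto simp: k_def elim!: AE_mp split: split_indicator)
    finally show ?thesis using m by blast
  qed
  define u where "u = (\<lambda>e a x. if x \<in> R e then ennreal (weight e x) * (if g e x \<in> R a then ennreal (weight a (g e x)) else 0) else 0)"
  have s: "src \<Lambda> a = src \<Lambda> b" using src_cmp[of e a] src_cmp[of e' b] e sq by (simp add: edges_mor)
  note ea = two[OF u_def e(1,2) sq(1)] and eb = two[OF u_def e(3,4) sq(2)]
  have m: "u e a \<in> borel_measurable M" "u e' b \<in> borel_measurable M" using ea eb by blast+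
  have "density M (u e a) = density M (u e' b)"
  proof (rule measure_eqI)
    fix A assume "A \<in> sets (density M (u e a))"
    then have A: "A \<in> sets M" by simp
    have "(\<integral>\<^sup>+y. indicator A (f e (f a y)) * indicator (D (src \<Lambda> a)) y \<partial>M) =
      (\<integral>\<^sup>+y. (indicator A (f e' (f b y)) :: ennreal) * indicator (D (src \<Lambda> b)) y \<partial>M)"
      using f_commute[OF e sq] s by (intro nn_integral_cong_AE) (auto elim!: AE_mp split: split_indicator)
    then show "emeasure (density M (u e a)) A = emeasure (density M (u e' b)) A"
      using ea[OF A] eb[OF A] A m by (simp add: emeasure_density)
  qed simp
  \<comment> \<open>On a sigma-finite space equal measures have densities that agree almost
    everywhere.\<close>
  then have "AE x in M. u e a x = u e' b x" using density_unique_iff[OF m] by simp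
  with AE_good show ?thesis
  proof eventually_elim
    case (elim x)
    show ?case
    proof
      assume x: "x \<in> R e \<and> g e x \<in> R a"
      then have "x \<in> R e'" "g e' x \<in> R b" using good_square[OF elim(1) _ _ e sq] by auto
      then show "weight e x * weight a (g e x) = weight e' x * weight b (g e' x)"
        using elim(2) x by (simp add: u_def ennreal_mult'[symmetric])
    qed
  qed
qed

end

section \<open>Operators on square-integrable functions\<close>

text \<open>The map is applied to the chosen representative; \<open>lift_class\<close> shows that
  the choice does not matter for maps respecting almost-everywhere equality.\<close>

definition lift_L2 :: "'x measure \<Rightarrow> (('x \<Rightarrow> complex) \<Rightarrow> 'x \<Rightarrow> complex) \<Rightarrow>
    ('x \<Rightarrow> complex) set \<Rightarrow> ('x \<Rightarrow> complex) set" where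
  "lift_L2 M T = (\<lambda>h\<in>carrier (L2 M). L2_class M (T (L2_rep h)))"

text \<open>Linearity is required pointwise since the intended maps are weighted compositions.
  Stating the norm bound with nonnegative integrals makes square integrability of the image a
  consequence.\<close>

locale L2_contraction =
  fixes M :: "'x measure" and T :: "('x \<Rightarrow> complex) \<Rightarrow> 'x \<Rightarrow> complex"
  assumes T_measurable: "\<phi> \<in> borel_measurable M \<Longrightarrow> T \<phi> \<in> borel_measurable M"
    and T_AE: "\<lbrakk>\<phi> \<in> borel_measurable M; \<psi> \<in> borel_measurable M; AE x in M. \<phi> x = \<psi> x\<rbrakk> \<Longrightarrow>
      AE x in M. T \<phi> x = T \<psi> x"
    and T_add: "T (\<lambda>x. \<phi> x + \<psi> x) = (\<lambda>x. T \<phi> x + T \<psi> x)"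
    and T_scale: "T (\<lambda>x. z * \<phi> x) = (\<lambda>x. z * T \<phi> x)"
    and T_norm: "\<phi> \<in> borel_measurable M \<Longrightarrow>
      (\<integral>\<^sup>+x. ennreal ((cmod (T \<phi> x))\<^sup>2) \<partial>M) \<le> (\<integral>\<^sup>+x. ennreal ((cmod (\<phi> x))\<^sup>2) \<partial>M)"
begin

lemma T_sq: "\<phi> \<in> square_integrable M \<Longrightarrow> T \<phi> \<in> square_integrable M"
  unfolding square_integrable_iff using T_measurable T_norm by (auto intro: le_less_trans)

lemma lift_class:
  assumes "\<phi> \<in> square_integrable M"
  shows "lift_L2 M T (L2_class M \<phi>) = L2_class M (T \<phi>)"
proof -
  have m: "\<phi> \<in> borel_measurable M" using assms by (rule square_integrable_measurable)
  have "L2_class M (T (L2_rep (L2_class M \<phi>))) = L2_class M (T \<phi>)"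
    using m L2_rep_measurable[OF m] L2_rep_AE[OF m] by (simp add: L2_class_eq_iff T_measurable T_AE)
  then show ?thesis using assms by (simp add: lift_L2_def L2_class_mem)
qed

lemma lift_bop: "lift_L2 M T \<in> bounded_operators (L2 M)"
proof -
  interpret H: hilbert_space "L2 M" by (rule hilbert_space_L2)
  show ?thesis
  proof (rule H.bopI[where C = 1])
    fix h assume "h \<in> carrier (L2 M)"
    then obtain \<phi> where \<phi>: "\<phi> \<in> square_integrable M" "h = L2_class M \<phi>" by (rule L2_cases)
    then show "lift_L2 M T h \<in> carrier (L2 M)" by (simp add: lift_class L2_class_mem T_sq)
    have "ennreal ((hnorm (L2 M) (L2_class M (T \<phi>)))\<^sup>2) \<le> ennreal ((hnorm (L2 M) (L2_class M \<phi>))\<^sup>2)"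
      unfolding hnorm_L2[OF \<phi>(1)] hnorm_L2[OF T_sq[OF \<phi>(1)]]
      using \<phi>(1) by (intro T_norm square_integrable_measurable)
    then have "(hnorm (L2 M) (L2_class M (T \<phi>)))\<^sup>2 \<le> (hnorm (L2 M) (L2_class M \<phi>))\<^sup>2"
      by (subst (asm) ennreal_le_iff) auto
    then have "hnorm (L2 M) (L2_class M (T \<phi>)) \<le> hnorm (L2 M) (L2_class M \<phi>)"
      by (rule power2_le_imp_le) (use \<phi> H.nrm_nonneg in \<open>simp add: L2_class_mem\<close>)
    then show "hnorm (L2 M) (lift_L2 M T h) \<le> 1 * hnorm (L2 M) h" using \<phi> by (simp add: lift_class)
    show "lift_L2 M T (z \<odot>\<^bsub>L2 M\<^esub> h) = z \<odot>\<^bsub>L2 M\<^esub> lift_L2 M T h" for z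
      using \<phi> by (simp add: lift_class L2_smult square_integrable_measurable square_integrable_scale T_scale T_measurable)
    fix k assume "k \<in> carrier (L2 M)"
    then obtain \<psi> where \<psi>: "\<psi> \<in> square_integrable M" "k = L2_class M \<psi>" by (rule L2_cases)
    show "lift_L2 M T (h \<oplus>\<^bsub>L2 M\<^esub> k) = lift_L2 M T h \<oplus>\<^bsub>L2 M\<^esub> lift_L2 M T k"
      using \<phi> \<psi> by (simp add: lift_class L2_add square_integrable_measurable square_integrable_add T_add T_measurable)
  qed (simp add: lift_L2_def)
qed

end

lemma operator_eqI:
  assumes "S \<in> bounded_operators (L2 M)" "T \<in> bounded_operators (L2 M)"
    and "\<And>\<phi>. \<phi> \<in> square_integrable M \<Longrightarrow> S (L2_class M \<phi>) = T (L2_class M \<phi>)"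
  shows "S = T"
proof -
  interpret H: hilbert_space "L2 M" by (rule hilbert_space_L2)
  show ?thesis by (rule H.bop_eqI) (use assms in \<open>auto elim: L2_cases\<close>)
qed

section \<open>Projections given by indicators\<close>

definition proj_L2 :: "'x measure \<Rightarrow> 'x set \<Rightarrow> ('x \<Rightarrow> complex) set \<Rightarrow> ('x \<Rightarrow> complex) set" where
  "proj_L2 M Q = lift_L2 M (\<lambda>\<phi> x. indicator Q x * \<phi> x)"

lemma L2_contraction_indicator:
  "Q \<in> sets M \<Longrightarrow> L2_contraction M (\<lambda>\<phi> x. indicator Q x * \<phi> x)"
  by unfold_locales
    (auto simp: distrib_left mult.left_commute elim!: AE_mp intro!: nn_integral_mono split: split_indicator)

lemma proj_bop [simp]: "Q \<in> sets M \<Longrightarrow> proj_L2 M Q \<in> bounded_operators (L2 M)"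
  unfolding proj_L2_def by (rule L2_contraction.lift_bop[OF L2_contraction_indicator])

lemma square_integrable_indicator:
  "\<lbrakk>Q \<in> sets M; \<phi> \<in> square_integrable M\<rbrakk> \<Longrightarrow> (\<lambda>x. indicator Q x * \<phi> x) \<in> square_integrable M"
  by (rule L2_contraction.T_sq[OF L2_contraction_indicator])

lemma proj_class:
  "\<lbrakk>Q \<in> sets M; \<phi> \<in> square_integrable M\<rbrakk> \<Longrightarrow>
    proj_L2 M Q (L2_class M \<phi>) = L2_class M (\<lambda>x. indicator Q x * \<phi> x)"
  unfolding proj_L2_def by (rule L2_contraction.lift_class[OF L2_contraction_indicator])

lemma proj_cong_AE:
  assumes "Q \<in> sets M" "Q' \<in> sets M" "AE x in M. x \<in> Q \<longleftrightarrow> x \<in> Q'"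
  shows "proj_L2 M Q = proj_L2 M Q'"
proof (rule operator_eqI)
  fix \<phi> assume \<phi>: "\<phi> \<in> square_integrable M"
  have "AE x in M. indicator Q x * \<phi> x = indicator Q' x * \<phi> x"
    using assms(3) by eventually_elim (simp add: indicator_def)
  then show "proj_L2 M Q (L2_class M \<phi>) = proj_L2 M Q' (L2_class M \<phi>)"
    using assms \<phi> by (simp add: proj_class L2_class_eq_iff square_integrable_indicator square_integrable_measurable)
qed (use assms in auto)

lemma proj_mult:
  assumes "Q \<in> sets M" "Q' \<in> sets M"
  shows "proj_L2 M Q \<otimes>\<^bsub>operator_algebra (L2 M)\<^esub> proj_L2 M Q' = proj_L2 M (Q \<inter> Q')"
proof -
  interpret H: hilbert_space "L2 M" by (rule hilbert_space_L2)
  show ?thesis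
  proof (rule operator_eqI)
    fix \<phi> assume \<phi>: "\<phi> \<in> square_integrable M"
    have "(\<lambda>x. indicator Q x * (indicator Q' x * \<phi> x)) = (\<lambda>x. indicator (Q \<inter> Q') x * \<phi> x)"
      by (auto split: split_indicator)
    then show "(proj_L2 M Q \<otimes>\<^bsub>operator_algebra (L2 M)\<^esub> proj_L2 M Q') (L2_class M \<phi>) = proj_L2 M (Q \<inter> Q') (L2_class M \<phi>)"
      using assms \<phi> by (simp add: proj_class square_integrable_indicator L2_class_mem)
  qed (use assms in auto)
qed

lemma proj_add:
  assumes "Q \<in> sets M" "Q' \<in> sets M" "AE x in M. x \<notin> Q \<inter> Q'"
  shows "proj_L2 M Q \<oplus>\<^bsub>operator_algebra (L2 M)\<^esub> proj_L2 M Q' = proj_L2 M (Q \<union> Q')"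
proof -
  interpret H: hilbert_space "L2 M" by (rule hilbert_space_L2)
  show ?thesis
  proof (rule operator_eqI)
    fix \<phi> assume \<phi>: "\<phi> \<in> square_integrable M"
    note m = square_integrable_measurable[OF square_integrable_indicator[OF assms(1) \<phi>]]
      square_integrable_measurable[OF square_integrable_indicator[OF assms(2) \<phi>]]
      square_integrable_measurable[OF square_integrable_indicator[OF sets.Un[OF assms(1,2)] \<phi>]]
    have "AE x in M. indicator Q x * \<phi> x + indicator Q' x * \<phi> x = indicator (Q \<union> Q') x * \<phi> x"
      using assms(3) by eventually_elim (auto simp: indicator_def)
    then show "(proj_L2 M Q \<oplus>\<^bsub>operator_algebra (L2 M)\<^esub> proj_L2 M Q') (L2_class M \<phi>) = proj_L2 M (Q \<union> Q') (L2_class M \<phi>)"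
      using assms \<phi> m by (simp add: proj_class L2_class_mem L2_add L2_class_eq_iff)
  qed (use assms in auto)
qed

lemma proj_minus:
  assumes "Q \<in> sets M" "Q' \<in> sets M" "AE x in M. x \<in> Q' \<longrightarrow> x \<in> Q"
  shows "proj_L2 M Q \<ominus>\<^bsub>operator_algebra (L2 M)\<^esub> proj_L2 M Q' = proj_L2 M (Q - Q')"
proof -
  interpret H: hilbert_space "L2 M" by (rule hilbert_space_L2)
  show ?thesis
  proof (rule operator_eqI)
    fix \<phi> assume \<phi>: "\<phi> \<in> square_integrable M"
    note m = square_integrable_indicator[OF assms(1) \<phi>] square_integrable_indicator[OF assms(2) \<phi>]
      square_integrable_indicator[OF sets.Diff[OF assms(1,2)] \<phi>]
    have "AE x in M. indicator Q x * \<phi> x - indicator Q' x * \<phi> x = indicator (Q - Q') x * \<phi> x"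
      using assms(3) by eventually_elim (auto simp: indicator_def)
    then show "(proj_L2 M Q \<ominus>\<^bsub>operator_algebra (L2 M)\<^esub> proj_L2 M Q') (L2_class M \<phi>) = proj_L2 M (Q - Q') (L2_class M \<phi>)"
      using assms \<phi> m square_integrable_measurable[OF square_integrable_diff[OF m(1,2)]]
      by (simp add: H.minus_BH_apply proj_class L2_class_mem L2_minus L2_class_eq_iff square_integrable_measurable)
  qed (use assms in auto)
qed

lemma proj_empty: "proj_L2 M {} = \<zero>\<^bsub>operator_algebra (L2 M)\<^esub>"
proof -
  interpret H: hilbert_space "L2 M" by (rule hilbert_space_L2)
  show ?thesis
    by (rule operator_eqI[of _ M]) (simp_all add: proj_class L2_class_mem, simp add: zero_L2)
qed

lemma star_proj:
  assumes "Q \<in> sets M"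
  shows "star (operator_algebra (L2 M)) (proj_L2 M Q) = proj_L2 M Q"
proof -
  interpret H: hilbert_space "L2 M" by (rule hilbert_space_L2)
  show ?thesis
  proof (rule H.star_eqI)
    fix h k assume "h \<in> carrier (L2 M)" "k \<in> carrier (L2 M)"
    then obtain \<phi> \<psi> where \<phi>: "\<phi> \<in> square_integrable M" "h = L2_class M \<phi>"
      and \<psi>: "\<psi> \<in> square_integrable M" "k = L2_class M \<psi>" by (metis L2_cases)
    have "(\<lambda>x. indicator Q x * \<phi> x * cnj (\<psi> x)) = (\<lambda>x. \<phi> x * cnj (indicator Q x * \<psi> x))"
      by (auto split: split_indicator)
    then show "inner_prod (L2 M) (proj_L2 M Q h) k = inner_prod (L2 M) h (proj_L2 M Q k)"
      using assms \<phi> \<psi> square_integrable_indicator[OF assms]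
      by (simp add: proj_class L2_inner square_integrable_measurable)
  qed (use assms in simp)
qed

lemma finsum_proj:
  assumes "finite I" "\<And>i. i \<in> I \<Longrightarrow> Q i \<in> sets M"
    and "AE x in M. \<forall>i\<in>I. \<forall>j\<in>I. i \<noteq> j \<longrightarrow> x \<notin> Q i \<inter> Q j"
  shows "finsum (operator_algebra (L2 M)) (\<lambda>i. proj_L2 M (Q i)) I = proj_L2 M (\<Union>i\<in>I. Q i)"
proof -
  interpret H: hilbert_space "L2 M" by (rule hilbert_space_L2)
  interpret B: cstar_algebra "operator_algebra (L2 M)" by (rule H.cstar_algebra_BH)
  show ?thesis
    using assms
  proof (induction I)
    case (insert i I)
    have dis: "AE x in M. x \<notin> Q i \<inter> (\<Union>j\<in>I. Q j)"
      using insert.prems(2) by eventually_elim (use insert.hyps in auto)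
    have "finsum (operator_algebra (L2 M)) (\<lambda>i. proj_L2 M (Q i)) I = proj_L2 M (\<Union>i\<in>I. Q i)"
      using insert.prems by (intro insert.IH) (auto elim: AE_mp)
    moreover have "(\<Union>j\<in>I. Q j) \<in> sets M" using insert.hyps insert.prems(1) by (intro sets.finite_UN) auto
    ultimately show ?case
      using insert.hyps insert.prems(1) dis by (simp add: proj_add Pi_def)
  qed (simp add: proj_empty)
qed

section \<open>The Cuntz--Krieger family of a branching system\<close>

context branching
begin

section \<open>Edge operators and their adjoints\<close>

abbreviation "B \<equiv> operator_algebra (L2 M)"

sublocale H: hilbert_space "L2 M" by (rule hilbert_space_L2)
sublocale BL2: cstar_algebra B by (rule H.cstar_algebra_BH)

definition edge_fun :: "'m \<Rightarrow> ('x \<Rightarrow> complex) \<Rightarrow> 'x \<Rightarrow> complex" where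
  "edge_fun e \<phi> x = (if x \<in> R e then complex_of_real (sqrt (weight e x)) * \<phi> (g e x) else 0)"

text \<open>Dividing by the root of the weight at \<open>f e y\<close> takes the place of a second
  Radon-Nikodym derivative, the one along \<open>f e\<close>.\<close>

definition edge_adj :: "'m \<Rightarrow> ('x \<Rightarrow> complex) \<Rightarrow> 'x \<Rightarrow> complex" where
  "edge_adj e \<psi> y = (if y \<in> D (src \<Lambda> e)
     then \<psi> (f e y) / complex_of_real (sqrt (weight e (f e y))) else 0)"

definition edge_op :: "'m \<Rightarrow> ('x \<Rightarrow> complex) set \<Rightarrow> ('x \<Rightarrow> complex) set" where
  "edge_op e = lift_L2 M (edge_fun e)"

lemma measurable_on_R:
  "\<lbrakk>e \<in> edges \<Lambda>; h \<in> borel_measurable (MR e)\<rbrakk> \<Longrightarrow>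
    (\<lambda>x. if x \<in> R e then h x else 0) \<in> borel_measurable M"
  using R_sets by (subst measurable_If_restrict_space_iff) auto

lemma measurable_on_D:
  "\<lbrakk>e \<in> edges \<Lambda>; h \<in> borel_measurable (MD e)\<rbrakk> \<Longrightarrow>
    (\<lambda>x. if x \<in> D (src \<Lambda> e) then h x else 0) \<in> borel_measurable M"
  using D_src_sets by (subst measurable_If_restrict_space_iff) auto

lemma comp_g_measurable: "\<lbrakk>e \<in> edges \<Lambda>; h \<in> borel_measurable M\<rbrakk> \<Longrightarrow> (\<lambda>x. h (g e x)) \<in> borel_measurable (MR e)"
  by (rule measurable_compose[OF g_measurable measurable_restrict_space1])

lemma comp_f_measurable: "\<lbrakk>e \<in> edges \<Lambda>; h \<in> borel_measurable (MR e)\<rbrakk> \<Longrightarrow> (\<lambda>x. h (f e x)) \<in> borel_measurable (MD e)"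
  by (rule measurable_compose[OF f_measurable])

lemma edge_adj_measurable_D:
  assumes "e \<in> edges \<Lambda>" "\<psi> \<in> borel_measurable M"
  shows "(\<lambda>y. \<psi> (f e y) / complex_of_real (sqrt (weight e (f e y)))) \<in> borel_measurable (MD e)"
proof -
  note [measurable] = weight_measurable[OF assms(1)] measurable_restrict_space1[OF assms(2)]
  show ?thesis by (rule comp_f_measurable[OF assms(1)]) measurable
qed

lemma L2_contraction_edge_fun:
  assumes e: "e \<in> edges \<Lambda>"
  shows "L2_contraction M (edge_fun e)"
proof
  fix \<phi> :: "'x \<Rightarrow> complex" assume \<phi> [measurable]: "\<phi> \<in> borel_measurable M"
  note [measurable] = weight_measurable[OF e] comp_g_measurable[OF e \<phi>]
  show "edge_fun e \<phi> \<in> borel_measurable M"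
    unfolding edge_fun_def by (rule measurable_on_R[OF e]) measurable
  have "(\<integral>\<^sup>+x. ennreal ((cmod (edge_fun e \<phi> x))\<^sup>2) \<partial>M) =
      (\<integral>\<^sup>+x. ennreal (weight e x) * ennreal ((cmod (\<phi> (g e x)))\<^sup>2) * indicator (R e) x \<partial>M)"
    by (intro nn_integral_cong)
      (auto simp: edge_fun_def norm_mult power_mult_distrib ennreal_mult'[symmetric])
  also have "\<dots> = (\<integral>\<^sup>+y. ennreal ((cmod (\<phi> y))\<^sup>2) * indicator (D (src \<Lambda> e)) y \<partial>M)"
    by (rule nn_integral_weight[OF e, where h = "\<lambda>y. ennreal ((cmod (\<phi> y))\<^sup>2)"])
      (rule measurable_restrict_space1, measurable)
  also have "\<dots> \<le> (\<integral>\<^sup>+y. ennreal ((cmod (\<phi> y))\<^sup>2) \<partial>M)"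
    by (intro nn_integral_mono) (auto split: split_indicator)
  finally show "(\<integral>\<^sup>+x. ennreal ((cmod (edge_fun e \<phi> x))\<^sup>2) \<partial>M) \<le> (\<integral>\<^sup>+y. ennreal ((cmod (\<phi> y))\<^sup>2) \<partial>M)" .
next
  fix \<phi> \<psi> :: "'x \<Rightarrow> complex" assume "AE x in M. \<phi> x = \<psi> x"
  from AE_g[OF e this] show "AE x in M. edge_fun e \<phi> x = edge_fun e \<psi> x"
    by eventually_elim (simp add: edge_fun_def)
qed (auto simp: edge_fun_def distrib_left)

text \<open>The change of variables, read backwards, introduces exactly the weight by which
  \<open>edge_adj\<close> divides; \<open>weight_pos\<close> justifies the cancellation.\<close>

lemma L2_contraction_edge_adj:
  assumes e: "e \<in> edges \<Lambda>"
  shows "L2_contraction M (edge_adj e)"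
proof
  fix \<psi> :: "'x \<Rightarrow> complex" assume \<psi> [measurable]: "\<psi> \<in> borel_measurable M"
  note m [measurable] = edge_adj_measurable_D[OF e \<psi>]
  show "edge_adj e \<psi> \<in> borel_measurable M"
    unfolding edge_adj_def by (rule measurable_on_D[OF e m])
  define h where "h y = ennreal ((cmod (\<psi> (f e y) / complex_of_real (sqrt (weight e (f e y)))))\<^sup>2)" for y
  have h [measurable]: "h \<in> borel_measurable (MD e)" unfolding h_def by measurable
  have "(\<integral>\<^sup>+x. ennreal ((cmod (edge_adj e \<psi> x))\<^sup>2) \<partial>M) = (\<integral>\<^sup>+y. h y * indicator (D (src \<Lambda> e)) y \<partial>M)"
    by (intro nn_integral_cong) (auto simp: edge_adj_def h_def split: split_indicator)
  also have "\<dots> = (\<integral>\<^sup>+x. ennreal (weight e x) * h (g e x) * indicator (R e) x \<partial>M)"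
    by (rule nn_integral_weight[OF e h, symmetric])
  also have "\<dots> \<le> (\<integral>\<^sup>+x. ennreal ((cmod (\<psi> x))\<^sup>2) \<partial>M)"
  proof (rule nn_integral_mono_AE)
    show "AE x in M. ennreal (weight e x) * h (g e x) * indicator (R e) x \<le> ennreal ((cmod (\<psi> x))\<^sup>2)"
      using f_g[OF e] weight_pos[OF e]
    proof eventually_elim
      case (elim x)
      then show ?case
        by (auto simp: h_def norm_divide power_divide ennreal_mult'[symmetric] split: split_indicator)
    qed
  qed
  finally show "(\<integral>\<^sup>+x. ennreal ((cmod (edge_adj e \<psi> x))\<^sup>2) \<partial>M) \<le> (\<integral>\<^sup>+x. ennreal ((cmod (\<psi> x))\<^sup>2) \<partial>M)" .
next
  fix \<phi> \<psi> :: "'x \<Rightarrow> complex" assume "AE x in M. \<phi> x = \<psi> x"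
  from AE_f[OF e this] show "AE x in M. edge_adj e \<phi> x = edge_adj e \<psi> x"
    by eventually_elim (simp add: edge_adj_def)
qed (auto simp: edge_adj_def add_divide_distrib)

lemmas edge_bop [simp] = L2_contraction.lift_bop[OF L2_contraction_edge_fun, folded edge_op_def]
lemmas edge_class = L2_contraction.lift_class[OF L2_contraction_edge_fun, folded edge_op_def]
lemmas edge_fun_sq = L2_contraction.T_sq[OF L2_contraction_edge_fun]
lemmas edge_adj_sq = L2_contraction.T_sq[OF L2_contraction_edge_adj]

lemma star_edge:
  assumes e: "e \<in> edges \<Lambda>"
  shows "star B (edge_op e) = lift_L2 M (edge_adj e)"
proof (rule H.star_eqI)
  fix h k assume "h \<in> carrier (L2 M)" "k \<in> carrier (L2 M)"
  then obtain \<phi> \<psi> where \<phi>: "\<phi> \<in> square_integrable M" "h = L2_class M \<phi>"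
    and \<psi>: "\<psi> \<in> square_integrable M" "k = L2_class M \<psi>" by (metis L2_cases)
  have [measurable]: "\<phi> \<in> borel_measurable M" "\<psi> \<in> borel_measurable M" "edge_fun e \<phi> \<in> borel_measurable M"
      "edge_adj e \<psi> \<in> borel_measurable M"
    using \<phi>(1) \<psi>(1) e by (simp_all add: square_integrable_measurable edge_fun_sq edge_adj_sq)
  \<comment> \<open>Chosen so that \<open>weight e x\<close> times \<open>u (g e x)\<close> is the
    integrand of the left inner product on \<open>R e\<close>: \<open>f e\<close> undoes
    \<open>g e\<close>, and the weight over its root is the root.\<close>
  define u where "u y = \<phi> y * cnj (\<psi> (f e y) / complex_of_real (sqrt (weight e (f e y))))" for y
  have u: "u \<in> borel_measurable (MD e)"
    unfolding u_def
    by (rule borel_measurable_times[OF measurable_restrict_space1 borel_measurable_cnj[OF edge_adj_measurable_D[OF e]]])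
      measurable
  have "(LINT x|M. edge_fun e \<phi> x * cnj (\<psi> x)) = (LINT x|M. indicator (R e) x *\<^sub>R (weight e x *\<^sub>R u (g e x)))"
  proof (rule integral_cong_AE)
    show "(\<lambda>x. indicator (R e) x *\<^sub>R (weight e x *\<^sub>R u (g e x))) \<in> borel_measurable M"
    proof -
      note [measurable] = weight_measurable[OF e] measurable_compose[OF g_measurable[OF e] u]
      have "(\<lambda>x. if x \<in> R e then weight e x *\<^sub>R u (g e x) else 0) \<in> borel_measurable M"
        by (rule measurable_on_R[OF e]) measurable
      moreover have "(\<lambda>x. if x \<in> R e then weight e x *\<^sub>R u (g e x) else 0) =
          (\<lambda>x. indicator (R e) x *\<^sub>R (weight e x *\<^sub>R u (g e x)))" by (auto simp: indicator_def)
      ultimately show ?thesis by simp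
    qed
    show "AE x in M. edge_fun e \<phi> x * cnj (\<psi> x) = indicator (R e) x *\<^sub>R (weight e x *\<^sub>R u (g e x))"
      using f_g[OF e]
    proof eventually_elim
      case (elim x)
      have "complex_of_real (weight e x) / complex_of_real (sqrt (weight e x)) = complex_of_real (sqrt (weight e x))"
        unfolding of_real_divide[symmetric] by (simp add: real_div_sqrt)
      moreover have "weight e x *\<^sub>R u (g e x) = (complex_of_real (weight e x) /
          complex_of_real (sqrt (weight e x))) * (\<phi> (g e x) * cnj (\<psi> x))" if "x \<in> R e"
        using elim that by (simp add: u_def scaleR_conv_of_real)
      ultimately show ?case by (simp add: edge_fun_def indicator_def mult.assoc)
    qed
  qed measurable
  also have "\<dots> = (LINT y|M. indicator (D (src \<Lambda> e)) y *\<^sub>R u y)" by (rule integral_weight[OF e u])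
  also have "\<dots> = (LINT y|M. \<phi> y * cnj (edge_adj e \<psi> y))"
    by (intro Bochner_Integration.integral_cong) (auto simp: u_def edge_adj_def indicator_def)
  finally show "inner_prod (L2 M) (edge_op e h) k = inner_prod (L2 M) h (lift_L2 M (edge_adj e) k)"
    using \<phi> \<psi> e by (simp add: edge_class L2_contraction.lift_class[OF L2_contraction_edge_adj] L2_inner)
qed (rule L2_contraction.lift_bop[OF L2_contraction_edge_adj[OF e]])

lemma star_edge_class:
  "\<lbrakk>e \<in> edges \<Lambda>; \<psi> \<in> square_integrable M\<rbrakk> \<Longrightarrow> star B (edge_op e) (L2_class M \<psi>) = L2_class M (edge_adj e \<psi>)"
  by (simp add: star_edge L2_contraction.lift_class[OF L2_contraction_edge_adj])

text \<open>At \<open>f e y\<close> the root of the weight cancels its inverse, because positivity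
  on \<open>R e\<close> is pulled back along \<open>f e\<close>.\<close>

lemma edge_isometry:
  assumes e: "e \<in> edges \<Lambda>"
  shows "star B (edge_op e) \<otimes>\<^bsub>B\<^esub> edge_op e = proj_L2 M (D (src \<Lambda> e))"
proof (rule operator_eqI)
  fix \<phi> assume \<phi>: "\<phi> \<in> square_integrable M"
  have "AE x in M. edge_adj e (edge_fun e \<phi>) x = indicator (D (src \<Lambda> e)) x * \<phi> x"
    using AE_f[OF e weight_pos[OF e]] g_f[OF e]
    by eventually_elim (use f_mem[OF e] in \<open>auto simp: edge_adj_def edge_fun_def\<close>)
  then show "(star B (edge_op e) \<otimes>\<^bsub>B\<^esub> edge_op e) (L2_class M \<phi>) = proj_L2 M (D (src \<Lambda> e)) (L2_class M \<phi>)"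
    using e \<phi> D_src_sets[OF e]
    by (simp add: L2_class_mem edge_class star_edge_class edge_fun_sq edge_adj_sq proj_class
        L2_class_eq_iff square_integrable_measurable square_integrable_indicator)
qed (use e D_src_sets[OF e] in auto)

text \<open>Conjugation by an edge operator prepends the edge to an itinerary condition; this drives
  the induction that identifies the range projections of paths.\<close>

lemma edge_conj_proj:
  assumes e: "e \<in> edges \<Lambda>" and Q: "Q \<in> sets M"
  shows "{x \<in> R e. g e x \<in> Q} \<in> sets M"
    and "(edge_op e \<otimes>\<^bsub>B\<^esub> proj_L2 M Q) \<otimes>\<^bsub>B\<^esub> star B (edge_op e) = proj_L2 M {x \<in> R e. g e x \<in> Q}"
proof -
  have "g e -` (Q \<inter> D (src \<Lambda> e)) \<inter> space (MR e) \<in> sets (MR e)"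
    using Q D_src_sets[OF e] by (intro measurable_sets[OF g_measurable[OF e]]) (auto simp: sets_restrict_space_iff)
  then have "g e -` (Q \<inter> D (src \<Lambda> e)) \<inter> R e \<in> sets M"
    using R_sets[OF e] by (simp add: sets_restrict_space_iff space_MR[OF e])
  moreover have "g e -` (Q \<inter> D (src \<Lambda> e)) \<inter> R e = {x \<in> R e. g e x \<in> Q}" using g_mem[OF e] by auto
  ultimately show sets: "{x \<in> R e. g e x \<in> Q} \<in> sets M" by simp
  show "(edge_op e \<otimes>\<^bsub>B\<^esub> proj_L2 M Q) \<otimes>\<^bsub>B\<^esub> star B (edge_op e) = proj_L2 M {x \<in> R e. g e x \<in> Q}"
  proof (rule operator_eqI)
    fix \<phi> assume \<phi>: "\<phi> \<in> square_integrable M"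
    have "AE x in M. edge_fun e (\<lambda>x. indicator Q x * edge_adj e \<phi> x) x = indicator {x \<in> R e. g e x \<in> Q} x * \<phi> x"
      using weight_pos[OF e] f_g[OF e]
      by eventually_elim (use g_mem[OF e] in \<open>auto simp: edge_adj_def edge_fun_def indicator_def\<close>)
    then show "((edge_op e \<otimes>\<^bsub>B\<^esub> proj_L2 M Q) \<otimes>\<^bsub>B\<^esub> star B (edge_op e)) (L2_class M \<phi>) =
        proj_L2 M {x \<in> R e. g e x \<in> Q} (L2_class M \<phi>)"
      using e \<phi> Q sets
      by (simp add: L2_class_mem edge_class star_edge_class edge_fun_sq edge_adj_sq proj_class
          L2_class_eq_iff square_integrable_measurable square_integrable_indicator)
  qed (use e Q sets in auto)
qed

lemma proj_edge:
  assumes e: "e \<in> edges \<Lambda>"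
  shows "proj_L2 M (D (rng \<Lambda> e)) \<otimes>\<^bsub>B\<^esub> edge_op e = edge_op e"
    and "edge_op e \<otimes>\<^bsub>B\<^esub> proj_L2 M (D (src \<Lambda> e)) = edge_op e"
proof -
  have D: "D (rng \<Lambda> e) \<in> sets M" "D (src \<Lambda> e) \<in> sets M"
    using e by (auto intro!: D_sets edge_rng edge_src)
  show "proj_L2 M (D (rng \<Lambda> e)) \<otimes>\<^bsub>B\<^esub> edge_op e = edge_op e"
  proof (rule operator_eqI)
    fix \<phi> assume \<phi>: "\<phi> \<in> square_integrable M"
    have "AE x in M. indicator (D (rng \<Lambda> e)) x * edge_fun e \<phi> x = edge_fun e \<phi> x"
      using R_subset_D[OF e] by eventually_elim (auto simp: edge_fun_def indicator_def)
    then show "(proj_L2 M (D (rng \<Lambda> e)) \<otimes>\<^bsub>B\<^esub> edge_op e) (L2_class M \<phi>) = edge_op e (L2_class M \<phi>)"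
      using e \<phi> D by (simp add: L2_class_mem edge_class edge_fun_sq proj_class
          L2_class_eq_iff square_integrable_measurable square_integrable_indicator)
  qed (use e D in auto)
  show "edge_op e \<otimes>\<^bsub>B\<^esub> proj_L2 M (D (src \<Lambda> e)) = edge_op e"
  proof (rule operator_eqI)
    fix \<phi> assume \<phi>: "\<phi> \<in> square_integrable M"
    have "edge_fun e (\<lambda>x. indicator (D (src \<Lambda> e)) x * \<phi> x) = edge_fun e \<phi>"
      using g_mem[OF e] by (auto simp: edge_fun_def)
    then show "(edge_op e \<otimes>\<^bsub>B\<^esub> proj_L2 M (D (src \<Lambda> e))) (L2_class M \<phi>) = edge_op e (L2_class M \<phi>)"
      using e \<phi> D by (simp add: L2_class_mem edge_class proj_class square_integrable_indicator)
  qed (use e D in auto)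
qed

text \<open>\<open>good_square\<close>, read in both directions, says that the two composites have
  the same support and the same shifted point; \<open>weight_square\<close> says that their weights
  agree.\<close>

lemma edge_op_square:
  assumes e: "e \<in> edges \<Lambda>" "a \<in> edges \<Lambda>" "e' \<in> edges \<Lambda>" "b \<in> edges \<Lambda>"
    and sq: "src \<Lambda> e = rng \<Lambda> a" "src \<Lambda> e' = rng \<Lambda> b" "cmp \<Lambda> e a = cmp \<Lambda> e' b"
  shows "edge_op e \<otimes>\<^bsub>B\<^esub> edge_op a = edge_op e' \<otimes>\<^bsub>B\<^esub> edge_op b"
proof (rule operator_eqI)
  fix \<phi> assume \<phi>: "\<phi> \<in> square_integrable M"
  have "AE x in M. edge_fun e (edge_fun a \<phi>) x = edge_fun e' (edge_fun b \<phi>) x"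
    using weight_square[OF e sq] AE_good
  proof eventually_elim
    case (elim x)
    note 1 = good_square[OF elim(2) _ _ e sq]
      and 2 = good_square[OF elim(2) _ _ e(3,4,1,2) sq(2,1) sq(3)[symmetric]]
    show ?case
    proof (cases "x \<in> R e \<and> g e x \<in> R a")
      case True
      then have *: "x \<in> R e'" "g e' x \<in> R b" "g b (g e' x) = g a (g e x)" using 1 by auto
      have "sqrt (weight e x) * sqrt (weight a (g e x)) = sqrt (weight e' x) * sqrt (weight b (g e' x))"
        using elim(1) True by (simp add: real_sqrt_mult[symmetric])
      then have "complex_of_real (sqrt (weight e x)) * complex_of_real (sqrt (weight a (g e x))) =
          complex_of_real (sqrt (weight e' x)) * complex_of_real (sqrt (weight b (g e' x)))"
        unfolding of_real_mult[symmetric] by simp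
      then show ?thesis using True * by (simp add: edge_fun_def mult.assoc[symmetric])
    next
      case False
      then have "\<not> (x \<in> R e' \<and> g e' x \<in> R b)" using 2 by auto
      then show ?thesis using False by (auto simp: edge_fun_def)
    qed
  qed
  then show "(edge_op e \<otimes>\<^bsub>B\<^esub> edge_op a) (L2_class M \<phi>) = (edge_op e' \<otimes>\<^bsub>B\<^esub> edge_op b) (L2_class M \<phi>)"
    using e \<phi> by (simp add: L2_class_mem edge_class edge_fun_sq L2_class_eq_iff square_integrable_measurable)
qed (use e in auto)

end

context cstar_algebra
begin

lemma mult_zero_right: "a \<in> carrier A \<Longrightarrow> a \<otimes> \<zero> = \<zero>"
  using smult_mult_right[of a "\<zero>" 0] smult_l_null[of "\<zero>"] smult_l_null[of "a \<otimes> \<zero>"] by simp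

lemma mult_zero_left: "a \<in> carrier A \<Longrightarrow> \<zero> \<otimes> a = \<zero>"
  using smult_mult_left[of "\<zero>" a 0] smult_l_null[of "\<zero>"] smult_l_null[of "\<zero> \<otimes> a"] by simp

lemma mult_finsum_mult:
  assumes "finite I" "F \<in> I \<rightarrow> carrier A" "a \<in> carrier A" "b \<in> carrier A"
  shows "(a \<otimes> finsum A F I) \<otimes> b = finsum A (\<lambda>i. (a \<otimes> F i) \<otimes> b) I"
  using assms(1,2)
proof (induction I)
  case empty
  then show ?case using assms(3,4) by (simp add: mult_zero_right mult_zero_left)
next
  case (insert i I)
  have F: "F i \<in> carrier A" "F \<in> I \<rightarrow> carrier A" using insert.prems by auto
  have F': "(\<lambda>i. (a \<otimes> F i) \<otimes> b) \<in> I \<rightarrow> carrier A" using F assms(3,4) by (auto simp: Pi_def)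
  have "(a \<otimes> finsum A F (insert i I)) \<otimes> b = (a \<otimes> F i) \<otimes> b \<oplus> (a \<otimes> finsum A F I) \<otimes> b"
    using insert.hyps F assms(3,4) by (simp add: mult_add_right mult_add_left)
  then show ?case
    using insert.hyps insert.IH F F' assms(3,4) by (subst M.finsum_insert) auto
qed

end

section \<open>The Cuntz-Krieger relations for all paths\<close>

context branching
begin

lemma list_mult_proj:
  assumes "xs \<noteq> []" "\<And>x. x \<in> set xs \<Longrightarrow> Q x \<in> sets M"
  shows "list_mult B (map (\<lambda>x. proj_L2 M (Q x)) xs) = proj_L2 M (\<Inter>x\<in>set xs. Q x) \<and>
    (\<Inter>x\<in>set xs. Q x) \<in> sets M"
  using assms
proof (induction xs rule: list_nonempty_induct)
  case (cons x xs)
  then have IH: "list_mult B (map (\<lambda>x. proj_L2 M (Q x)) xs) = proj_L2 M (\<Inter>x\<in>set xs. Q x)"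
    "(\<Inter>x\<in>set xs. Q x) \<in> sets M" by auto
  obtain y ys where "xs = y # ys" using cons.hyps by (cases xs) auto
  then have "list_mult B (map (\<lambda>x. proj_L2 M (Q x)) (x # xs)) =
      proj_L2 M (Q x) \<otimes>\<^bsub>B\<^esub> list_mult B (map (\<lambda>x. proj_L2 M (Q x)) xs)" by simp
  then show ?case using IH cons.prems by (simp add: proj_mult)
qed simp

text \<open>Left multiplication by edge operators respects commuting squares, so it extends to
  paths. The relations are then reduced to identities between indicator projections, which hold at
  good points.\<close>

lemma ex_cuntz_krieger_family:
  obtains S where "cuntz_krieger_family \<Lambda> B S" "\<And>e. e \<in> edges \<Lambda> \<Longrightarrow> S e = edge_op e"
    "\<And>v. v \<in> vertices \<Lambda> \<Longrightarrow> S v = proj_L2 M (D v)"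
proof -
  obtain S where Sv: "\<And>v. v \<in> vertices \<Lambda> \<Longrightarrow> S v = proj_L2 M (D v)"
    and Sc: "\<And>e \<mu>. \<lbrakk>e \<in> edges \<Lambda>; \<mu> \<in> mor \<Lambda>; src \<Lambda> e = rng \<Lambda> \<mu>\<rbrakk> \<Longrightarrow>
      S (cmp \<Lambda> e \<mu>) = edge_op e \<otimes>\<^bsub>B\<^esub> S \<mu>"
    and S_bop: "\<And>\<mu>. \<mu> \<in> mor \<Lambda> \<Longrightarrow> S \<mu> \<in> bounded_operators (L2 M)"
  proof (rule extend_to_paths[where base = "\<lambda>v. proj_L2 M (D v)" and Z = "bounded_operators (L2 M)"
        and step = "\<lambda>e T. edge_op e \<otimes>\<^bsub>B\<^esub> T"])
    fix e a e' b T
    assume e: "e \<in> edges \<Lambda>" "a \<in> edges \<Lambda>" "e' \<in> edges \<Lambda>" "b \<in> edges \<Lambda>"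
      and sq: "src \<Lambda> e = rng \<Lambda> a" "src \<Lambda> e' = rng \<Lambda> b" "cmp \<Lambda> e a = cmp \<Lambda> e' b"
      and T: "T \<in> bounded_operators (L2 M)"
    have "edge_op e \<otimes>\<^bsub>B\<^esub> (edge_op a \<otimes>\<^bsub>B\<^esub> T) = (edge_op e \<otimes>\<^bsub>B\<^esub> edge_op a) \<otimes>\<^bsub>B\<^esub> T"
      using e T by (intro BL2.mult_assoc[symmetric]) auto
    also have "\<dots> = (edge_op e' \<otimes>\<^bsub>B\<^esub> edge_op b) \<otimes>\<^bsub>B\<^esub> T"
      by (simp only: edge_op_square[OF e sq])
    also have "\<dots> = edge_op e' \<otimes>\<^bsub>B\<^esub> (edge_op b \<otimes>\<^bsub>B\<^esub> T)"
      using e T by (intro BL2.mult_assoc) auto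
    finally show "edge_op e \<otimes>\<^bsub>B\<^esub> (edge_op a \<otimes>\<^bsub>B\<^esub> T) = edge_op e' \<otimes>\<^bsub>B\<^esub> (edge_op b \<otimes>\<^bsub>B\<^esub> T)" .
  qed (auto simp: D_sets)
  note assoc = BL2.mult_assoc[simplified]
  note bop = S_bop H.star_bop[OF S_bop]
  have Se: "S e = edge_op e" if "e \<in> edges \<Lambda>" for e
    using Sc[OF that, of "src \<Lambda> e"] that Sv[OF edge_src[OF that]] proj_edge(2)[OF that]
    by (simp add: edges_mor src_closed rng_src cmp_src)
  have Srng: "proj_L2 M (D (rng \<Lambda> \<mu>)) \<otimes>\<^bsub>B\<^esub> S \<mu> = S \<mu>" if "\<mu> \<in> mor \<Lambda>" for \<mu>
    using that
  proof (induction rule: path_induct)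
    case (vertex v)
    then show ?case by (simp add: Sv proj_mult D_sets vertexD)
  next
    case (cons e \<mu>)
    have "proj_L2 M (D (rng \<Lambda> e)) \<otimes>\<^bsub>B\<^esub> (edge_op e \<otimes>\<^bsub>B\<^esub> S \<mu>) =
        (proj_L2 M (D (rng \<Lambda> e)) \<otimes>\<^bsub>B\<^esub> edge_op e) \<otimes>\<^bsub>B\<^esub> S \<mu>"
      using cons by (intro assoc[symmetric]) (auto simp: D_sets edge_rng S_bop)
    then show ?case using cons by (simp add: Sc rng_cmp edges_mor proj_edge(1))
  qed
  have S_mult: "S (cmp \<Lambda> \<mu> \<nu>) = S \<mu> \<otimes>\<^bsub>B\<^esub> S \<nu>" if "\<mu> \<in> mor \<Lambda>" "\<nu> \<in> mor \<Lambda>" "src \<Lambda> \<mu> = rng \<Lambda> \<nu>" for \<mu> \<nu>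
    using that
  proof (induction rule: path_induct)
    case (vertex v)
    then have "v = rng \<Lambda> \<nu>" by (simp add: vertexD)
    then show ?case using vertex Srng[OF vertex(2)] by (simp add: Sv cmp_rng)
  next
    case (cons e \<mu>)
    have s: "src \<Lambda> \<mu> = rng \<Lambda> \<nu>" using cons src_cmp[of e \<mu>] by (simp add: edges_mor)
    have "cmp \<Lambda> (cmp \<Lambda> e \<mu>) \<nu> = cmp \<Lambda> e (cmp \<Lambda> \<mu> \<nu>)"
      using cons s by (intro cmp_assoc) (auto simp: edges_mor)
    then have "S (cmp \<Lambda> (cmp \<Lambda> e \<mu>) \<nu>) = edge_op e \<otimes>\<^bsub>B\<^esub> (S \<mu> \<otimes>\<^bsub>B\<^esub> S \<nu>)"
      using cons s by (simp add: Sc cmp_closed rng_cmp)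
    also have "\<dots> = (edge_op e \<otimes>\<^bsub>B\<^esub> S \<mu>) \<otimes>\<^bsub>B\<^esub> S \<nu>"
      using cons by (intro assoc[symmetric]) (auto simp: S_bop)
    finally show ?case using cons by (simp add: Sc)
  qed
  \<comment> \<open>The inner edge cancels by \<open>edge_isometry\<close>, and its source
    projection is absorbed by the next path.\<close>
  have isom: "star B (S \<mu>) \<otimes>\<^bsub>B\<^esub> S \<mu> = proj_L2 M (D (src \<Lambda> \<mu>))" if "\<mu> \<in> mor \<Lambda>" for \<mu>
    using that
  proof (induction rule: path_induct)
    case (vertex v)
    then show ?case by (simp add: Sv star_proj proj_mult D_sets vertexD)
  next
    case (cons e \<mu>)
    note b = bop[OF cons(2)] edge_bop[OF cons(1)] H.star_bop[OF edge_bop[OF cons(1)]]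
    have "star B (S (cmp \<Lambda> e \<mu>)) \<otimes>\<^bsub>B\<^esub> S (cmp \<Lambda> e \<mu>) =
        (star B (S \<mu>) \<otimes>\<^bsub>B\<^esub> star B (edge_op e)) \<otimes>\<^bsub>B\<^esub> (edge_op e \<otimes>\<^bsub>B\<^esub> S \<mu>)"
      using cons b by (simp add: Sc BL2.star_mult)
    also have "\<dots> = star B (S \<mu>) \<otimes>\<^bsub>B\<^esub> ((star B (edge_op e) \<otimes>\<^bsub>B\<^esub> edge_op e) \<otimes>\<^bsub>B\<^esub> S \<mu>)"
      using b by (simp add: assoc)
    also have "\<dots> = star B (S \<mu>) \<otimes>\<^bsub>B\<^esub> S \<mu>"
      using cons by (simp add: edge_isometry Srng)
    finally show ?case using cons by (simp add: src_cmp edges_mor)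
  qed
  obtain P where P: "itineraries \<Lambda> P g" and Pv: "\<And>v. v \<in> vertices \<Lambda> \<Longrightarrow> P v = D v \<inter> good"
    and Pc: "\<And>e \<mu>. \<lbrakk>e \<in> edges \<Lambda>; \<mu> \<in> mor \<Lambda>; src \<Lambda> e = rng \<Lambda> \<mu>\<rbrakk> \<Longrightarrow>
      P (cmp \<Lambda> e \<mu>) = {x \<in> R e \<inter> good. g e x \<in> P \<mu>}" using ex_itineraries by blast
  interpret P: itineraries \<Lambda> P g by (rule P)
  \<comment> \<open>\<open>P \<mu>\<close> is built by intersecting with \<open>good\<close>, so it
    need not be measurable; a measurable set with the same good points is carried through the
    induction instead.\<close>
  have "\<exists>Q. Q \<in> sets M \<and> S \<mu> \<otimes>\<^bsub>B\<^esub> star B (S \<mu>) = proj_L2 M Q \<and> (\<forall>x\<in>good. x \<in> Q \<longleftrightarrow> x \<in> P \<mu>)"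
    if "\<mu> \<in> mor \<Lambda>" for \<mu>
    using that
  proof (induction rule: path_induct)
    case (vertex v)
    then show ?case by (intro exI[of _ "D v"]) (simp add: Sv star_proj proj_mult D_sets Pv)
  next
    case (cons e \<mu>)
    note b = bop[OF cons(2)] edge_bop[OF cons(1)] H.star_bop[OF edge_bop[OF cons(1)]]
    obtain Q where Q: "Q \<in> sets M" "S \<mu> \<otimes>\<^bsub>B\<^esub> star B (S \<mu>) = proj_L2 M Q" "\<forall>x\<in>good. x \<in> Q \<longleftrightarrow> x \<in> P \<mu>"
      using cons by blast
    have "S (cmp \<Lambda> e \<mu>) \<otimes>\<^bsub>B\<^esub> star B (S (cmp \<Lambda> e \<mu>)) =
        (edge_op e \<otimes>\<^bsub>B\<^esub> S \<mu>) \<otimes>\<^bsub>B\<^esub> (star B (S \<mu>) \<otimes>\<^bsub>B\<^esub> star B (edge_op e))"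
      using cons b by (simp add: Sc BL2.star_mult)
    also have "\<dots> = (edge_op e \<otimes>\<^bsub>B\<^esub> (S \<mu> \<otimes>\<^bsub>B\<^esub> star B (S \<mu>))) \<otimes>\<^bsub>B\<^esub> star B (edge_op e)"
      using b by (simp add: assoc)
    also have "\<dots> = proj_L2 M {x \<in> R e. g e x \<in> Q}"
      unfolding Q(2) by (rule edge_conj_proj(2)[OF cons(1) Q(1)])
    finally show ?case
      using edge_conj_proj(1)[OF cons(1) Q(1)] Q(3) good_g cons by (intro exI[of _ "{x \<in> R e. g e x \<in> Q}"]) (auto simp: Pc)
  qed
  then obtain Q where Q_sets: "\<And>\<mu>. \<mu> \<in> mor \<Lambda> \<Longrightarrow> Q \<mu> \<in> sets M"
    and Q_proj: "\<And>\<mu>. \<mu> \<in> mor \<Lambda> \<Longrightarrow> S \<mu> \<otimes>\<^bsub>B\<^esub> star B (S \<mu>) = proj_L2 M (Q \<mu>)"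
    and Q_P: "\<And>\<mu> x. \<lbrakk>\<mu> \<in> mor \<Lambda>; x \<in> good\<rbrakk> \<Longrightarrow> x \<in> Q \<mu> \<longleftrightarrow> x \<in> P \<mu>" by metis
  have pi: "(S \<mu> \<otimes>\<^bsub>B\<^esub> star B (S \<mu>)) \<otimes>\<^bsub>B\<^esub> S \<mu> = S \<mu>" if \<mu>: "\<mu> \<in> mor \<Lambda>" for \<mu>
  proof -
    have "(S \<mu> \<otimes>\<^bsub>B\<^esub> star B (S \<mu>)) \<otimes>\<^bsub>B\<^esub> S \<mu> = S \<mu> \<otimes>\<^bsub>B\<^esub> proj_L2 M (D (src \<Lambda> \<mu>))"
      using bop[OF \<mu>] by (simp add: assoc isom[OF \<mu>, symmetric])
    also have "\<dots> = S (cmp \<Lambda> \<mu> (src \<Lambda> \<mu>))"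
      using \<mu> by (simp add: S_mult src_closed rng_src Sv src_vertex)
    finally show ?thesis using \<mu> by (simp add: cmp_src)
  qed
  \<comment> \<open>At good points the intersection is covered by the minimal common extensions, by
    \<open>common_extension\<close>, and they are disjoint because all of them have the same
    degree.\<close>
  have prod: "proj_L2 M (Q \<mu>) \<otimes>\<^bsub>B\<^esub> proj_L2 M (Q \<nu>) =
      finsum B (\<lambda>p. proj_L2 M (Q (cmp \<Lambda> \<mu> (fst p)))) (Lambda_min \<Lambda> \<mu> \<nu>)"
    if \<mu>: "\<mu> \<in> mor \<Lambda>" and \<nu>: "\<nu> \<in> mor \<Lambda>" for \<mu> \<nu>
  proof -
    let ?I = "Lambda_min \<Lambda> \<mu> \<nu>"
    have fin: "finite ?I" by (rule finite_Lambda_min[OF \<mu> \<nu>])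
    have m: "cmp \<Lambda> \<mu> (fst p) \<in> mor \<Lambda>" if "p \<in> ?I" for p
      using that Lambda_minD(1,3)[of "fst p" "snd p" \<mu> \<nu>] \<mu> by (simp add: cmp_closed)
    have dis: "AE x in M. \<forall>p\<in>?I. \<forall>q\<in>?I. p \<noteq> q \<longrightarrow> x \<notin> Q (cmp \<Lambda> \<mu> (fst p)) \<inter> Q (cmp \<Lambda> \<mu> (fst q))"
      using AE_good
    proof eventually_elim
      case (elim x)
      show ?case
      proof (intro ballI impI notI)
        fix p q assume pq: "p \<in> ?I" "q \<in> ?I" "p \<noteq> q" and x: "x \<in> Q (cmp \<Lambda> \<mu> (fst p)) \<inter> Q (cmp \<Lambda> \<mu> (fst q))"
        obtain \<alpha> \<beta> \<alpha>' \<beta>' where p: "p = (\<alpha>, \<beta>)" and q: "q = (\<alpha>', \<beta>')" by (cases p, cases q)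
        note a = Lambda_minD[OF pq(1)[unfolded p]] and a' = Lambda_minD[OF pq(2)[unfolded q]]
        have eq: "cmp \<Lambda> \<mu> \<alpha> = cmp \<Lambda> \<mu> \<alpha>'"
          using P.same_degree_disjoint[OF m[OF pq(1)] m[OF pq(2)], of x] x Q_P[OF m elim] pq a(6) a'(6) p q by auto
        have "\<alpha> = \<alpha>'" by (rule factorize_unique(2)[OF \<mu> a(1,3) \<mu> a'(1,3) eq refl])
        moreover have "cmp \<Lambda> \<nu> \<beta> = cmp \<Lambda> \<nu> \<beta>'" using eq a(5) a'(5) by simp
        then have "\<beta> = \<beta>'" by (rule factorize_unique(2)[OF \<nu> a(2,4) \<nu> a'(2,4) _ refl])
        ultimately show False using pq(3) p q by simp
      qed
    qed
    have "finsum B (\<lambda>p. proj_L2 M (Q (cmp \<Lambda> \<mu> (fst p)))) ?I = proj_L2 M (\<Union>p\<in>?I. Q (cmp \<Lambda> \<mu> (fst p)))"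
      by (rule finsum_proj[OF fin Q_sets[OF m] dis])
    also have "\<dots> = proj_L2 M (Q \<mu> \<inter> Q \<nu>)"
    proof (rule proj_cong_AE)
      show "AE x in M. x \<in> (\<Union>p\<in>?I. Q (cmp \<Lambda> \<mu> (fst p))) \<longleftrightarrow> x \<in> Q \<mu> \<inter> Q \<nu>"
        using AE_good
      proof eventually_elim
        case (elim x)
        have "x \<in> P \<mu> \<and> x \<in> P \<nu> \<longleftrightarrow> (\<exists>p\<in>?I. x \<in> P (cmp \<Lambda> \<mu> (fst p)))"
        proof
          assume "x \<in> P \<mu> \<and> x \<in> P \<nu>"
          then show "\<exists>p\<in>?I. x \<in> P (cmp \<Lambda> \<mu> (fst p))" using P.common_extension[OF \<mu> \<nu>] by force
        next
          assume "\<exists>p\<in>?I. x \<in> P (cmp \<Lambda> \<mu> (fst p))"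
          then obtain \<alpha> \<beta> where ab: "(\<alpha>, \<beta>) \<in> ?I" "x \<in> P (cmp \<Lambda> \<mu> \<alpha>)" by force
          note a = Lambda_minD[OF ab(1)]
          show "x \<in> P \<mu> \<and> x \<in> P \<nu>"
            using P.P_cmp_subset[OF \<mu> a(1,3)] P.P_cmp_subset[OF \<nu> a(2,4)] a(5) ab(2) by auto
        qed
        then show ?case using Q_P[OF m elim] Q_P[OF \<mu> elim] Q_P[OF \<nu> elim] by auto
      qed
    qed (use fin Q_sets m \<mu> \<nu> in auto)
    finally show ?thesis using Q_sets \<mu> \<nu> by (simp add: proj_mult)
  qed
  have "cuntz_krieger_family \<Lambda> B S"
  proof (intro cuntz_krieger_family.intro H.cstar_algebra_BH cuntz_krieger_family_axioms.intro)
    fix \<mu> \<nu> assume \<mu>: "\<mu> \<in> mor \<Lambda>" and \<nu>: "\<nu> \<in> mor \<Lambda>"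
    let ?I = "Lambda_min \<Lambda> \<mu> \<nu>"
    let ?T = "star B (S \<mu>)" and ?U = "S \<nu>"
    have fin: "finite ?I" by (rule finite_Lambda_min[OF \<mu> \<nu>])
    have b: "?T \<in> H.bop" "?U \<in> H.bop" "S \<mu> \<in> H.bop" "star B ?U \<in> H.bop" using bop \<mu> \<nu> by auto
    \<comment> \<open>Range projections are inserted beside both factors so that \<open>prod\<close>
      can turn their product into a sum over \<open>?I\<close>.\<close>
    have T: "?T = ?T \<otimes>\<^bsub>B\<^esub> proj_L2 M (Q \<mu>)"
      using arg_cong[OF pi[OF \<mu>], of "star B"] b Q_sets[OF \<mu>]
      by (simp add: BL2.star_mult Q_proj[OF \<mu>] star_proj)
    have U: "?U = proj_L2 M (Q \<nu>) \<otimes>\<^bsub>B\<^esub> ?U" using pi[OF \<nu>] by (simp add: Q_proj[OF \<nu>])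
    have "?T \<otimes>\<^bsub>B\<^esub> ?U = (?T \<otimes>\<^bsub>B\<^esub> proj_L2 M (Q \<mu>)) \<otimes>\<^bsub>B\<^esub> (proj_L2 M (Q \<nu>) \<otimes>\<^bsub>B\<^esub> ?U)"
      using T U by simp
    also have "\<dots> = (?T \<otimes>\<^bsub>B\<^esub> (proj_L2 M (Q \<mu>) \<otimes>\<^bsub>B\<^esub> proj_L2 M (Q \<nu>))) \<otimes>\<^bsub>B\<^esub> ?U"
      using b Q_sets[OF \<mu>] Q_sets[OF \<nu>] by (simp add: assoc)
    also have "\<dots> = finsum B (\<lambda>p. (?T \<otimes>\<^bsub>B\<^esub> proj_L2 M (Q (cmp \<Lambda> \<mu> (fst p)))) \<otimes>\<^bsub>B\<^esub> ?U) ?I"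
      unfolding prod[OF \<mu> \<nu>]
    proof (rule BL2.mult_finsum_mult[OF fin])
      show "(\<lambda>p. proj_L2 M (Q (cmp \<Lambda> \<mu> (fst p)))) \<in> ?I \<rightarrow> carrier B"
        using \<mu> by (auto intro!: proj_bop Q_sets cmp_closed simp: Lambda_min_def)
    qed (use b in auto)
    \<comment> \<open>Termwise, the projection of the common extension is written through
      \<open>\<mu>\<close> on the left and \<open>\<nu>\<close> on the right. The outer factors
      become source projections, which \<open>S \<alpha>\<close> and the adjoint of
      \<open>S \<beta>\<close> absorb.\<close>
    also have "\<dots> = finsum B (\<lambda>(\<alpha>, \<beta>). S \<alpha> \<otimes>\<^bsub>B\<^esub> star B (S \<beta>)) ?I"
    proof (rule BL2.M.finsum_cong')
      show "(\<lambda>(\<alpha>, \<beta>). S \<alpha> \<otimes>\<^bsub>B\<^esub> star B (S \<beta>)) \<in> ?I \<rightarrow> carrier B"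
        using bop by (auto simp: Lambda_min_def)
      fix p assume p: "p \<in> ?I"
      obtain \<alpha> \<beta> where ab: "p = (\<alpha>, \<beta>)" by (cases p)
      note a = Lambda_minD[OF p[unfolded ab]]
      note ba = bop(1)[OF a(1)] bop(2)[OF a(2)]
      have V: "S (cmp \<Lambda> \<mu> \<alpha>) = S \<mu> \<otimes>\<^bsub>B\<^esub> S \<alpha>" "S (cmp \<Lambda> \<mu> \<alpha>) = ?U \<otimes>\<^bsub>B\<^esub> S \<beta>"
        using S_mult[OF \<mu> a(1,3)] S_mult[OF \<nu> a(2,4)] a(5) by simp_all
      have "proj_L2 M (Q (cmp \<Lambda> \<mu> \<alpha>)) = S (cmp \<Lambda> \<mu> \<alpha>) \<otimes>\<^bsub>B\<^esub> star B (S (cmp \<Lambda> \<mu> \<alpha>))"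
        using \<mu> a by (intro Q_proj[symmetric] cmp_closed)
      also have "\<dots> = (S \<mu> \<otimes>\<^bsub>B\<^esub> S \<alpha>) \<otimes>\<^bsub>B\<^esub> star B (?U \<otimes>\<^bsub>B\<^esub> S \<beta>)"
        using V by simp
      also have "\<dots> = (S \<mu> \<otimes>\<^bsub>B\<^esub> S \<alpha>) \<otimes>\<^bsub>B\<^esub> (star B (S \<beta>) \<otimes>\<^bsub>B\<^esub> star B ?U)"
        using b bop(1)[OF a(2)] by (simp add: BL2.star_mult)
      finally have "(?T \<otimes>\<^bsub>B\<^esub> proj_L2 M (Q (cmp \<Lambda> \<mu> \<alpha>))) \<otimes>\<^bsub>B\<^esub> ?U =
          ((?T \<otimes>\<^bsub>B\<^esub> S \<mu>) \<otimes>\<^bsub>B\<^esub> S \<alpha>) \<otimes>\<^bsub>B\<^esub> (star B (S \<beta>) \<otimes>\<^bsub>B\<^esub> (star B ?U \<otimes>\<^bsub>B\<^esub> ?U))"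
        using b ba by (simp add: assoc)
      also have "(?T \<otimes>\<^bsub>B\<^esub> S \<mu>) \<otimes>\<^bsub>B\<^esub> S \<alpha> = S \<alpha>"
        using isom[OF \<mu>] Srng[OF a(1)] a(3) by simp
      also have "star B (S \<beta>) \<otimes>\<^bsub>B\<^esub> (star B ?U \<otimes>\<^bsub>B\<^esub> ?U) = star B (S \<beta>)"
      proof -
        have D: "D (rng \<Lambda> \<beta>) \<in> sets M" using a(2) by (intro D_sets rng_vertex)
        have "star B (proj_L2 M (D (rng \<Lambda> \<beta>)) \<otimes>\<^bsub>B\<^esub> S \<beta>) = star B (S \<beta>) \<otimes>\<^bsub>B\<^esub> proj_L2 M (D (rng \<Lambda> \<beta>))"
          using D bop(1)[OF a(2)] by (simp add: BL2.star_mult star_proj)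
        then show ?thesis using Srng[OF a(2)] isom[OF \<nu>] a(4) by simp
      qed
      finally show "(?T \<otimes>\<^bsub>B\<^esub> proj_L2 M (Q (cmp \<Lambda> \<mu> (fst p)))) \<otimes>\<^bsub>B\<^esub> ?U =
          (case p of (\<alpha>, \<beta>) \<Rightarrow> S \<alpha> \<otimes>\<^bsub>B\<^esub> star B (S \<beta>))"
        using ab by simp
    qed simp
    finally show "?T \<otimes>\<^bsub>B\<^esub> ?U = finsum B (\<lambda>(\<alpha>, \<beta>). S \<alpha> \<otimes>\<^bsub>B\<^esub> star B (S \<beta>)) ?I" .
  next
    fix v \<mu>s assume v: "v \<in> vertices \<Lambda>" and ex: "exhaustive \<Lambda> v (set \<mu>s)" and dist: "distinct \<mu>s"
    have m: "\<mu> \<in> mor \<Lambda>" "rng \<Lambda> \<mu> = v" if "\<mu> \<in> set \<mu>s" for \<mu> using ex that by (auto simp: exhaustive_def)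
    \<comment> \<open>An exhaustive set must contain a path compatible with \<open>v\<close> itself;
      this excludes the undefined empty product.\<close>
    have ne: "\<mu>s \<noteq> []" using ex v vertexD[OF v] by (auto simp: exhaustive_def paths_def)
    have sets: "D v - Q \<mu> \<in> sets M" if "\<mu> \<in> set \<mu>s" for \<mu> using D_sets[OF v] Q_sets[OF m(1)[OF that]] by auto
    have "map (\<lambda>\<mu>. S v \<ominus>\<^bsub>B\<^esub> S \<mu> \<otimes>\<^bsub>B\<^esub> star B (S \<mu>)) \<mu>s = map (\<lambda>\<mu>. proj_L2 M (D v - Q \<mu>)) \<mu>s"
    proof (rule map_cong[OF refl])
      fix \<mu> assume \<mu>: "\<mu> \<in> set \<mu>s"
      have "AE x in M. x \<in> Q \<mu> \<longrightarrow> x \<in> D v"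
        using AE_good by eventually_elim (use Q_P m[OF \<mu>] P.P_rng[OF m(1)[OF \<mu>]] Pv[OF v] in auto)
      then show "S v \<ominus>\<^bsub>B\<^esub> S \<mu> \<otimes>\<^bsub>B\<^esub> star B (S \<mu>) = proj_L2 M (D v - Q \<mu>)"
        unfolding Sv[OF v] Q_proj[OF m(1)[OF \<mu>]] by (rule proj_minus[OF D_sets[OF v] Q_sets[OF m(1)[OF \<mu>]]])
    qed
    then have "list_mult B (map (\<lambda>\<mu>. S v \<ominus>\<^bsub>B\<^esub> S \<mu> \<otimes>\<^bsub>B\<^esub> star B (S \<mu>)) \<mu>s) =
        proj_L2 M (\<Inter>\<mu>\<in>set \<mu>s. D v - Q \<mu>)" "(\<Inter>\<mu>\<in>set \<mu>s. D v - Q \<mu>) \<in> sets M"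
      using list_mult_proj[of \<mu>s "\<lambda>\<mu>. D v - Q \<mu>", OF ne sets] by (simp_all only:)
    \<comment> \<open>By \<open>P_exhaustive\<close> a good point of \<open>D v\<close> lies in some
      \<open>Q \<mu>\<close>. Points off \<open>D v\<close> lie in none of the sets, and the list is
      nonempty.\<close>
    moreover have "AE x in M. x \<in> (\<Inter>\<mu>\<in>set \<mu>s. D v - Q \<mu>) \<longleftrightarrow> x \<in> {}"
      using AE_good
    proof eventually_elim
      case (elim x)
      have "x \<in> P v \<longleftrightarrow> (\<exists>\<mu>\<in>set \<mu>s. x \<in> P \<mu>)" using P.P_exhaustive[OF v _ ex] by auto
      then show ?case using Pv[OF v] elim Q_P[OF m(1) elim] ne by (cases \<mu>s) auto
    qed
    ultimately show "list_mult B (map (\<lambda>\<mu>. S v \<ominus>\<^bsub>B\<^esub> S \<mu> \<otimes>\<^bsub>B\<^esub> star B (S \<mu>)) \<mu>s) = \<zero>\<^bsub>B\<^esub>"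
      using proj_cong_AE[of "\<Inter>\<mu>\<in>set \<mu>s. D v - Q \<mu>" M "{}"] proj_empty[of M] by simp
  next
    fix v w assume vw: "v \<in> vertices \<Lambda>" "w \<in> vertices \<Lambda>" "v \<noteq> w"
    have "proj_L2 M (D v \<inter> D w) = proj_L2 M {}"
      by (rule proj_cong_AE) (use vw D_sets D_disjoint[OF vw] in auto)
    then show "S v \<otimes>\<^bsub>B\<^esub> S w = \<zero>\<^bsub>B\<^esub>" using vw by (simp add: Sv proj_mult D_sets proj_empty)
  qed (use S_bop pi S_mult in \<open>auto simp: Sv star_proj proj_mult D_sets\<close>)
  then show ?thesis using that Se Sv by blast
qed

end

theorem theorem3p5:
  fixes \<Lambda> :: "('m, 'k::finite) kgraph"
    and A :: "'a cstar" and s :: "'m \<Rightarrow> 'a"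
    and M :: "'x measure"
    and D R :: "'m \<Rightarrow> 'x set" and f g :: "'m \<Rightarrow> 'x \<Rightarrow> 'x"
  assumes "finitely_aligned_k_graph \<Lambda>"
    and "graph_cstar_algebra TYPE(('x \<Rightarrow> complex) set \<Rightarrow> ('x \<Rightarrow> complex) set) \<Lambda> A s"
    and "sigma_finite_measure M"
    and "branching_system \<Lambda> M D R f g"
  shows "\<exists>!\<pi>. \<pi> \<in> star_hom A (operator_algebra (L2 M)) \<and>
    (\<forall>\<mu>\<in>edges \<Lambda>. \<forall>\<phi>\<in>square_integrable M.
       \<pi> (s \<mu>) (L2_class M \<phi>) =
         L2_class M (\<lambda>x. if x \<in> R \<mu> then
           complex_of_real (sqrt (branching_deriv \<Lambda> M D R f \<mu> x)) * \<phi> (g \<mu> x) else 0)) \<and>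
    (\<forall>v\<in>vertices \<Lambda>. \<forall>\<phi>\<in>square_integrable M.
       \<pi> (s v) (L2_class M \<phi>) = L2_class M (\<lambda>x. indicator (D v) x * \<phi> x))"
proof -
  interpret branching \<Lambda> M D R f g
    by (intro branching.intro assms)
  interpret A: cuntz_krieger_family \<Lambda> A s using assms(2) by (simp add: graph_cstar_algebra_def)
  have gen: "generates A (s ` mor \<Lambda>)" using assms(2) by (simp add: graph_cstar_algebra_def)
  obtain S where S: "cuntz_krieger_family \<Lambda> B S" and Se: "\<And>e. e \<in> edges \<Lambda> \<Longrightarrow> S e = edge_op e"
    and Sv: "\<And>v. v \<in> vertices \<Lambda> \<Longrightarrow> S v = proj_L2 M (D v)"
    using ex_cuntz_krieger_family by blast
  interpret S: cuntz_krieger_family \<Lambda> B S by (rule S)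
  \<comment> \<open>The universal property is available exactly at the type of maps between
    \<open>L2\<close> classes, where \<open>B\<close> lives.\<close>
  obtain \<pi> where \<pi>: "\<pi> \<in> star_hom A B" and \<pi>_s: "\<And>\<mu>. \<mu> \<in> mor \<Lambda> \<Longrightarrow> \<pi> (s \<mu>) = S \<mu>"
    using assms(2) S unfolding graph_cstar_algebra_def by blast
  have edge_eq: "(\<lambda>x. if x \<in> R \<mu> then complex_of_real (sqrt (weight \<mu> x)) * \<phi> (g \<mu> x) else 0) = edge_fun \<mu> \<phi>"
    for \<mu> \<phi> by (simp add: edge_fun_def fun_eq_iff)
  show ?thesis
    unfolding edge_eq
  proof (rule ex1I[of _ \<pi>], intro conjI ballI)
    fix \<mu> \<phi> assume "\<mu> \<in> edges \<Lambda>" "\<phi> \<in> square_integrable M"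
    then show "\<pi> (s \<mu>) (L2_class M \<phi>) = L2_class M (edge_fun \<mu> \<phi>)"
      by (simp add: \<pi>_s edges_mor Se edge_class)
  next
    fix v \<phi> assume "v \<in> vertices \<Lambda>" "\<phi> \<in> square_integrable M"
    then show "\<pi> (s v) (L2_class M \<phi>) = L2_class M (\<lambda>x. indicator (D v) x * \<phi> x)"
      by (simp add: \<pi>_s vertex_mor Sv proj_class D_sets)
  next
    fix \<rho> assume \<rho>: "\<rho> \<in> star_hom A B \<and>
      (\<forall>\<mu>\<in>edges \<Lambda>. \<forall>\<phi>\<in>square_integrable M. \<rho> (s \<mu>) (L2_class M \<phi>) = L2_class M (edge_fun \<mu> \<phi>)) \<and>
      (\<forall>v\<in>vertices \<Lambda>. \<forall>\<phi>\<in>square_integrable M.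
        \<rho> (s v) (L2_class M \<phi>) = L2_class M (\<lambda>x. indicator (D v) x * \<phi> x))"
    have \<rho>_bop: "\<rho> (s \<mu>) \<in> bounded_operators (L2 M)" if "\<mu> \<in> mor \<Lambda>" for \<mu>
      using \<rho> A.S_closed[OF that] by (auto simp: star_hom_def)
    \<comment> \<open>Only edges and vertices are prescribed; multiplicativity propagates the values
      to all paths, whose images generate.\<close>
    have "\<rho> (s \<mu>) = S \<mu>" if "\<mu> \<in> mor \<Lambda>" for \<mu>
      using that
    proof (induction rule: path_induct)
      case (vertex v)
      then show ?case
        using \<rho> by (intro operator_eqI[OF \<rho>_bop]) (auto simp: vertex_mor Sv proj_class D_sets)
    next
      case (cons e \<mu>)
      have "\<rho> (s e) = edge_op e"
        using \<rho> cons(1) by (intro operator_eqI[OF \<rho>_bop]) (auto simp: edges_mor edge_class)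
      moreover have "\<rho> (s e \<otimes>\<^bsub>A\<^esub> s \<mu>) = \<rho> (s e) \<otimes>\<^bsub>B\<^esub> \<rho> (s \<mu>)"
        using \<rho> A.S_closed cons by (auto simp: star_hom_def edges_mor)
      ultimately show ?case
        using cons by (simp add: A.S_cmp S.S_cmp edges_mor Se)
    qed
    then show "\<rho> = \<pi>"
      using \<rho> \<pi> \<pi>_s by (intro star_hom_unique[OF A.cstar_algebra_axioms hilbert_space_L2 gen]) auto
  qed (rule \<pi>)
qed

end
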